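(* Let $N\ge2$ and let $A\in M_N(\{0,1\})$ be primitive. The action $\varphi_A$ of $\mathbb G_A^\infty$ on $O_A$ preserves the path space $\Sigma_A$, i.e. $\varphi_A(C(\Sigma_A))\subset C(\mathbb G_A^\infty)\otimes C(\Sigma_A)$. In particular, for the matrix $\mathbf 1_N$ with all entries equal to $1$, the non-classical compact matrix quantum group $\mathbb G_{\mathbf 1_N}^\infty$ (i.e. with $C(\mathbb G_{\mathbf 1_N}^\infty)$ noncommutative) acts ergodically on the Cantor set $\Sigma_{\mathbf 1_N}$: the restriction $\varphi:C(\Sigma_{\mathbf 1_N})\to C(\mathbb G_{\mathbf 1_N}^\infty)\otimes C(\Sigma_{\mathbf 1_N})$ of $\varphi_{\mathbf 1_N}$ is an action and $\{f\in C(\Sigma_{\mathbf 1_N}):\varphi(f)=1\otimes f\}=\mathbb C1$.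
   Context: $A\in M_N(\{0,1\})$ primitive means some power of $A$ has strictly positive entries. $\vec u$ is the right Perron--Frobenius eigenvector of $A$ (eigenvector of the maximal eigenvalue, with positive entries summing to $1$). A word $x_1\cdots x_k$ over $\{1,\dots,N\}$ is admissible if $A_{x_i,x_{i+1}}=1$ for all $i$; $V_A^k$ is the set of admissible words of length $k$, $V_A$ the set of all admissible words (including the empty one). $O_A$ is the universal $C^*$-algebra generated by $S_1,\dots,S_N$ with $\sum_jS_jS_j^*=1$ and $S_i^*S_k=\delta_{ik}\sum_jA_{ij}S_jS_j^*$; $S_\alpha=S_{\alpha_1}\cdots S_{\alpha_n}$. $\Sigma_A=\{x\in\{1,\dots,N\}^{\mathbb N}:A_{x_n,x_{n+1}}=1\ \forall n\}$ and $C(\Sigma_A)$ is identified with the closed span of $\{S_\alpha S_\alpha^*:\alpha\in V_A\}\subset O_A$, where $S_\alpha S_\alpha^*$ corresponds to the characteristic function of the cylinder set of sequences starting with $\alpha$. A magic unitary is a square matrix of projections in a unital $C^*$-algebra with all rows and columns summing to $1$. $C(\mathbb G_A^\infty)$ is the universal unital $C^*$-algebra generated by partial isometries $(u_{\alpha,\beta})_{1\le\alpha,\beta\le N}$ such that, with $p_{\alpha,\beta}=u_{\alpha,\beta}u_{\alpha,\beta}^*$ and $q_{\alpha,\beta}=u_{\alpha,\beta}^*u_{\alpha,\beta}$: (I) $p,q$ are magic unitaries with $p\vec u=\vec u1=q\vec u$; (II) $Ap=qA$; (III) for all $n\in\mathbb N$ and $\alpha,\beta\in V_A^n$, $u_{\alpha_1,\beta_1}\cdots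 u_{\alpha_n,\beta_n}$ is a partial isometry. It is a compact matrix quantum group with coproduct $\Phi_A(u_{\alpha,\beta})=\sum_\gamma u_{\alpha,\gamma}\otimes u_{\gamma,\beta}$, acting on $O_A$ by $\varphi_A(S_\alpha)=\sum_{\alpha'=1}^Nu_{\alpha,\alpha'}\otimes S_{\alpha'}$. An action of a compact quantum group $\mathbb G=(C(\mathbb G),\Phi)$ on a unital $C^*$-algebra $B$ is a unital $*$-homomorphism $\varphi:B\to C(\mathbb G)\otimes B$ with $(\Phi\otimes\mathrm{id})\varphi=(\mathrm{id}\otimes\varphi)\varphi$ and $\varphi(B)(C(\mathbb G)\otimes1)$ having dense span in $C(\mathbb G)\otimes B$. Tensor products are minimal. *)

theory Defs
  imports "HOL-Analysis.Analysis"
begin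

section \<open>Complex vector spaces\<close>

class complex_vector = real_vector +
  fixes scaleC :: "complex \<Rightarrow> 'a \<Rightarrow> 'a" (infixr "*\<^sub>C" 75)
  assumes scaleC_add_right: "c *\<^sub>C (x + y) = c *\<^sub>C x + c *\<^sub>C y"
    and scaleC_add_left: "(c + d) *\<^sub>C x = c *\<^sub>C x + d *\<^sub>C x"
    and scaleC_scaleC: "c *\<^sub>C d *\<^sub>C x = (c * d) *\<^sub>C x"
    and scaleC_one: "1 *\<^sub>C x = x"
    and scaleR_scaleC: "r *\<^sub>R x = complex_of_real r *\<^sub>C x"

interpretation complex_vector: vector_space "scaleC :: complex \<Rightarrow> 'a \<Rightarrow> 'a::complex_vector"
  by standard (simp_all add: scaleC_add_right scaleC_add_left scaleC_scaleC scaleC_one)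

abbreviation cspan :: "'a::complex_vector set \<Rightarrow> 'a set" where
  "cspan \<equiv> complex_vector.span"


section \<open>The Hilbert space of square-summable families\<close>

typedef 'a ell2 = "{x :: 'a \<Rightarrow> complex. (\<lambda>i. (cmod (x i))\<^sup>2) summable_on UNIV}"
  morphisms coord Abs_ell2
  by (rule exI[of _ "\<lambda>_. 0"]) simp

setup_lifting type_definition_ell2

lemma coord_summable: "(\<lambda>i. (cmod (coord x i))\<^sup>2) summable_on UNIV"
  using coord[of x] by simp

lemma ell2_eqI: "(\<And>i. coord x i = coord y i) \<Longrightarrow> x = y"
  by (simp add: coord_inject[symmetric] fun_eq_iff)

lemma summable_sq_add:
  fixes x y :: "'a \<Rightarrow> complex"
  assumes "(\<lambda>i. (cmod (x i))\<^sup>2) summable_on UNIV" "(\<lambda>i. (cmod (y i))\<^sup>2) summable_on UNIV"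
  shows "(\<lambda>i. (cmod (x i + y i))\<^sup>2) summable_on UNIV"
proof (rule summable_on_comparison_test)
  show "(\<lambda>i. 2 * (cmod (x i))\<^sup>2 + 2 * (cmod (y i))\<^sup>2) summable_on UNIV"
    by (intro summable_on_add summable_on_cmult_right assms)
  show "(cmod (x i + y i))\<^sup>2 \<le> 2 * (cmod (x i))\<^sup>2 + 2 * (cmod (y i))\<^sup>2" for i
  proof -
    have "(cmod (x i + y i))\<^sup>2 \<le> (cmod (x i) + cmod (y i))\<^sup>2"
      by (intro power_mono norm_triangle_ineq) simp
    also have "\<dots> \<le> 2 * (cmod (x i))\<^sup>2 + 2 * (cmod (y i))\<^sup>2"
      using zero_le_power2[of "cmod (x i) - cmod (y i)"]
      by (simp add: power2_eq_square algebra_simps)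
    finally show ?thesis .
  qed
qed simp

lemma summable_sq_scale:
  fixes x :: "'a \<Rightarrow> complex"
  assumes "(\<lambda>i. (cmod (x i))\<^sup>2) summable_on UNIV"
  shows "(\<lambda>i. (cmod (c * x i))\<^sup>2) summable_on UNIV"
  using summable_on_cmult_right[OF assms, of "(cmod c)\<^sup>2"]
  by (simp add: norm_mult power_mult_distrib)

lemma summable_sq_product:
  fixes x y :: "'a \<Rightarrow> complex"
  assumes "(\<lambda>i. (cmod (x i))\<^sup>2) summable_on UNIV" "(\<lambda>i. (cmod (y i))\<^sup>2) summable_on UNIV"
  shows "(\<lambda>i. cnj (x i) * y i) summable_on UNIV"
proof -
  have "(\<lambda>i. norm (cnj (x i) * y i)) summable_on UNIV"
    by (rule abs_summable_product) (use assms in \<open>simp_all add: norm_mult power2_eq_square\<close>)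
  then show ?thesis
    by (rule abs_summable_summable)
qed

instantiation ell2 :: (type) complex_vector
begin
lift_definition zero_ell2 :: "'a ell2" is "\<lambda>_. 0" by simp
lift_definition plus_ell2 :: "'a ell2 \<Rightarrow> 'a ell2 \<Rightarrow> 'a ell2" is "\<lambda>x y i. x i + y i"
  by (simp add: summable_sq_add)
lift_definition uminus_ell2 :: "'a ell2 \<Rightarrow> 'a ell2" is "\<lambda>x i. - x i" by simp
lift_definition minus_ell2 :: "'a ell2 \<Rightarrow> 'a ell2 \<Rightarrow> 'a ell2" is "\<lambda>x y i. x i - y i"
  subgoal for x y using summable_sq_add[of x "\<lambda>i. - y i"] by simp
  done
lift_definition scaleC_ell2 :: "complex \<Rightarrow> 'a ell2 \<Rightarrow> 'a ell2" is "\<lambda>c x i. c * x i"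
  by (simp add: summable_sq_scale)
lift_definition scaleR_ell2 :: "real \<Rightarrow> 'a ell2 \<Rightarrow> 'a ell2" is "\<lambda>r x i. complex_of_real r * x i"
  by (simp add: summable_sq_scale)
instance
  by standard (transfer; simp add: fun_eq_iff algebra_simps)+
end

definition cinner :: "'a ell2 \<Rightarrow> 'a ell2 \<Rightarrow> complex" where
  "cinner x y = (\<Sum>\<^sub>\<infinity>i. cnj (coord x i) * coord y i)"

lemma cinner_summable: "(\<lambda>i. cnj (coord x i) * coord y i) summable_on UNIV"
  by (intro summable_sq_product coord_summable)

lemma cinner_commute: "cinner y x = cnj (cinner x y)"
  unfolding cinner_def infsum_cnj[symmetric] by (simp add: mult.commute)

lemma cinner_add_left: "cinner (x + y) z = cinner x z + cinner y z"
  unfolding cinner_def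
  by (subst infsum_add[symmetric])
     (simp_all add: cinner_summable plus_ell2.rep_eq distrib_right)

lemma cinner_scaleC_left: "cinner (c *\<^sub>C x) y = cnj c * cinner x y"
  unfolding cinner_def
  by (subst infsum_cmult_right'[symmetric]) (simp add: scaleC_ell2.rep_eq mult.assoc)

lemma cinner_self: "cinner x x = complex_of_real (\<Sum>\<^sub>\<infinity>i. (cmod (coord x i))\<^sup>2)"
proof -
  have "((\<lambda>i. complex_of_real ((cmod (coord x i))\<^sup>2)) has_sum
      complex_of_real (\<Sum>\<^sub>\<infinity>i. (cmod (coord x i))\<^sup>2)) UNIV"
    by (intro has_sum_of_real has_sum_infsum coord_summable)
  then show ?thesis
    unfolding cinner_def complex_norm_square by (intro infsumI) (simp add: mult.commute)
qed

instantiation ell2 :: (type) real_inner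
begin
definition inner_ell2 :: "'a ell2 \<Rightarrow> 'a ell2 \<Rightarrow> real" where
  "inner_ell2 x y = Re (cinner x y)"
definition norm_ell2 :: "'a ell2 \<Rightarrow> real" where
  "norm_ell2 x = sqrt (inner x x)"
definition dist_ell2 :: "'a ell2 \<Rightarrow> 'a ell2 \<Rightarrow> real" where
  "dist_ell2 x y = norm (x - y)"
definition sgn_ell2 :: "'a ell2 \<Rightarrow> 'a ell2" where
  "sgn_ell2 x = x /\<^sub>R norm x"
definition uniformity_ell2 :: "('a ell2 \<times> 'a ell2) filter" where
  "uniformity_ell2 = (INF e\<in>{0<..}. principal {(x, y). dist x y < e})"
definition open_ell2 :: "'a ell2 set \<Rightarrow> bool" where
  "open_ell2 U \<longleftrightarrow> (\<forall>x\<in>U. \<forall>\<^sub>F (x', y) in uniformity. x' = x \<longrightarrow> y \<in> U)"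
instance
proof
  fix x y z :: "'a ell2" and r :: real and U :: "'a ell2 set"
  show "inner x y = inner y x"
    unfolding inner_ell2_def by (subst cinner_commute) simp
  show "inner (x + y) z = inner x z + inner y z"
    unfolding inner_ell2_def by (simp add: cinner_add_left)
  show "inner (r *\<^sub>R x) y = r * inner x y"
    unfolding inner_ell2_def by (simp add: scaleR_scaleC cinner_scaleC_left)
  show "0 \<le> inner x x"
    unfolding inner_ell2_def by (simp add: cinner_self infsum_nonneg)
  show "(inner x x = 0) = (x = 0)"
  proof
    assume "inner x x = 0"
    then have 0: "(\<Sum>\<^sub>\<infinity>i. (cmod (coord x i))\<^sup>2) = 0"
      by (simp add: inner_ell2_def cinner_self)
    have "(cmod (coord x i))\<^sup>2 = 0" for i
      by (rule nonneg_infsum_le_0D[of _ UNIV]) (use 0 coord_summable[of x] in auto)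
    then show "x = 0"
      by (intro ell2_eqI) (simp add: zero_ell2.rep_eq)
  qed (simp add: inner_ell2_def cinner_self zero_ell2.rep_eq)
qed (simp_all add: norm_ell2_def dist_ell2_def sgn_ell2_def uniformity_ell2_def open_ell2_def)
end

lemma norm_ell2_square: "(norm x)\<^sup>2 = (\<Sum>\<^sub>\<infinity>i. (cmod (coord x i))\<^sup>2)" for x :: "'a ell2"
  by (simp add: power2_norm_eq_inner inner_ell2_def cinner_self)

lemma norm_scaleC_ell2: "norm (c *\<^sub>C x) = cmod c * norm x" for x :: "'a ell2"
proof -
  have "(norm (c *\<^sub>C x))\<^sup>2 = (cmod c * norm x)\<^sup>2"
    by (simp add: norm_ell2_square scaleC_ell2.rep_eq norm_mult power_mult_distrib
        infsum_cmult_right')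
  then show ?thesis
    by (simp add: power2_eq_iff_nonneg)
qed

lemma sum_coord_le_norm: "finite F \<Longrightarrow> (\<Sum>i\<in>F. (cmod (coord x i))\<^sup>2) \<le> (norm x)\<^sup>2"
  unfolding norm_ell2_square by (intro finite_sum_le_infsum coord_summable) auto

lemma coord_le_norm: "cmod (coord x i) \<le> norm x"
  using sum_coord_le_norm[of "{i}" x] by (simp add: power2_le_iff_abs_le)

instance ell2 :: (type) complete_space
proof
  fix X :: "nat \<Rightarrow> 'a ell2"
  assume X: "Cauchy X"
  have "Cauchy (\<lambda>n. coord (X n) i)" for i
  proof (rule metric_CauchyI)
    fix e :: real assume "0 < e"
    then obtain M where M: "\<And>m n. m \<ge> M \<Longrightarrow> n \<ge> M \<Longrightarrow> norm (X m - X n) < e"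
      using CauchyD[OF X] by blast
    have "dist (coord (X m) i) (coord (X n) i) < e" if "m \<ge> M" "n \<ge> M" for m n
      using M[OF that] coord_le_norm[of "X m - X n" i]
      by (simp add: dist_norm minus_ell2.rep_eq)
    then show "\<exists>M. \<forall>m\<ge>M. \<forall>n\<ge>M. dist (coord (X m) i) (coord (X n) i) < e"
      by blast
  qed
  then obtain f where f: "\<And>i. (\<lambda>n. coord (X n) i) \<longlonglongrightarrow> f i"
    unfolding Cauchy_convergent_iff convergent_def by metis
  have bound: "\<exists>M. \<forall>n\<ge>M. \<forall>F. finite F \<longrightarrow> (\<Sum>i\<in>F. (cmod (coord (X n) i - f i))\<^sup>2) \<le> e\<^sup>2"
    if e: "0 < e" for e :: real
  proof -
    obtain M where M: "\<And>m n. m \<ge> M \<Longrightarrow> n \<ge> M \<Longrightarrow> norm (X m - X n) < e"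
      using CauchyD[OF X e] by blast
    have "(\<Sum>i\<in>F. (cmod (coord (X n) i - f i))\<^sup>2) \<le> e\<^sup>2" if "n \<ge> M" "finite F" for n F
    proof (rule tendsto_upperbound)
      show "(\<lambda>m. \<Sum>i\<in>F. (cmod (coord (X n) i - coord (X m) i))\<^sup>2)
        \<longlonglongrightarrow> (\<Sum>i\<in>F. (cmod (coord (X n) i - f i))\<^sup>2)"
        by (intro tendsto_intros f)
      have "(\<Sum>i\<in>F. (cmod (coord (X n) i - coord (X m) i))\<^sup>2) \<le> e\<^sup>2" if "m \<ge> M" for m
      proof -
        have "(\<Sum>i\<in>F. (cmod (coord (X n) i - coord (X m) i))\<^sup>2) \<le> (norm (X n - X m))\<^sup>2"
          using sum_coord_le_norm[OF \<open>finite F\<close>, of "X n - X m"] by (simp add: minus_ell2.rep_eq)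
        also have "\<dots> \<le> e\<^sup>2"
          using M[OF \<open>n \<ge> M\<close> \<open>m \<ge> M\<close>] by (intro power_mono) auto
        finally show ?thesis .
      qed
      then show "\<forall>\<^sub>F m in sequentially. (\<Sum>i\<in>F. (cmod (coord (X n) i - coord (X m) i))\<^sup>2) \<le> e\<^sup>2"
        unfolding eventually_sequentially by blast
    qed simp
    then show ?thesis by blast
  qed
  have sq: "(\<lambda>i. (cmod (coord (X n) i - f i))\<^sup>2) summable_on UNIV
      \<and> (\<Sum>\<^sub>\<infinity>i. (cmod (coord (X n) i - f i))\<^sup>2) \<le> e\<^sup>2"
    if "\<forall>F. finite F \<longrightarrow> (\<Sum>i\<in>F. (cmod (coord (X n) i - f i))\<^sup>2) \<le> e\<^sup>2" for n e
  proof
    show s: "(\<lambda>i. (cmod (coord (X n) i - f i))\<^sup>2) summable_on UNIV"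
      by (rule nonneg_bdd_above_summable_on) (use that in \<open>auto simp: bdd_above_def\<close>)
    show "(\<Sum>\<^sub>\<infinity>i. (cmod (coord (X n) i - f i))\<^sup>2) \<le> e\<^sup>2"
      by (rule infsum_le_finite_sums[OF s]) (use that in auto)
  qed
  obtain n0 where "\<forall>F. finite F \<longrightarrow> (\<Sum>i\<in>F. (cmod (coord (X n0) i - f i))\<^sup>2) \<le> 1\<^sup>2"
    using bound[of 1] by auto
  then have "(\<lambda>i. (cmod (coord (X n0) i - f i))\<^sup>2) summable_on UNIV"
    using sq by blast
  then have "(\<lambda>i. (cmod (-1 * (coord (X n0) i - f i)))\<^sup>2) summable_on UNIV"
    by (rule summable_sq_scale)
  from summable_sq_add[OF coord_summable[of "X n0"] this]
  have "(\<lambda>i. (cmod (f i))\<^sup>2) summable_on UNIV" by simp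
  then have L: "coord (Abs_ell2 f) = f"
    by (simp add: Abs_ell2_inverse)
  have "X \<longlonglongrightarrow> Abs_ell2 f"
  proof (rule metric_LIMSEQ_I)
    fix e :: real assume "0 < e"
    then obtain M where M: "\<forall>n\<ge>M. \<forall>F. finite F \<longrightarrow>
        (\<Sum>i\<in>F. (cmod (coord (X n) i - f i))\<^sup>2) \<le> (e / 2)\<^sup>2"
      using bound[of "e / 2"] by auto
    have "dist (X n) (Abs_ell2 f) < e" if "n \<ge> M" for n
    proof -
      have "(norm (X n - Abs_ell2 f))\<^sup>2 \<le> (e / 2)\<^sup>2"
        using sq[of n "e / 2"] M that by (simp add: norm_ell2_square minus_ell2.rep_eq L)
      then have "norm (X n - Abs_ell2 f) \<le> e / 2"
        using \<open>0 < e\<close> by (simp add: power2_le_iff_abs_le)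
      then show ?thesis using \<open>0 < e\<close> by (simp add: dist_norm)
    qed
    then show "\<exists>no. \<forall>n\<ge>no. dist (X n) (Abs_ell2 f) < e" by blast
  qed
  then show "convergent X" by (auto simp: convergent_def)
qed

lift_definition ket :: "'a \<Rightarrow> 'a ell2" is "\<lambda>a i. if i = a then 1 else 0"
proof -
  fix a :: 'a
  have "(\<lambda>i. (cmod (if i = a then 1 else 0))\<^sup>2) summable_on {a}" by simp
  then show "(\<lambda>i. (cmod (if i = a then 1 else 0))\<^sup>2) summable_on UNIV"
    by (rule summable_on_cong_neutral[THEN iffD1, rotated -1]) auto
qed

lemma ket_nonzero: "ket a \<noteq> 0"
  by transfer (auto simp: fun_eq_iff)

lift_definition tensor_vec :: "'a ell2 \<Rightarrow> 'b ell2 \<Rightarrow> ('a \<times> 'b) ell2"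
  is "\<lambda>x y (i, j). x i * y j"
proof -
  fix x :: "'a \<Rightarrow> complex" and y :: "'b \<Rightarrow> complex"
  assume xy: "(\<lambda>i. (cmod (x i))\<^sup>2) summable_on UNIV" "(\<lambda>j. (cmod (y j))\<^sup>2) summable_on UNIV"
  have "(\<lambda>p. norm ((\<lambda>(i, j). (cmod (x i))\<^sup>2 * (cmod (y j))\<^sup>2) p)) summable_on UNIV \<times> UNIV"
    by (rule Infinite_Sum.abs_summable_on_Sigma_iff[THEN iffD2])
       (use xy in \<open>auto simp: abs_mult infsum_cmult_right' intro!: summable_on_cmult_right summable_on_cmult_left\<close>)
  then have "(\<lambda>(i, j). (cmod (x i))\<^sup>2 * (cmod (y j))\<^sup>2) summable_on UNIV"
    by (simp add: case_prod_unfold abs_mult)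
  then show "(\<lambda>p. (cmod (case p of (i, j) \<Rightarrow> x i * y j))\<^sup>2) summable_on UNIV"
    by (simp add: case_prod_unfold norm_mult power_mult_distrib)
qed

lift_definition assoc_vec :: "(('a \<times> 'b) \<times> 'c) ell2 \<Rightarrow> ('a \<times> 'b \<times> 'c) ell2"
  is "\<lambda>x (i, j, k). x ((i, j), k)"
proof -
  fix x :: "('a \<times> 'b) \<times> 'c \<Rightarrow> complex"
  assume *: "(\<lambda>p. (cmod (x p))\<^sup>2) summable_on UNIV"
  have bij: "bij (\<lambda>(i, j, k). ((i, j), k) :: ('a \<times> 'b) \<times> 'c)"
    by (rule bij_betw_byWitness[where f' = "\<lambda>((i, j), k). (i, j, k)"]) auto
  show "(\<lambda>p. (cmod (case p of (i, j, k) \<Rightarrow> x ((i, j), k)))\<^sup>2) summable_on UNIV"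
    using * summable_on_reindex_bij_betw[OF bij, of "\<lambda>p. (cmod (x p))\<^sup>2"]
    by (simp add: case_prod_unfold)
qed


section \<open>Bounded operators\<close>

text \<open>Isabelle's \<open>\<Rightarrow>\<^sub>L\<close> only asks for linearity over the reals.\<close>

typedef 'a bop = "{T :: 'a ell2 \<Rightarrow>\<^sub>L 'a ell2. \<forall>c x. T (c *\<^sub>C x) = c *\<^sub>C T x}"
  morphisms blinfun_of Abs_bop
  by (rule exI[of _ 0]) (simp add: complex_vector.scale_zero_right)

setup_lifting type_definition_bop

abbreviation app :: "'a bop \<Rightarrow> 'a ell2 \<Rightarrow> 'a ell2" where
  "app T x \<equiv> blinfun_apply (blinfun_of T) x"

lemma scaleC_ell2_bounded: "bounded_linear (\<lambda>x :: 'a ell2. c *\<^sub>C x)"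
  by (rule bounded_linear_intro[where K = "cmod c"])
     (simp_all add: scaleC_add_right scaleR_scaleC scaleC_scaleC norm_scaleC_ell2 mult.commute)

instantiation bop :: (type) complex_vector
begin
lift_definition zero_bop :: "'a bop" is 0 by (simp add: complex_vector.scale_zero_right)
lift_definition plus_bop :: "'a bop \<Rightarrow> 'a bop \<Rightarrow> 'a bop" is "(+)"
  by (simp add: blinfun.add_left scaleC_add_right)
lift_definition uminus_bop :: "'a bop \<Rightarrow> 'a bop" is uminus
  by (simp add: blinfun.minus_left complex_vector.scale_minus_right)
lift_definition minus_bop :: "'a bop \<Rightarrow> 'a bop \<Rightarrow> 'a bop" is "(-)"
  by (simp add: blinfun.diff_left complex_vector.scale_right_diff_distrib)
lift_definition scaleR_bop :: "real \<Rightarrow> 'a bop \<Rightarrow> 'a bop" is scaleR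
  by (simp add: blinfun.scaleR_left scaleR_scaleC scaleC_scaleC mult.commute)
lift_definition scaleC_bop :: "complex \<Rightarrow> 'a bop \<Rightarrow> 'a bop"
  is "\<lambda>c T. Blinfun (\<lambda>x. c *\<^sub>C blinfun_apply T x)"
  by (simp add: bounded_linear_Blinfun_apply
        bounded_linear_compose[OF scaleC_ell2_bounded blinfun.bounded_linear_right]
        scaleC_scaleC mult.commute)
instance
proof
  fix c d :: complex and r :: real and x y z :: "'a bop"
  have app_scaleC: "app (c *\<^sub>C x) v = c *\<^sub>C app x v" for c x and v :: "'a ell2"
    by (simp add: scaleC_bop.rep_eq bounded_linear_Blinfun_apply
        bounded_linear_compose[OF scaleC_ell2_bounded blinfun.bounded_linear_right])
  have eqI: "(\<And>v. app S v = app T v) \<Longrightarrow> S = T" for S T :: "'a bop"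
    by (simp add: blinfun_of_inject[symmetric] blinfun_eqI)
  show "x + y + z = x + (y + z)" "x + y = y + x" "0 + x = x" "- x + x = 0" "x - y = x + - y"
    "r *\<^sub>R (x + y) = r *\<^sub>R x + r *\<^sub>R y"
    by (transfer; simp add: algebra_simps)+
  show "(r + s) *\<^sub>R x = r *\<^sub>R x + s *\<^sub>R x" "r *\<^sub>R s *\<^sub>R x = (r * s) *\<^sub>R x" "1 *\<^sub>R x = x" for s
    by (transfer; simp add: algebra_simps)+
  show "c *\<^sub>C (x + y) = c *\<^sub>C x + c *\<^sub>C y"
    by (rule eqI) (simp add: app_scaleC plus_bop.rep_eq blinfun.add_left scaleC_add_right)
  show "(c + d) *\<^sub>C x = c *\<^sub>C x + d *\<^sub>C x"
    by (rule eqI) (simp add: app_scaleC plus_bop.rep_eq blinfun.add_left scaleC_add_left)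
  show "c *\<^sub>C d *\<^sub>C x = (c * d) *\<^sub>C x"
    by (rule eqI) (simp add: app_scaleC scaleC_scaleC)
  show "1 *\<^sub>C x = x"
    by (rule eqI) (simp add: app_scaleC scaleC_one)
  show "r *\<^sub>R x = complex_of_real r *\<^sub>C x"
    by (rule eqI) (simp add: app_scaleC scaleR_bop.rep_eq blinfun.scaleR_left scaleR_scaleC)
qed
end

lemma app_scaleC: "app (c *\<^sub>C T) x = c *\<^sub>C app T x"
  by (simp add: scaleC_bop.rep_eq bounded_linear_Blinfun_apply
      bounded_linear_compose[OF scaleC_ell2_bounded blinfun.bounded_linear_right])

lemma bop_eqI: "(\<And>x. app S x = app T x) \<Longrightarrow> S = T"
  by (simp add: blinfun_of_inject[symmetric] blinfun_eqI)

instantiation bop :: (type) real_normed_algebra_1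
begin
lift_definition one_bop :: "'a bop" is id_blinfun by simp
lift_definition times_bop :: "'a bop \<Rightarrow> 'a bop \<Rightarrow> 'a bop" is "(o\<^sub>L)" by simp
lift_definition norm_bop :: "'a bop \<Rightarrow> real" is "norm :: ('a ell2 \<Rightarrow>\<^sub>L 'a ell2) \<Rightarrow> real" .
definition dist_bop :: "'a bop \<Rightarrow> 'a bop \<Rightarrow> real" where
  "dist_bop S T = norm (S - T)"
definition sgn_bop :: "'a bop \<Rightarrow> 'a bop" where
  "sgn_bop T = T /\<^sub>R norm T"
definition uniformity_bop :: "('a bop \<times> 'a bop) filter" where
  "uniformity_bop = (INF e\<in>{0<..}. principal {(S, T). dist S T < e})"
definition open_bop :: "'a bop set \<Rightarrow> bool" where
  "open_bop U \<longleftrightarrow> (\<forall>T\<in>U. \<forall>\<^sub>F (T', S) in uniformity. T' = T \<longrightarrow> S \<in> U)"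
instance
proof
  fix r :: real and x y z :: "'a bop"
  show "norm (1 :: 'a bop) = 1"
  proof transfer
    have "norm (ket undefined :: 'a ell2) \<le> norm (id_blinfun :: 'a ell2 \<Rightarrow>\<^sub>L 'a ell2) * norm (ket undefined :: 'a ell2)"
      using norm_blinfun[of id_blinfun "ket undefined :: 'a ell2"] by simp
    then have "1 \<le> norm (id_blinfun :: 'a ell2 \<Rightarrow>\<^sub>L 'a ell2)"
      by (simp add: ket_nonzero)
    then show "norm (id_blinfun :: 'a ell2 \<Rightarrow>\<^sub>L 'a ell2) = 1"
      using norm_blinfun_id_le by (intro order_antisym)
  qed
  moreover have "norm (0 :: 'a bop) = 0"
    by (simp add: norm_bop.rep_eq zero_bop.rep_eq)
  ultimately show "(0 :: 'a bop) \<noteq> 1"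
    by (metis zero_neq_one)
  show "x * y * z = x * (y * z)"
    by (rule bop_eqI) (simp add: times_bop.rep_eq)
  show "(x + y) * z = x * z + y * z" "x * (y + z) = x * y + x * z"
    "r *\<^sub>R x * y = r *\<^sub>R (x * y)" "x * r *\<^sub>R y = r *\<^sub>R (x * y)"
    by (rule bop_eqI; simp add: times_bop.rep_eq plus_bop.rep_eq scaleR_bop.rep_eq
        blinfun.bilinear_simps)+
  show "1 * x = x" "x * 1 = x"
    by (rule bop_eqI; simp add: times_bop.rep_eq one_bop.rep_eq)+
  show "norm x = 0 \<longleftrightarrow> x = 0" by transfer simp
  show "norm (x + y) \<le> norm x + norm y" by transfer (rule norm_triangle_ineq)
  show "norm (r *\<^sub>R x) = \<bar>r\<bar> * norm x" by transfer simp
  show "norm (x * y) \<le> norm x * norm y" by transfer (rule norm_blinfun_compose)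
qed (simp_all add: dist_bop_def sgn_bop_def uniformity_bop_def open_bop_def)
end

definition adj :: "'a bop \<Rightarrow> 'a bop" ("_\<^sup>\<dagger>" [1000] 999) where
  "T\<^sup>\<dagger> = (THE S. \<forall>x y. cinner (app S x) y = cinner x (app T y))"

definition tensor_op :: "'a bop \<Rightarrow> 'b bop \<Rightarrow> ('a \<times> 'b) bop" (infixr "\<otimes>" 72) where
  "S \<otimes> T = (THE R. \<forall>x y. app R (tensor_vec x y) = tensor_vec (app S x) (app T y))"

definition assoc_op :: "(('a \<times> 'b) \<times> 'c) bop \<Rightarrow> ('a \<times> 'b \<times> 'c) bop" where
  "assoc_op R = (THE R'. \<forall>x. app R' (assoc_vec x) = assoc_vec (app R x))"


section \<open>C*-algebras\<close>

text \<open>A unital C*-algebra is given in a faithful unital representation, i.e. as a norm-closed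
  unital *-algebra of operators on \<open>\<ell>\<^sup>2('a)\<close>.  By the Gelfand--Naimark theorem, and because every
  Hilbert space is some \<open>\<ell>\<^sup>2('a)\<close>, every nonzero unital C*-algebra is of this form.\<close>

definition unital_cstar_algebra :: "'a bop set \<Rightarrow> bool" where
  "unital_cstar_algebra B \<longleftrightarrow> 1 \<in> B \<and>
     (\<forall>a\<in>B. \<forall>b\<in>B. a + b \<in> B \<and> a * b \<in> B) \<and>
     (\<forall>c. \<forall>a\<in>B. c *\<^sub>C a \<in> B) \<and> (\<forall>a\<in>B. a\<^sup>\<dagger> \<in> B) \<and> closed B"

definition generated_cstar_algebra :: "'a bop set \<Rightarrow> 'a bop set" where
  "generated_cstar_algebra X = \<Inter>{B. unital_cstar_algebra B \<and> X \<subseteq> B}"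

definition unital_star_hom :: "'a bop set \<Rightarrow> 'b bop set \<Rightarrow> ('a bop \<Rightarrow> 'b bop) \<Rightarrow> bool" where
  "unital_star_hom B D h \<longleftrightarrow> h ` B \<subseteq> D \<and> h 1 = 1 \<and>
     (\<forall>a\<in>B. \<forall>b\<in>B. h (a + b) = h a + h b \<and> h (a * b) = h a * h b) \<and>
     (\<forall>c. \<forall>a\<in>B. h (c *\<^sub>C a) = c *\<^sub>C h a) \<and> (\<forall>a\<in>B. h (a\<^sup>\<dagger>) = (h a)\<^sup>\<dagger>)"

text \<open>The minimal (spatial) tensor product: up to isomorphism it does not depend on the faithful
  representations of the two factors, and for a C*-subalgebra \<open>D' \<subseteq> D\<close> it contains the minimal
  tensor product \<open>B \<otimes> D'\<close> as a subset.\<close>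

definition min_tensor :: "'a bop set \<Rightarrow> 'b bop set \<Rightarrow> ('a \<times> 'b) bop set" (infixr "\<otimes>\<^sub>m" 72) where
  "B \<otimes>\<^sub>m D = closure (cspan {b \<otimes> d | b d. b \<in> B \<and> d \<in> D})"

text \<open>For unital *-homomorphisms \<open>f: B \<rightarrow> B'\<close> and \<open>g: D \<rightarrow> D'\<close> the *-homomorphism
  \<open>f \<otimes> g: B \<otimes> D \<rightarrow> B' \<otimes> D'\<close> is unique as a map on \<open>B \<otimes> D\<close>; the choice only concerns
  the irrelevant values outside.\<close>

definition tensor_hom :: "'a bop set \<Rightarrow> 'b bop set \<Rightarrow> 'c bop set \<Rightarrow> 'd bop set \<Rightarrow>
    ('a bop \<Rightarrow> 'c bop) \<Rightarrow> ('b bop \<Rightarrow> 'd bop) \<Rightarrow> ('a \<times> 'b) bop \<Rightarrow> ('c \<times> 'd) bop" where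
  "tensor_hom B D B' D' f g =
     (SOME h. unital_star_hom (B \<otimes>\<^sub>m D) (B' \<otimes>\<^sub>m D') h \<and> (\<forall>b\<in>B. \<forall>d\<in>D. h (b \<otimes> d) = f b \<otimes> g d))"

definition partial_isometry :: "'a bop \<Rightarrow> bool" where
  "partial_isometry v \<longleftrightarrow> v * v\<^sup>\<dagger> * v = v"

definition projection :: "'a bop \<Rightarrow> bool" where
  "projection p \<longleftrightarrow> p * p = p \<and> p\<^sup>\<dagger> = p"

definition magic_unitary :: "('n::finite \<Rightarrow> 'n \<Rightarrow> 'a bop) \<Rightarrow> bool" where
  "magic_unitary p \<longleftrightarrow> (\<forall>i j. projection (p i j)) \<and>
     (\<forall>i. (\<Sum>j\<in>UNIV. p i j) = 1) \<and> (\<forall>j. (\<Sum>i\<in>UNIV. p i j) = 1)"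


section \<open>Compact matrix quantum groups and actions\<close>

text \<open>Woronowicz's definition; \<open>conjugate_matrix u\<close> has the entries \<open>u\<^sub>i\<^sub>j\<^sup>\<dagger>\<close> (no transposition).\<close>

definition invertible_over :: "'a bop set \<Rightarrow> ('n::finite \<Rightarrow> 'n \<Rightarrow> 'a bop) \<Rightarrow> bool" where
  "invertible_over C u \<longleftrightarrow> (\<exists>v. (\<forall>i j. v i j \<in> C) \<and>
     (\<forall>i j. (\<Sum>k\<in>UNIV. u i k * v k j) = (if i = j then 1 else 0)) \<and>
     (\<forall>i j. (\<Sum>k\<in>UNIV. v i k * u k j) = (if i = j then 1 else 0)))"

definition conjugate_matrix :: "('n \<Rightarrow> 'n \<Rightarrow> 'a bop) \<Rightarrow> 'n \<Rightarrow> 'n \<Rightarrow> 'a bop" where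
  "conjugate_matrix u i j = (u i j)\<^sup>\<dagger>"

definition matrix_comultiplication ::
    "'a bop set \<Rightarrow> ('n::finite \<Rightarrow> 'n \<Rightarrow> 'a bop) \<Rightarrow> ('a bop \<Rightarrow> ('a \<times> 'a) bop) \<Rightarrow> bool" where
  "matrix_comultiplication C u \<Phi> \<longleftrightarrow> unital_star_hom C (C \<otimes>\<^sub>m C) \<Phi> \<and>
     (\<forall>i j. \<Phi> (u i j) = (\<Sum>k\<in>UNIV. u i k \<otimes> u k j))"

definition compact_matrix_quantum_group ::
    "'a bop set \<Rightarrow> ('n::finite \<Rightarrow> 'n \<Rightarrow> 'a bop) \<Rightarrow> ('a bop \<Rightarrow> ('a \<times> 'a) bop) \<Rightarrow> bool" where
  "compact_matrix_quantum_group C u \<Phi> \<longleftrightarrow> unital_cstar_algebra C \<and>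
     C = generated_cstar_algebra {u i j | i j. True} \<and>
     invertible_over C u \<and> invertible_over C (conjugate_matrix u) \<and>
     matrix_comultiplication C u \<Phi>"

definition quantum_action :: "'a bop set \<Rightarrow> ('a bop \<Rightarrow> ('a \<times> 'a) bop) \<Rightarrow>
    'b bop set \<Rightarrow> ('b bop \<Rightarrow> ('a \<times> 'b) bop) \<Rightarrow> bool" where
  "quantum_action C \<Phi> B \<phi> \<longleftrightarrow> unital_cstar_algebra B \<and> unital_star_hom B (C \<otimes>\<^sub>m B) \<phi> \<and>
     (\<forall>x\<in>B. assoc_op (tensor_hom C B (C \<otimes>\<^sub>m C) B \<Phi> id (\<phi> x)) =
             tensor_hom C B C (C \<otimes>\<^sub>m B) id \<phi> (\<phi> x)) \<and>
     closure (cspan {\<phi> x * (c \<otimes> 1) | x c. x \<in> B \<and> c \<in> C}) = C \<otimes>\<^sub>m B"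


section \<open>Zero-one matrices, admissible words and Perron--Frobenius vectors\<close>

definition zero_one_matrix :: "real^'n^'n \<Rightarrow> bool" where
  "zero_one_matrix A \<longleftrightarrow> (\<forall>i j. A $ i $ j \<in> {0, 1})"

definition matrix_power :: "real^'n^'n \<Rightarrow> nat \<Rightarrow> real^'n^'n" where
  "matrix_power A k = (((**) A) ^^ k) (mat 1)"

definition primitive_matrix :: "real^'n^'n \<Rightarrow> bool" where
  "primitive_matrix A \<longleftrightarrow> (\<exists>k\<ge>1. \<forall>i j. matrix_power A k $ i $ j > 0)"

definition all_ones :: "real^'n^'n" where
  "all_ones = (\<chi> i j. 1)"

definition complex_eigenvalue :: "real^'n^'n \<Rightarrow> complex \<Rightarrow> bool" where
  "complex_eigenvalue A \<mu> \<longleftrightarrow>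
     (\<exists>z :: complex^'n. z \<noteq> 0 \<and> (\<forall>i. (\<Sum>j\<in>UNIV. complex_of_real (A $ i $ j) * z $ j) = \<mu> * z $ i))"

definition maximal_eigenvalue :: "real^'n^'n \<Rightarrow> real \<Rightarrow> bool" where
  "maximal_eigenvalue A r \<longleftrightarrow> complex_eigenvalue A (complex_of_real r) \<and>
     (\<forall>\<mu>. complex_eigenvalue A \<mu> \<longrightarrow> cmod \<mu> \<le> r)"

definition pf_vector :: "real^'n^'n \<Rightarrow> real^'n" where
  "pf_vector A = (THE v. (\<forall>i. v $ i > 0) \<and> (\<Sum>i\<in>UNIV. v $ i) = 1 \<and>
     (\<exists>r. maximal_eigenvalue A r \<and> A *v v = r *\<^sub>R v))"

definition admissible :: "real^'n^'n \<Rightarrow> 'n list \<Rightarrow> bool" where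
  "admissible A w \<longleftrightarrow> successively (\<lambda>i j. A $ i $ j = 1) w"


section \<open>Cuntz--Krieger algebras and the quantum groups\<close>

text \<open>In both universal properties it suffices to test against C*-algebras on \<open>\<ell>\<^sup>2(\<nat>)\<close>: the test
  algebra may be replaced by the C*-subalgebra generated by the finitely many given elements,
  which is separable and therefore has a faithful unital representation on \<open>\<ell>\<^sup>2(\<nat>)\<close>.\<close>

definition cuntz_krieger_family :: "real^'n^'n \<Rightarrow> ('n::finite \<Rightarrow> 'a bop) \<Rightarrow> bool" where
  "cuntz_krieger_family A S \<longleftrightarrow> (\<Sum>j\<in>UNIV. S j * (S j)\<^sup>\<dagger>) = 1 \<and>
     (\<forall>i k. (S i)\<^sup>\<dagger> * S k = (if i = k then (\<Sum>j\<in>UNIV. (A $ i $ j) *\<^sub>R (S j * (S j)\<^sup>\<dagger>)) else 0))"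

definition cuntz_krieger_algebra :: "real^'n^'n \<Rightarrow> 'a bop set \<Rightarrow> ('n::finite \<Rightarrow> 'a bop) \<Rightarrow> bool" where
  "cuntz_krieger_algebra A B S \<longleftrightarrow> unital_cstar_algebra B \<and>
     B = generated_cstar_algebra (range S) \<and> cuntz_krieger_family A S \<and>
     (\<forall>(D :: nat bop set) T. unital_cstar_algebra D \<and> range T \<subseteq> D \<and> cuntz_krieger_family A T \<longrightarrow>
        (\<exists>h. unital_star_hom B D h \<and> (\<forall>i. h (S i) = T i)))"

definition word_prod :: "('n \<Rightarrow> 'a bop) \<Rightarrow> 'n list \<Rightarrow> 'a bop" where
  "word_prod S w = prod_list (map S w)"

text \<open>\<open>C(\<Sigma>\<^sub>A)\<close>, where \<open>S\<^sub>w S\<^sub>w\<^sup>\<dagger>\<close> is the characteristic function of the cylinder set of the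
  sequences starting with \<open>w\<close>.\<close>

definition path_space_algebra :: "real^'n^'n \<Rightarrow> ('n::finite \<Rightarrow> 'a bop) \<Rightarrow> 'a bop set" where
  "path_space_algebra A S =
     closure (cspan {word_prod S w * (word_prod S w)\<^sup>\<dagger> | w. admissible A w})"

definition source_proj :: "('n \<Rightarrow> 'n \<Rightarrow> 'a bop) \<Rightarrow> 'n \<Rightarrow> 'n \<Rightarrow> 'a bop" where
  "source_proj u i j = (u i j)\<^sup>\<dagger> * u i j"

definition range_proj :: "('n \<Rightarrow> 'n \<Rightarrow> 'a bop) \<Rightarrow> 'n \<Rightarrow> 'n \<Rightarrow> 'a bop" where
  "range_proj u i j = u i j * (u i j)\<^sup>\<dagger>"

definition quantum_path_family :: "real^'n^'n \<Rightarrow> ('n::finite \<Rightarrow> 'n \<Rightarrow> 'a bop) \<Rightarrow> bool" where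
  "quantum_path_family A u \<longleftrightarrow>
     (let p = range_proj u; q = source_proj u; v = pf_vector A in
      (\<forall>i j. partial_isometry (u i j)) \<and>
      magic_unitary p \<and> magic_unitary q \<and>
      (\<forall>i. (\<Sum>j\<in>UNIV. (v $ j) *\<^sub>R p i j) = (v $ i) *\<^sub>R 1) \<and>
      (\<forall>i. (\<Sum>j\<in>UNIV. (v $ j) *\<^sub>R q i j) = (v $ i) *\<^sub>R 1) \<and>
      (\<forall>i j. (\<Sum>k\<in>UNIV. (A $ i $ k) *\<^sub>R p k j) = (\<Sum>k\<in>UNIV. (A $ k $ j) *\<^sub>R q i k)) \<and>
      (\<forall>a b. length a = length b \<and> admissible A a \<and> admissible A b \<longrightarrow>
         partial_isometry (prod_list (map2 u a b))))"

definition quantum_path_algebra ::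
    "real^'n^'n \<Rightarrow> 'a bop set \<Rightarrow> ('n::finite \<Rightarrow> 'n \<Rightarrow> 'a bop) \<Rightarrow> bool" where
  "quantum_path_algebra A C u \<longleftrightarrow> unital_cstar_algebra C \<and>
     C = generated_cstar_algebra {u i j | i j. True} \<and> quantum_path_family A u \<and>
     (\<forall>(D :: nat bop set) v.
        unital_cstar_algebra D \<and> (\<forall>i j. v i j \<in> D) \<and> quantum_path_family A v \<longrightarrow>
        (\<exists>h. unital_star_hom C D h \<and> (\<forall>i j. h (u i j) = v i j)))"

end

theory Submission
  imports Defs
begin

text \<open>The relations of \<open>C(\<G>\<^sub>A)\<close> force the source projection of \<open>u\<^sub>a\<^sub>b\<close> to commute with the range
  projection of \<open>u\<^sub>w\<^sub>y = u\<^bsub>w\<^sub>1 y\<^sub>1\<^esub> u\<^bsub>w\<^sub>2 y\<^sub>2\<^esub> \<dots>\<close> whenever \<open>aw\<close> and \<open>by\<close> are admissible, since the product of two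
  partial isometries \<open>v w\<close> is a partial isometry only if \<open>v\<^sup>\<dagger>v\<close> and \<open>ww\<^sup>\<dagger>\<close> commute.  Hence all mixed terms
  of \<open>\<phi>(S\<^sub>w S\<^sub>w\<^sup>\<dagger>)\<close> vanish and \<open>\<phi>(S\<^sub>w S\<^sub>w\<^sup>\<dagger>) = \<Sum>\<^sub>y P\<^sub>w\<^sub>y \<otimes> S\<^sub>y S\<^sub>y\<^sup>\<dagger>\<close> with \<open>P\<^sub>w\<^sub>y = u\<^sub>w\<^sub>y u\<^sub>w\<^sub>y\<^sup>\<dagger>\<close>.
  For the full shift \<open>P\<close> is a magic unitary on the words of each length and
  \<open>\<Phi>(P\<^sub>w\<^sub>y) = \<Sum>\<^sub>z P\<^sub>w\<^sub>z \<otimes> P\<^sub>z\<^sub>y\<close>, which gives the coaction identity and density.  If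
  \<open>g = \<Sum>\<^sub>w g\<^sub>w S\<^sub>w S\<^sub>w\<^sup>\<dagger>\<close> is almost fixed, multiplying \<open>\<phi>(g) - 1 \<otimes> g\<close> by \<open>P\<^sub>w\<^sub>y \<otimes> S\<^sub>y S\<^sub>y\<^sup>\<dagger>\<close> shows
  that \<open>(g\<^sub>w - g\<^sub>y) P\<^sub>w\<^sub>y\<close> is small, so \<open>g\<close> is almost constant as soon as no \<open>P\<^sub>w\<^sub>y\<close> is zero.  This and the
  noncommutativity are seen in representations by the bilateral shift multiplied by indicator
  functions of sets of points.\<close>

section \<open>Hilbert space operators\<close>

text \<open>Two obstacles shape the proof. Homomorphisms are defined purely algebraically while
  every algebra is a norm closure, so an identity checked on cylinder projections reaches the whole
  algebra only once homomorphisms are known to be contractive; this is what the square roots and the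
  completeness of \<open>bop\<close> are for. And \<open>tensor_hom\<close> is chosen by
  \<open>SOME\<close>, so the coaction identity says nothing until a homomorphism extending f and g
  to the tensor product exists. Here the second factor is the closed span of a tree of projections,
  whose finite levels are commutative and finite dimensional, and at each level the tensor norm is
  explicit. The same normal form, one coefficient per word of a single length, carries the
  ergodicity argument. The test representations have to live over \<open>nat\<close>, where the
  universal property is stated. They consist of weighted composition operators, which are closed
  under products and adjoints, so that the third family of relations, a condition on words of every
  length, holds at once.\<close>

lemma cinner_add_right: "cinner x (y + z) = cinner x y + cinner x z"
  by (metis cinner_add_left cinner_commute complex_cnj_add)

lemma cinner_scaleC_right: "cinner x (c *\<^sub>C y) = c * cinner x y"
  by (metis cinner_commute cinner_scaleC_left complex_cnj_cnj complex_cnj_mult)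

lemma cinner_zero_left [simp]: "cinner 0 x = 0"
  using cinner_add_left[of 0 0 x] by simp

lemma cinner_zero_right [simp]: "cinner x 0 = 0"
  using cinner_add_right[of x 0 0] by simp

lemma cinner_minus_left: "cinner (- x) y = - cinner x y"
  using cinner_add_left[of x "- x" y] by (simp add: eq_neg_iff_add_eq_0 add.commute)

lemma cinner_minus_right: "cinner x (- y) = - cinner x y"
  using cinner_add_right[of x y "- y"] by (simp add: eq_neg_iff_add_eq_0 add.commute)

lemma cinner_diff_left: "cinner (x - y) z = cinner x z - cinner y z"
  using cinner_add_left[of x "- y" z] by (simp add: cinner_minus_left)

lemma cinner_diff_right: "cinner x (y - z) = cinner x y - cinner x z"
  using cinner_add_right[of x y "- z"] by (simp add: cinner_minus_right)

lemma cinner_sum_left: "cinner (sum f F) y = (\<Sum>i\<in>F. cinner (f i) y)"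
  by (induction F rule: infinite_finite_induct) (auto simp: cinner_add_left)

lemma cinner_sum_right: "cinner y (sum f F) = (\<Sum>i\<in>F. cinner y (f i))"
  by (induction F rule: infinite_finite_induct) (auto simp: cinner_add_right)

lemma cinner_norm: "cinner x x = complex_of_real ((norm x)\<^sup>2)"
  by (simp add: cinner_self norm_ell2_square)

text \<open>The real Cauchy-Schwarz inequality only bounds the real part of \<open>cinner\<close>.
  Multiplying \<open>x\<close> by the phase \<open>c\<close> of the inner product makes that product
  real and nonnegative without changing the norm of \<open>x\<close>.\<close>

lemma cinner_cauchy_schwarz: "cmod (cinner x y) \<le> norm x * norm y"
proof (cases "cinner x y = 0")
  case False
  define c where "c = cinner x y / cmod (cinner x y)"
  have c: "cmod c = 1" using False by (simp add: c_def norm_divide)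
  have "cinner (c *\<^sub>C x) y = cnj (cinner x y) * cinner x y / cmod (cinner x y)"
    by (simp add: cinner_scaleC_left c_def)
  also have "cnj (cinner x y) * cinner x y = complex_of_real ((cmod (cinner x y))\<^sup>2)"
    by (metis complex_norm_square mult.commute)
  finally have "cinner (c *\<^sub>C x) y = complex_of_real (cmod (cinner x y))"
    using False by (simp add: power2_eq_square)
  then have "cmod (cinner x y) = inner (c *\<^sub>C x) y"
    by (simp add: inner_ell2_def)
  also have "\<dots> \<le> norm (c *\<^sub>C x) * norm y" by (rule norm_cauchy_schwarz)
  finally show ?thesis by (simp add: norm_scaleC_ell2 c)
qed simp

lemma bounded_linear_cinner_left: "bounded_linear (\<lambda>x. cinner x y)"
  by (rule bounded_linear_intro[where K = "norm y"])
     (simp_all add: cinner_add_left scaleR_scaleC cinner_scaleC_left scaleR_conv_of_real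
        order_trans[OF cinner_cauchy_schwarz])

lemma cinner_ext: "(\<And>x. cinner x y = cinner x z) \<Longrightarrow> y = z"
proof -
  assume "\<And>x. cinner x y = cinner x z"
  then have "cinner (y - z) (y - z) = 0" by (simp add: cinner_diff_right)
  then show "y = z" by (simp add: cinner_norm)
qed

lemma coord_ket: "coord (ket a) i = (if i = a then 1 else 0)"
  by (simp add: ket.rep_eq)

lemma coord_sum: "coord (sum f F) i = (\<Sum>j\<in>F. coord (f j) i)"
  by (induction F rule: infinite_finite_induct) (auto simp: zero_ell2.rep_eq plus_ell2.rep_eq)

lemma cinner_ket_left: "cinner (ket a) x = coord x a"
proof -
  have "((\<lambda>i. cnj (coord (ket a) i) * coord x i) has_sum (\<Sum>i\<in>{a}. coord x i)) UNIV"
    by (rule has_sum_finite_neutralI[where B = "{a}"]) (auto simp: coord_ket)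
  then show ?thesis by (simp add: cinner_def infsumI)
qed

text \<open>By Pythagoras the squared distance of a finite partial sum from \<open>x\<close> is the
  squared norm of \<open>x\<close> minus the squares of the coordinates already used, and these add
  up to it. Hence operators are determined by their values on kets.\<close>

lemma ell2_has_sum_ket: "((\<lambda>i. coord x i *\<^sub>C ket i) has_sum x) UNIV"
proof -
  have s: "(\<lambda>i. (cmod (coord x i))\<^sup>2) summable_on UNIV" by (rule coord_summable)
  have cf: "coord (\<Sum>i\<in>F. coord x i *\<^sub>C ket i) j = (if j \<in> F then coord x j else 0)"
    if "finite F" for F j
    using that by (simp add: coord_sum scaleC_ell2.rep_eq coord_ket if_distrib sum.delta cong: if_cong)
  have eq: "(norm ((\<Sum>i\<in>F. coord x i *\<^sub>C ket i) - x))\<^sup>2 = (norm x)\<^sup>2 - (\<Sum>i\<in>F. (cmod (coord x i))\<^sup>2)"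
    if F: "finite F" for F
  proof -
    have "(\<lambda>i. (cmod (coord x i))\<^sup>2) summable_on (- F)"
      using s by (rule summable_on_subset_banach) simp
    then have 1: "(\<Sum>\<^sub>\<infinity>i\<in>F \<union> - F. (cmod (coord x i))\<^sup>2)
        = (\<Sum>\<^sub>\<infinity>i\<in>F. (cmod (coord x i))\<^sup>2) + (\<Sum>\<^sub>\<infinity>i\<in>-F. (cmod (coord x i))\<^sup>2)"
      by (intro infsum_Un_disjoint) (use F in auto)
    have "(norm ((\<Sum>i\<in>F. coord x i *\<^sub>C ket i) - x))\<^sup>2
        = (\<Sum>\<^sub>\<infinity>i. (cmod ((if i \<in> F then coord x i else 0) - coord x i))\<^sup>2)"
      by (simp add: norm_ell2_square minus_ell2.rep_eq cf[OF F])
    also have "\<dots> = (\<Sum>\<^sub>\<infinity>i\<in>-F. (cmod (coord x i))\<^sup>2)"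
      by (rule infsum_cong_neutral) auto
    finally show ?thesis using 1 F by (simp add: norm_ell2_square)
  qed
  have "((\<lambda>F. (norm x)\<^sup>2 - (\<Sum>i\<in>F. (cmod (coord x i))\<^sup>2)) \<longlongrightarrow> (norm x)\<^sup>2 - (norm x)\<^sup>2)
      (finite_subsets_at_top UNIV)"
    using has_sum_infsum[OF s] unfolding has_sum_def norm_ell2_square
    by (intro tendsto_intros)
  moreover have "\<forall>\<^sub>F F in finite_subsets_at_top UNIV. (norm x)\<^sup>2 - (\<Sum>i\<in>F. (cmod (coord x i))\<^sup>2)
      = (norm ((\<Sum>i\<in>F. coord x i *\<^sub>C ket i) - x))\<^sup>2"
    using eq by (intro eventually_finite_subsets_at_top_weakI) auto
  ultimately have "((\<lambda>F. (norm ((\<Sum>i\<in>F. coord x i *\<^sub>C ket i) - x))\<^sup>2) \<longlongrightarrow> 0)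
      (finite_subsets_at_top UNIV)"
    by (simp add: tendsto_cong)
  then have "((\<lambda>F. sqrt ((norm ((\<Sum>i\<in>F. coord x i *\<^sub>C ket i) - x))\<^sup>2)) \<longlongrightarrow> sqrt 0)
      (finite_subsets_at_top UNIV)"
    by (rule tendsto_real_sqrt)
  then have "((\<lambda>F. norm ((\<Sum>i\<in>F. coord x i *\<^sub>C ket i) - x)) \<longlongrightarrow> 0) (finite_subsets_at_top UNIV)"
    by simp
  then show ?thesis
    unfolding has_sum_def using tendsto_norm_zero_iff Lim_null by blast
qed

section \<open>Algebra and norm of bounded operators\<close>

lemma app_scaleC_right: "app T (c *\<^sub>C x) = c *\<^sub>C app T x"
  using blinfun_of[of T] by simp

lemma app_add: "app (S + T) x = app S x + app T x"
  by (simp add: plus_bop.rep_eq blinfun.add_left)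

lemma app_diff: "app (S - T) x = app S x - app T x"
  by (simp add: minus_bop.rep_eq blinfun.diff_left)

lemma app_zero [simp]: "app 0 x = 0"
  by (simp add: zero_bop.rep_eq)

lemma app_one [simp]: "app 1 x = x"
  by (simp add: one_bop.rep_eq)

lemma app_mult: "app (S * T) x = app S (app T x)"
  by (simp add: times_bop.rep_eq)

lemma app_sum: "app (sum f F) x = (\<Sum>i\<in>F. app (f i) x)"
  by (induction F rule: infinite_finite_induct) (auto simp: app_add)

lemma norm_app_le: "norm (app T x) \<le> norm T * norm x"
  by (simp add: norm_bop.rep_eq norm_blinfun)

lemma norm_bop_le: "0 \<le> M \<Longrightarrow> (\<And>x. norm (app T x) \<le> M * norm x) \<Longrightarrow> norm T \<le> M"
  unfolding norm_bop.rep_eq by (rule norm_blinfun_bound)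

lemma norm_scaleC_bop: "norm (c *\<^sub>C T) = cmod c * norm T" for T :: "'a bop"
proof -
  have le: "norm (c *\<^sub>C T) \<le> cmod c * norm T" for c and T :: "'a bop"
    using norm_app_le[of T]
    by (intro norm_bop_le) (auto simp: app_scaleC norm_scaleC_ell2 mult.assoc mult_left_mono)
  show ?thesis
  proof (cases "c = 0")
    case False
    have "norm T = norm (inverse c *\<^sub>C c *\<^sub>C T)"
      using False by (simp add: scaleC_scaleC scaleC_one)
    also have "\<dots> \<le> inverse (cmod c) * norm (c *\<^sub>C T)"
      by (metis le norm_inverse)
    finally have "cmod c * norm T \<le> norm (c *\<^sub>C T)"
      using False by (simp add: field_simps)
    with le show ?thesis by (intro order_antisym)
  qed simp
qed

lemma scaleC_mult_left: "(c *\<^sub>C S) * T = c *\<^sub>C (S * T)" for S T :: "'a bop"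
  by (rule bop_eqI) (simp add: app_mult app_scaleC)

lemma scaleC_mult_right: "S * (c *\<^sub>C T) = c *\<^sub>C (S * T)" for S T :: "'a bop"
  by (rule bop_eqI) (simp add: app_mult app_scaleC app_scaleC_right)

lemma bounded_linear_scaleC_bop: "bounded_linear (\<lambda>T :: 'a bop. c *\<^sub>C T)"
  by (rule bounded_linear_intro[where K = "cmod c"])
     (simp_all add: scaleC_add_right scaleR_scaleC scaleC_scaleC mult.commute norm_scaleC_bop)

text \<open>The way in which adjoints, tensor products, the associator and weighted compositions are
  later obtained as operators.\<close>

lemma ex_bop:
  assumes "\<And>x y. f (x + y) = f x + f y" "\<And>c x. f (c *\<^sub>C x) = c *\<^sub>C f x"
    and "\<And>x. norm (f x) \<le> K * norm x"
  shows "\<exists>T :: 'a bop. \<forall>x. app T x = f x"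
proof -
  have "bounded_linear f"
    using assms by (intro bounded_linear_intro[where K = K]) (simp_all add: scaleR_scaleC mult.commute)
  then have "blinfun_of (Abs_bop (Blinfun f)) = Blinfun f"
    by (subst Abs_bop_inverse) (auto simp: bounded_linear_Blinfun_apply assms)
  with \<open>bounded_linear f\<close> show ?thesis
    by (metis bounded_linear_Blinfun_apply)
qed

lemma bop_eq_on_kets:
  fixes S T :: "'a bop"
  assumes "\<And>i. app S (ket i) = app T (ket i)"
  shows "S = T"
proof (rule bop_eqI)
  fix x :: "'a ell2"
  have "((\<lambda>i. app R (coord x i *\<^sub>C ket i)) has_sum app R x) UNIV" for R
    by (rule has_sum_bounded_linear[OF blinfun.bounded_linear_right ell2_has_sum_ket])
  from this[of S] this[of T] show "app S x = app T x"
    by (simp add: app_scaleC_right assms infsumI has_sum_unique)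
qed

instance ell2 :: (type) banach ..

text \<open>The limit is given as a bounded real-linear map; what remains is its complex linearity,
  which passes to pointwise limits.\<close>

lemma convergent_bop:
  assumes "\<And>n. blinfun_of (X n) = Y n" "Y \<longlonglongrightarrow> L"
  shows "\<exists>T. X \<longlonglongrightarrow> T"
proof -
  have "L (c *\<^sub>C x) = c *\<^sub>C L x" for c x
  proof (rule LIMSEQ_unique)
    show "(\<lambda>n. Y n (c *\<^sub>C x)) \<longlonglongrightarrow> L (c *\<^sub>C x)"
      by (intro blinfun.tendsto assms tendsto_const)
    have "(\<lambda>n. c *\<^sub>C Y n x) \<longlonglongrightarrow> c *\<^sub>C L x"
      by (intro bounded_linear.tendsto[OF scaleC_ell2_bounded] blinfun.tendsto assms tendsto_const)
    then show "(\<lambda>n. Y n (c *\<^sub>C x)) \<longlonglongrightarrow> c *\<^sub>C L x"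
      by (simp add: assms(1)[symmetric] app_scaleC_right)
  qed
  then have L: "blinfun_of (Abs_bop L) = L"
    by (simp add: Abs_bop_inverse)
  have "X \<longlonglongrightarrow> Abs_bop L"
    using assms(2) unfolding tendsto_iff dist_norm
    by (simp add: norm_bop.rep_eq minus_bop.rep_eq L assms(1))
  then show ?thesis ..
qed

instance bop :: (type) banach
proof
  fix X :: "nat \<Rightarrow> 'a bop"
  assume "Cauchy X"
  then have "Cauchy (\<lambda>n. blinfun_of (X n))"
    unfolding Cauchy_def dist_norm by (simp add: norm_bop.rep_eq minus_bop.rep_eq)
  then obtain L where "(\<lambda>n. blinfun_of (X n)) \<longlonglongrightarrow> L"
    using Cauchy_convergent convergent_def by blast
  then show "convergent X"
    using convergent_bop[of X "\<lambda>n. blinfun_of (X n)" L] by (auto simp: convergent_def)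
qed

text \<open>The coordinates of the adjoint vector have to be <T e_i, y>. Collected over a finite
  \<open>F\<close> into a vector \<open>z\<close>, they satisfy |z|^2 = <T z, y> <= |T| |z| |y|;
  cancelling |z| gives a bound uniform in \<open>F\<close>.\<close>

lemma adj_coord_summable:
  fixes T :: "'a bop"
  shows "(\<lambda>i. (cmod (cinner (app T (ket i)) y))\<^sup>2) summable_on UNIV"
    and "finite F \<Longrightarrow> (\<Sum>i\<in>F. (cmod (cinner (app T (ket i)) y))\<^sup>2) \<le> (norm T * norm y)\<^sup>2"
proof -
  have bd: "(\<Sum>i\<in>F. (cmod (cinner (app T (ket i)) y))\<^sup>2) \<le> (norm T * norm y)\<^sup>2" if F: "finite F" for F
  proof -
    define z where "z = (\<Sum>i\<in>F. cinner (app T (ket i)) y *\<^sub>C ket i)"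
    let ?s = "\<Sum>i\<in>F. (cmod (cinner (app T (ket i)) y))\<^sup>2"
    have Tz: "cinner (app T z) y = complex_of_real ?s"
      unfolding z_def
      by (simp add: blinfun.sum_right app_scaleC_right cinner_sum_left cinner_scaleC_left
          complex_norm_square mult.commute del: of_real_power)
    have cz: "cinner z z = complex_of_real ?s"
      unfolding z_def
      by (simp add: cinner_sum_left cinner_sum_right cinner_scaleC_left cinner_scaleC_right
          cinner_ket_left coord_ket F if_distrib complex_norm_square mult.commute
          del: of_real_power cong: if_cong)
    have s0: "0 \<le> ?s" by (simp add: sum_nonneg)
    have nz: "?s = (norm z)\<^sup>2" using cz unfolding cinner_norm by (simp only: of_real_eq_iff)
    have "(norm z)\<^sup>2 \<le> norm (app T z) * norm y"
      using cinner_cauchy_schwarz[of "app T z" y] s0 nz unfolding Tz norm_of_real by simp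
    also have "\<dots> \<le> norm T * norm z * norm y"
      by (intro mult_right_mono norm_app_le) simp
    finally have "norm z * norm z \<le> norm z * (norm T * norm y)"
      by (simp add: power2_eq_square mult_ac)
    then have "norm z \<le> norm T * norm y"
      by (cases "norm z = 0") (simp_all add: mult_le_cancel_left)
    then show ?thesis unfolding nz by (intro power_mono) simp_all
  qed
  show "(\<lambda>i. (cmod (cinner (app T (ket i)) y))\<^sup>2) summable_on UNIV"
    by (rule nonneg_bdd_above_summable_on) (use bd in \<open>auto simp: bdd_above_def\<close>)
  show "finite F \<Longrightarrow> (\<Sum>i\<in>F. (cmod (cinner (app T (ket i)) y))\<^sup>2) \<le> (norm T * norm y)\<^sup>2"
    by (rule bd)
qed

text \<open>\<open>adj\<close> is a definite description, so an adjoint has to be exhibited. It is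
  given by its matrix coefficients, and the defining identity follows by expanding the other vector
  in kets.\<close>

lemma ex_adj:
  fixes T :: "'a bop"
  shows "\<exists>S. \<forall>x y. cinner (app S x) y = cinner x (app T y)"
proof -
  define f where "f y = Abs_ell2 (\<lambda>i. cinner (app T (ket i)) y)" for y
  have cf: "coord (f y) i = cinner (app T (ket i)) y" for y i
    unfolding f_def by (subst Abs_ell2_inverse) (use adj_coord_summable in auto)
  have "norm (f y) \<le> norm T * norm y" for y
  proof -
    have "(norm (f y))\<^sup>2 \<le> (norm T * norm y)\<^sup>2"
      unfolding norm_ell2_square cf
      by (rule infsum_le_finite_sums) (use adj_coord_summable in auto)
    then show ?thesis by (simp add: power2_le_iff_abs_le)
  qed
  then obtain S where S: "\<And>y. app S y = f y"
    using ex_bop[of f "norm T"]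
    by (auto simp: ell2_eqI cf plus_ell2.rep_eq scaleC_ell2.rep_eq cinner_add_right cinner_scaleC_right)
  have "cinner (app S x) y = cinner x (app T y)" for x y
  proof -
    have "cinner (app T y) x = cinner y (f x)"
    proof (rule has_sum_unique)
      have "((\<lambda>i. cinner (app T (coord y i *\<^sub>C ket i)) x) has_sum cinner (app T y) x) UNIV"
        by (rule has_sum_bounded_linear[OF bounded_linear_compose[OF bounded_linear_cinner_left
            blinfun.bounded_linear_right] ell2_has_sum_ket])
      then show "((\<lambda>i. cnj (coord y i) * coord (f x) i) has_sum cinner (app T y) x) UNIV"
        by (simp add: app_scaleC_right cinner_scaleC_left cf)
      show "((\<lambda>i. cnj (coord y i) * coord (f x) i) has_sum cinner y (f x)) UNIV"
        unfolding cinner_def by (rule has_sum_infsum[OF cinner_summable])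
    qed
    then show ?thesis by (metis S cinner_commute)
  qed
  then show ?thesis by blast
qed

section \<open>Calculus of adjoints\<close>

lemma adj_unique:
  assumes "\<And>x y. cinner (app S x) y = cinner x (app T y)"
  shows "T\<^sup>\<dagger> = S"
  unfolding adj_def
proof (rule the_equality)
  show "\<forall>x y. cinner (app S x) y = cinner x (app T y)" using assms by blast
  fix R assume R: "\<forall>x y. cinner (app R x) y = cinner x (app T y)"
  show "R = S"
  proof (rule bop_eqI, rule cinner_ext)
    fix x y show "cinner y (app R x) = cinner y (app S x)"
      by (metis R assms cinner_commute)
  qed
qed

lemma cinner_adj_left: "cinner (app (T\<^sup>\<dagger>) x) y = cinner x (app T y)"
  using ex_adj[of T] adj_unique by metis

lemma cinner_adj_right: "cinner x (app (T\<^sup>\<dagger>) y) = cinner (app T x) y"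
  by (metis cinner_adj_left cinner_commute)

lemma adj_adj [simp]: "(T\<^sup>\<dagger>)\<^sup>\<dagger> = T"
  by (rule adj_unique) (simp add: cinner_adj_right)

lemma adj_add: "(S + T)\<^sup>\<dagger> = S\<^sup>\<dagger> + T\<^sup>\<dagger>"
  by (rule adj_unique) (simp add: app_add cinner_add_left cinner_add_right cinner_adj_left)

lemma adj_mult: "(S * T)\<^sup>\<dagger> = T\<^sup>\<dagger> * S\<^sup>\<dagger>"
  by (rule adj_unique) (simp add: app_mult cinner_adj_left)

lemma adj_scaleC: "(c *\<^sub>C T)\<^sup>\<dagger> = cnj c *\<^sub>C T\<^sup>\<dagger>"
  by (rule adj_unique) (simp add: app_scaleC cinner_scaleC_left cinner_scaleC_right cinner_adj_left)

lemma adj_scaleR: "(r *\<^sub>R T)\<^sup>\<dagger> = r *\<^sub>R T\<^sup>\<dagger>"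
  by (simp add: scaleR_scaleC adj_scaleC)

lemma adj_one [simp]: "1\<^sup>\<dagger> = 1"
  by (rule adj_unique) simp

lemma adj_zero [simp]: "0\<^sup>\<dagger> = 0"
  by (rule adj_unique) simp

lemma adj_diff: "(S - T)\<^sup>\<dagger> = S\<^sup>\<dagger> - T\<^sup>\<dagger>"
  by (rule adj_unique) (simp add: app_diff cinner_diff_left cinner_diff_right cinner_adj_left)

lemma adj_sum: "(sum f F)\<^sup>\<dagger> = (\<Sum>i\<in>F. (f i)\<^sup>\<dagger>)"
  by (induction F rule: infinite_finite_induct) (auto simp: adj_add)

lemma adj_power: "(T ^ n)\<^sup>\<dagger> = (T\<^sup>\<dagger>) ^ n"
  by (induction n) (simp_all add: adj_mult power_commutes)

lemma norm_app_sq: "(norm (app T x))\<^sup>2 = Re (cinner x (app (T\<^sup>\<dagger> * T) x))"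
  by (simp add: app_mult cinner_adj_right cinner_norm)

lemma norm_adj_le: "norm (T\<^sup>\<dagger>) \<le> norm T"
proof (rule norm_bop_le)
  fix x
  let ?y = "app (T\<^sup>\<dagger>) x"
  have "(norm ?y)\<^sup>2 = cmod (cinner (app T ?y) x)"
    by (simp only: cinner_adj_right[symmetric] cinner_norm) (simp add: norm_power)
  also have "\<dots> \<le> norm (app T ?y) * norm x" by (rule cinner_cauchy_schwarz)
  also have "\<dots> \<le> norm T * norm ?y * norm x"
    by (intro mult_right_mono norm_app_le) simp
  finally have "norm ?y * norm ?y \<le> norm ?y * (norm T * norm x)"
    by (simp add: power2_eq_square mult_ac)
  then show "norm ?y \<le> norm T * norm x"
    by (cases "norm ?y = 0") (simp_all add: mult_le_cancel_left)
qed simp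

lemma bounded_linear_adj: "bounded_linear adj"
  by (rule bounded_linear_intro[where K = 1]) (simp_all add: adj_add adj_scaleR norm_adj_le)

lemma adj_mult_self_eq_0: "T\<^sup>\<dagger> * T = 0 \<Longrightarrow> T = 0"
  by (rule bop_eqI) (metis app_zero cinner_zero_right complex_Re_numeral norm_app_sq norm_eq_zero
      zero_complex.sel(1) zero_eq_power2)

section \<open>Projections and partial isometries\<close>

lemma projectionD: "projection p \<Longrightarrow> p * p = p" "projection p \<Longrightarrow> p\<^sup>\<dagger> = p"
  by (simp_all add: projection_def)

lemma norm_app_projection: "projection p \<Longrightarrow> complex_of_real ((norm (app p x))\<^sup>2) = cinner x (app p x)"
  by (metis app_mult cinner_adj_right cinner_norm projectionD)

text \<open>For \<open>v\<close> in the range of \<open>p j\<close>, the squared norms of all the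
  vectors \<open>app (p k) v\<close> add up to that of \<open>v\<close>, and the index
  \<open>j\<close> alone already exhausts this sum.\<close>

lemma projections_orthogonal:
  assumes "finite I" "\<And>i. i \<in> I \<Longrightarrow> projection (p i)" "(\<Sum>i\<in>I. p i) = 1"
    and "i \<in> I" "j \<in> I" "i \<noteq> j"
  shows "p i * p j = 0"
proof (rule bop_eqI)
  fix x
  define v where "v = app (p j) x"
  have v: "app (p j) v = v"
    unfolding v_def using projectionD(1)[OF assms(2)[OF assms(5)]] by (metis app_mult)
  have "complex_of_real (\<Sum>k\<in>I. (norm (app (p k) v))\<^sup>2) = cinner v (app (\<Sum>k\<in>I. p k) v)"
    by (simp add: app_sum cinner_sum_right norm_app_projection[OF assms(2), symmetric])
  also have "\<dots> = complex_of_real ((norm v)\<^sup>2)"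
    by (simp add: assms(3) cinner_norm)
  finally have "(\<Sum>k\<in>I. (norm (app (p k) v))\<^sup>2) = (norm v)\<^sup>2"
    by (simp only: of_real_eq_iff)
  moreover have "(\<Sum>k\<in>{i,j}. (norm (app (p k) v))\<^sup>2) \<le> (\<Sum>k\<in>I. (norm (app (p k) v))\<^sup>2)"
    by (rule sum_mono2) (use assms in auto)
  ultimately have "(norm (app (p i) v))\<^sup>2 \<le> 0"
    using assms(6) v by simp
  then show "app (p i * p j) x = app 0 x"
    by (simp add: app_mult v_def)
qed

text \<open>Commutation puts the image of \<open>X i * p i\<close> into the range of
  \<open>p i\<close>. The summands thus have mutually orthogonal images, and Pythagoras bounds the
  block-diagonal sum by its largest block.\<close>

lemma norm_sum_projections_le:
  assumes fin: "finite I" and p: "\<And>i. i \<in> I \<Longrightarrow> projection (p i)" "(\<Sum>i\<in>I. p i) = 1"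
    and comm: "\<And>i. i \<in> I \<Longrightarrow> X i * p i = p i * X i"
    and bd: "\<And>i. i \<in> I \<Longrightarrow> norm (X i) \<le> M" and M: "0 \<le> M"
  shows "norm (\<Sum>i\<in>I. X i * p i) \<le> M"
proof (rule norm_bop_le[OF M])
  fix v
  have orth: "cinner (app (X i * p i) v) (app (X j * p j) v) = 0" if "i \<in> I" "j \<in> I" "i \<noteq> j" for i j
  proof -
    have "cinner (app (X i * p i) v) (app (X j * p j) v)
        = cinner (app (X i * p i) v) (app ((p j)\<^sup>\<dagger> * X j) v)"
      using comm that p projectionD by metis
    also have "\<dots> = cinner (app (p j * p i * X i) v) (app (X j) v)"
      using comm that by (simp add: app_mult cinner_adj_right)
    also have "p j * p i = 0"
      by (rule projections_orthogonal[of I p]) (use fin p that in auto)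
    finally show ?thesis by simp
  qed
  have "complex_of_real ((norm (app (\<Sum>i\<in>I. X i * p i) v))\<^sup>2)
      = (\<Sum>i\<in>I. \<Sum>j\<in>I. cinner (app (X i * p i) v) (app (X j * p j) v))"
    unfolding cinner_norm[symmetric] by (simp add: app_sum cinner_sum_left cinner_sum_right, rule sum.swap)
  also have "\<dots> = (\<Sum>i\<in>I. \<Sum>j\<in>I. if i = j then cinner (app (X i * p i) v) (app (X j * p j) v) else 0)"
    by (intro sum.cong refl) (auto simp: orth)
  also have "\<dots> = complex_of_real (\<Sum>i\<in>I. (norm (app (X i * p i) v))\<^sup>2)"
    by (simp add: fin cinner_norm)
  finally have "(norm (app (\<Sum>i\<in>I. X i * p i) v))\<^sup>2 = (\<Sum>i\<in>I. (norm (app (X i * p i) v))\<^sup>2)"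
    by (simp only: of_real_eq_iff)
  also have "\<dots> \<le> (\<Sum>i\<in>I. M\<^sup>2 * (norm (app (p i) v))\<^sup>2)"
  proof (rule sum_mono)
    fix i assume i: "i \<in> I"
    have "norm (app (X i * p i) v) \<le> norm (X i) * norm (app (p i) v)"
      by (simp add: app_mult norm_app_le)
    also have "\<dots> \<le> M * norm (app (p i) v)"
      by (intro mult_right_mono bd i) simp
    finally have "(norm (app (X i * p i) v))\<^sup>2 \<le> (M * norm (app (p i) v))\<^sup>2"
      by (rule power_mono) simp
    then show "(norm (app (X i * p i) v))\<^sup>2 \<le> M\<^sup>2 * (norm (app (p i) v))\<^sup>2"
      by (simp add: power_mult_distrib)
  qed
  also have "\<dots> = M\<^sup>2 * (norm v)\<^sup>2"
  proof -
    have "complex_of_real (\<Sum>k\<in>I. (norm (app (p k) v))\<^sup>2) = cinner v (app (\<Sum>k\<in>I. p k) v)"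
      by (simp add: app_sum cinner_sum_right norm_app_projection[OF p(1), symmetric])
    also have "\<dots> = complex_of_real ((norm v)\<^sup>2)"
      by (simp add: p(2) cinner_norm)
    finally show ?thesis by (simp only: of_real_eq_iff sum_distrib_left[symmetric])
  qed
  finally have "(norm (app (\<Sum>i\<in>I. X i * p i) v))\<^sup>2 \<le> (M * norm v)\<^sup>2"
    by (simp add: power_mult_distrib)
  then show "norm (app (\<Sum>i\<in>I. X i * p i) v) \<le> M * norm v"
    using M by (simp add: power2_le_iff_abs_le)
qed

lemma partial_isometry_adj: "partial_isometry v \<Longrightarrow> v\<^sup>\<dagger> * v * v\<^sup>\<dagger> = v\<^sup>\<dagger>"
  unfolding partial_isometry_def by (metis adj_adj adj_mult mult.assoc)

text \<open>The partial isometry identity for \<open>v * w\<close>, multiplied by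
  \<open>v\<^sup>\<dagger>\<close> on the left and by \<open>w\<^sup>\<dagger>\<close> on the right,
  says that the product of the two projections is idempotent. For projections this forces
  commutation.\<close>

lemma partial_isometry_product_commute:
  assumes v: "partial_isometry v" and w: "partial_isometry w" and vw: "partial_isometry (v * w)"
  shows "(v\<^sup>\<dagger> * v) * (w * w\<^sup>\<dagger>) = (w * w\<^sup>\<dagger>) * (v\<^sup>\<dagger> * v)"
proof -
  define q where "q = v\<^sup>\<dagger> * v"
  define p where "p = w * w\<^sup>\<dagger>"
  have q: "q * q = q" "q\<^sup>\<dagger> = q"
    using partial_isometry_adj[OF v] by (simp_all add: q_def adj_mult mult.assoc[symmetric])
  have p: "p * p = p" "p\<^sup>\<dagger> = p"
    using w by (simp_all add: p_def adj_mult mult.assoc[symmetric] partial_isometry_def)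
  have "v\<^sup>\<dagger> * ((v * w) * (v * w)\<^sup>\<dagger> * (v * w)) * w\<^sup>\<dagger> = v\<^sup>\<dagger> * (v * w) * w\<^sup>\<dagger>"
    using vw by (simp add: partial_isometry_def)
  then have qpqp: "q * p * q * p = q * p"
    by (simp add: q_def p_def adj_mult mult.assoc)
  \<comment> \<open>\<open>d\<close> is (1 - p) q p. Idempotency makes
    \<open>d\<^sup>\<dagger> * d\<close> vanish, so q p equals the self-adjoint operator p q p, and
    taking adjoints gives the same for p q.\<close>
  define d where "d = q * p - p * q * p"
  have "d\<^sup>\<dagger> * d = p * (q * q) * p - p * q * (p * q * p) - p * q * p * q * p + p * q * (p * p) * (q * p)"
    by (simp add: d_def adj_diff adj_mult p(2) q(2) algebra_simps)
  also have "\<dots> = p * (q * p - q * p * q * p)"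
    by (simp add: p(1) q(1) algebra_simps)
  also have "\<dots> = 0" by (simp add: qpqp)
  finally have "d = 0" by (rule adj_mult_self_eq_0)
  then have 1: "q * p = p * q * p" by (simp add: d_def)
  then have "(q * p)\<^sup>\<dagger> = (p * q * p)\<^sup>\<dagger>" by simp
  then have "p * q = p * q * p" unfolding adj_mult p(2) q(2) mult.assoc .
  with 1 show ?thesis by (simp add: q_def p_def)
qed

section \<open>Star homomorphisms\<close>

lemma star_hom_add: "unital_star_hom B D h \<Longrightarrow> a \<in> B \<Longrightarrow> b \<in> B \<Longrightarrow> h (a + b) = h a + h b"
  and star_hom_mult: "unital_star_hom B D h \<Longrightarrow> a \<in> B \<Longrightarrow> b \<in> B \<Longrightarrow> h (a * b) = h a * h b"
  and star_hom_scaleC: "unital_star_hom B D h \<Longrightarrow> a \<in> B \<Longrightarrow> h (c *\<^sub>C a) = c *\<^sub>C h a"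
  and star_hom_adj: "unital_star_hom B D h \<Longrightarrow> a \<in> B \<Longrightarrow> h (a\<^sup>\<dagger>) = (h a)\<^sup>\<dagger>"
  and star_hom_one: "unital_star_hom B D h \<Longrightarrow> h 1 = 1"
  and star_hom_in: "unital_star_hom B D h \<Longrightarrow> a \<in> B \<Longrightarrow> h a \<in> D"
  by (auto simp: unital_star_hom_def)

lemma cstar_one: "unital_cstar_algebra B \<Longrightarrow> 1 \<in> B"
  and cstar_add: "unital_cstar_algebra B \<Longrightarrow> a \<in> B \<Longrightarrow> b \<in> B \<Longrightarrow> a + b \<in> B"
  and cstar_mult: "unital_cstar_algebra B \<Longrightarrow> a \<in> B \<Longrightarrow> b \<in> B \<Longrightarrow> a * b \<in> B"
  and cstar_scaleC: "unital_cstar_algebra B \<Longrightarrow> a \<in> B \<Longrightarrow> c *\<^sub>C a \<in> B"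
  and cstar_adj: "unital_cstar_algebra B \<Longrightarrow> a \<in> B \<Longrightarrow> a\<^sup>\<dagger> \<in> B"
  and cstar_closed: "unital_cstar_algebra B \<Longrightarrow> closed B"
  by (auto simp: unital_cstar_algebra_def)

lemma cstar_zero: "unital_cstar_algebra B \<Longrightarrow> 0 \<in> B"
  using cstar_scaleC[of B 1 0] cstar_one[of B] by simp

lemma cstar_scaleR: "unital_cstar_algebra B \<Longrightarrow> a \<in> B \<Longrightarrow> r *\<^sub>R a \<in> B"
  by (simp add: scaleR_scaleC cstar_scaleC)

lemma cstar_diff: "unital_cstar_algebra B \<Longrightarrow> a \<in> B \<Longrightarrow> b \<in> B \<Longrightarrow> a - b \<in> B"
  using cstar_add[of B a "(-1) *\<^sub>C b"] cstar_scaleC[of B b "-1"] by simp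

lemma cstar_sum: "unital_cstar_algebra B \<Longrightarrow> (\<And>i. i \<in> F \<Longrightarrow> f i \<in> B) \<Longrightarrow> sum f F \<in> B"
  by (induction F rule: infinite_finite_induct) (auto intro: cstar_zero cstar_add)

lemma cstar_prod_list: "unital_cstar_algebra B \<Longrightarrow> set xs \<subseteq> B \<Longrightarrow> prod_list xs \<in> B"
  by (induction xs) (auto intro: cstar_one cstar_mult)

lemma cstar_power: "unital_cstar_algebra B \<Longrightarrow> a \<in> B \<Longrightarrow> a ^ n \<in> B"
  by (induction n) (auto intro: cstar_one cstar_mult)

lemma cstar_subspace: "unital_cstar_algebra B \<Longrightarrow> complex_vector.subspace B"
  by (auto simp: complex_vector.subspace_def cstar_zero cstar_add cstar_scaleC)

lemma star_hom_zero: "unital_star_hom B D h \<Longrightarrow> unital_cstar_algebra B \<Longrightarrow> h 0 = 0"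
  using star_hom_scaleC[of B D h 1 0] cstar_one[of B] by simp

lemma star_hom_sum:
  assumes "unital_star_hom B D h" "unital_cstar_algebra B" "\<And>i. i \<in> F \<Longrightarrow> f i \<in> B"
  shows "h (sum f F) = (\<Sum>i\<in>F. h (f i))"
  using assms(3)
  by (induction F rule: infinite_finite_induct)
     (auto simp: star_hom_zero[OF assms(1,2)] star_hom_add[OF assms(1)] cstar_sum[OF assms(2)])

lemma star_hom_diff:
  assumes "unital_star_hom B D h" "unital_cstar_algebra B" "a \<in> B" "b \<in> B"
  shows "h (a - b) = h a - h b"
proof -
  have "h (a - b) = h (a + (-1) *\<^sub>C b)" by simp
  also have "\<dots> = h a + (-1) *\<^sub>C h b"
    using assms by (metis cstar_scaleC star_hom_add star_hom_scaleC)
  finally show ?thesis by simp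
qed

text \<open>The square root of \<open>1 - a\<^sup>\<dagger> a\<close> is given by the binomial series; its square is computed with
  the Cauchy product and Vandermonde's identity.\<close>

lemma ex_sqrt_one_minus:
  assumes B: "unital_cstar_algebra B" and a: "a \<in> B" "norm a < 1"
  shows "\<exists>y\<in>B. y\<^sup>\<dagger> * y + a\<^sup>\<dagger> * a = 1"
proof -
  define t where "t = a\<^sup>\<dagger> * a"
  define c :: "nat \<Rightarrow> real" where "c n = ((1/2) gchoose n) * (-1) ^ n" for n
  have tB: "t \<in> B" and tadj: "t\<^sup>\<dagger> = t"
    using a B by (auto simp: t_def adj_mult intro: cstar_mult cstar_adj)
  have "norm t \<le> norm a * norm a"
    unfolding t_def by (intro order_trans[OF norm_mult_ineq] mult_right_mono norm_adj_le) simp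
  also have "\<dots> < 1" using a(2) by (metis abs_norm_cancel abs_square_less_1 power2_eq_square)
  finally have nt: "norm t < 1" .
  \<comment> \<open>The binomial theorem gives mere convergence at \<open>-r\<close>. A radius
    strictly beyond \<open>norm t\<close> turns it into absolute convergence at
    \<open>norm t\<close>, which the Cauchy product requires.\<close>
  obtain r where r: "norm t < r" "r < 1" using dense[OF nt] by blast
  have rpos: "0 < r" using r(1) norm_ge_zero[of t] by linarith
  have "summable (\<lambda>n. ((1/2) gchoose n) * (-r) ^ n)"
    using gen_binomial_real[of "-r" "1/2"] r rpos by (auto simp: sums_iff)
  then have s0: "summable (\<lambda>n. norm (((1/2) gchoose n) * (norm t) ^ n))"
    by (rule powser_insidea) (use r rpos in simp)
  have s: "summable (\<lambda>n. norm (c n *\<^sub>R t ^ n))"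
  proof (rule summable_comparison_test'[OF s0])
    fix n show "norm (norm (c n *\<^sub>R t ^ n)) \<le> norm (((1/2) gchoose n) * (norm t) ^ n)"
      by (simp add: c_def abs_mult power_abs mult_left_mono norm_power_ineq)
  qed
  define y where "y = (\<Sum>n. c n *\<^sub>R t ^ n)"
  have ys: "(\<lambda>n. \<Sum>i<n. c i *\<^sub>R t ^ i) \<longlonglongrightarrow> y"
    using summable_sums[OF summable_norm_cancel[OF s]] by (simp add: y_def sums_def)
  have yB: "y \<in> B"
    by (rule closed_sequentially[OF cstar_closed[OF B] _ ys])
       (intro cstar_sum cstar_scaleR cstar_power B tB)
  have "(\<lambda>n. (\<Sum>i<n. c i *\<^sub>R t ^ i)\<^sup>\<dagger>) \<longlonglongrightarrow> y\<^sup>\<dagger>"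
    by (rule bounded_linear.tendsto[OF bounded_linear_adj ys])
  then have "(\<lambda>n. \<Sum>i<n. c i *\<^sub>R t ^ i) \<longlonglongrightarrow> y\<^sup>\<dagger>"
    by (simp add: adj_sum adj_scaleR adj_power tadj)
  with ys have yadj: "y\<^sup>\<dagger> = y" by (rule LIMSEQ_unique[symmetric])
  have "(\<lambda>k. \<Sum>i\<le>k. (c i *\<^sub>R t ^ i) * (c (k - i) *\<^sub>R t ^ (k - i))) sums (y * y)"
    unfolding y_def by (rule Cauchy_product_sums[OF s s])
  moreover have "(\<Sum>i\<le>k. (c i *\<^sub>R t ^ i) * (c (k - i) *\<^sub>R t ^ (k - i)))
      = (if k = 0 then 1 else if k = 1 then - t else 0)" for k
  proof -
    have "(\<Sum>i\<le>k. (c i *\<^sub>R t ^ i) * (c (k - i) *\<^sub>R t ^ (k - i))) = (\<Sum>i\<le>k. (c i * c (k - i)) *\<^sub>R t ^ k)"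
      by (intro sum.cong refl) (simp add: power_add[symmetric])
    also have "\<dots> = (\<Sum>i\<le>k. c i * c (k - i)) *\<^sub>R t ^ k"
      by (simp add: scaleR_left.sum)
    also have "(\<Sum>i\<le>k. c i * c (k - i))
        = (\<Sum>i\<le>k. (-1) ^ k * (((1/2) gchoose i) * ((1/2) gchoose (k - i))))"
      by (intro sum.cong refl) (simp add: c_def power_add[symmetric])
    also have "\<dots> = (-1) ^ k * ((1/2 + 1/2 :: real) gchoose k)"
      by (simp only: sum_distrib_left[symmetric] gbinomial_Vandermonde atMost_atLeast0)
    \<comment> \<open>The binomial coefficient of 1 vanishes from k = 2 on, so only the terms 1 and
      -t survive.\<close>
    also have "(1/2 + 1/2 :: real) gchoose k = of_nat (1 choose k)"
      by (simp add: binomial_gbinomial)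
    finally show ?thesis by (cases k) (auto simp: binomial_eq_0)
  qed
  ultimately have "(\<lambda>k. if k = 0 then 1 else if k = 1 then - t else 0) sums (y * y)" by simp
  moreover have "(\<lambda>k. if k = 0 then 1 else if k = 1 then - t else 0) sums
      (\<Sum>k\<in>{0,1::nat}. if k = 0 then 1 else if k = 1 then - t else 0)"
    by (rule sums_finite) auto
  ultimately have "y * y = (\<Sum>k\<in>{0,1::nat}. if k = 0 then 1 else if k = 1 then - t else 0)"
    by (rule sums_unique2)
  then have "y * y = 1 - t" by simp
  with yB yadj show ?thesis by (intro bexI[of _ y]) (simp_all add: t_def)
qed

text \<open>For \<open>\<parallel>a\<parallel> < 1\<close>, applying the homomorphism to \<open>y\<^sup>\<dagger> y + a\<^sup>\<dagger> a = 1\<close> shows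
  \<open>\<parallel>h a v\<parallel>\<^sup>2 + \<parallel>h y v\<parallel>\<^sup>2 = \<parallel>v\<parallel>\<^sup>2\<close>.\<close>

lemma star_hom_contractive:
  assumes B: "unital_cstar_algebra B" and h: "unital_star_hom B D h" and a: "a \<in> B"
  shows "norm (h a) \<le> norm a"
proof -
  have le1: "norm (h b) \<le> 1" if b: "b \<in> B" "norm b < 1" for b
  proof (rule norm_bop_le)
    obtain y where y: "y \<in> B" "y\<^sup>\<dagger> * y + b\<^sup>\<dagger> * b = 1"
      using ex_sqrt_one_minus[OF B b] by blast
    have "h (y\<^sup>\<dagger> * y + b\<^sup>\<dagger> * b) = (h y)\<^sup>\<dagger> * h y + (h b)\<^sup>\<dagger> * h b"
      using y(1) b(1) B by (simp add: star_hom_add[OF h] star_hom_mult[OF h] star_hom_adj[OF h]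
          cstar_mult cstar_adj)
    then have 1: "(h y)\<^sup>\<dagger> * h y + (h b)\<^sup>\<dagger> * h b = 1"
      by (simp add: y(2) star_hom_one[OF h])
    fix v
    have "(norm (app (h y) v))\<^sup>2 + (norm (app (h b) v))\<^sup>2
        = Re (cinner v (app ((h y)\<^sup>\<dagger> * h y + (h b)\<^sup>\<dagger> * h b) v))"
      by (simp add: norm_app_sq app_add cinner_add_right)
    also have "\<dots> = (norm v)\<^sup>2" by (simp add: 1 cinner_norm)
    finally have "(norm (app (h b) v))\<^sup>2 \<le> (norm v)\<^sup>2"
      using zero_le_power2[of "norm (app (h y) v)"] by linarith
    then show "norm (app (h b) v) \<le> 1 * norm v" by (simp add: power2_le_iff_abs_le)
  qed simp
  show ?thesis
  proof (rule dense_ge)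
    fix r assume r: "norm a < r"
    then have rpos: "0 < r" using norm_ge_zero[of a] by linarith
    have nr: "cmod (complex_of_real (inverse r)) = inverse r"
      using rpos by (simp only: norm_of_real) simp
    have "norm (complex_of_real (inverse r) *\<^sub>C a) < 1"
      unfolding norm_scaleC_bop nr using r rpos by (simp add: field_simps)
    then have "norm (h (complex_of_real (inverse r) *\<^sub>C a)) \<le> 1"
      by (intro le1 cstar_scaleC[OF B] a)
    then have "inverse r * norm (h a) \<le> 1"
      unfolding star_hom_scaleC[OF h a] norm_scaleC_bop nr .
    then show "norm (h a) \<le> r"
      using rpos by (simp add: field_simps)
  qed
qed

text \<open>Carries identities from the span of the generators to its closure. The sequence has to
  stay in \<open>B\<close>, the only place where \<open>h\<close> is controlled.\<close>

lemma star_hom_tendsto: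
  assumes "unital_cstar_algebra B" "unital_star_hom B D h" "\<And>n. x n \<in> B" "x \<longlonglongrightarrow> l"
  shows "(\<lambda>n. h (x n)) \<longlonglongrightarrow> h l"
proof -
  have l: "l \<in> B" using closed_sequentially[OF cstar_closed] assms by blast
  have "(\<lambda>n. norm (x n - l)) \<longlonglongrightarrow> 0" using assms(4) by (simp add: LIM_zero_iff tendsto_norm_zero_iff)
  then have "(\<lambda>n. h (x n) - h l) \<longlonglongrightarrow> 0"
    by (rule Lim_null_comparison[rotated])
       (use star_hom_contractive[OF assms(1,2) cstar_diff[OF assms(1,3) l]]
          star_hom_diff[OF assms(2,1,3) l] in simp)
  then show ?thesis by (simp add: LIM_zero_iff)
qed

section \<open>Tensor products of operators\<close>

lemma coord_Abs_ell2: "(\<lambda>i. (cmod (f i))\<^sup>2) summable_on UNIV \<Longrightarrow> coord (Abs_ell2 f) = f"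
  by (simp add: Abs_ell2_inverse)

text \<open>Pulling back along a bijection of index sets is unitary; one construction serves the
  flip of two tensor factors, the associator and the weighted compositions.\<close>

definition reindex_vec :: "('b \<Rightarrow> 'a) \<Rightarrow> 'a ell2 \<Rightarrow> 'b ell2" where
  "reindex_vec f x = Abs_ell2 (\<lambda>i. coord x (f i))"

lemma coord_reindex_vec:
  assumes "bij f"
  shows "coord (reindex_vec f x) i = coord x (f i)"
  unfolding reindex_vec_def
  by (subst coord_Abs_ell2)
     (use summable_on_reindex_bij_betw[OF assms, of "\<lambda>p. (cmod (coord x p))\<^sup>2"] coord_summable[of x] in auto)

lemma norm_reindex_vec:
  assumes "bij f"
  shows "norm (reindex_vec f x) = norm x"
proof -
  have "(norm (reindex_vec f x))\<^sup>2 = (norm x)\<^sup>2"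
    unfolding norm_ell2_square coord_reindex_vec[OF assms]
    by (rule infsum_reindex_bij_betw[OF assms])
  then show ?thesis by simp
qed

lemma reindex_vec_linear:
  assumes "bij f"
  shows "reindex_vec f (x + y) = reindex_vec f x + reindex_vec f y"
    and "reindex_vec f (c *\<^sub>C x) = c *\<^sub>C reindex_vec f x"
  by (auto intro!: ell2_eqI simp: coord_reindex_vec[OF assms] plus_ell2.rep_eq scaleC_ell2.rep_eq)

text \<open>Views the space over pairs as the orthogonal sum of copies of the space over the second
  index, one for each \<open>i\<close>. The operator 1 \<otimes> T then acts row by row.\<close>

definition row :: "('a \<times> 'b) ell2 \<Rightarrow> 'a \<Rightarrow> 'b ell2" where
  "row x i = Abs_ell2 (\<lambda>j. coord x (i, j))"

lemma coord_row: "coord (row x i) j = coord x (i, j)"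
proof -
  have "(\<lambda>p. (cmod (coord x p))\<^sup>2) summable_on Pair i ` UNIV"
    by (rule summable_on_subset_banach[OF coord_summable]) simp
  then have "(\<lambda>j. (cmod (coord x (i, j)))\<^sup>2) summable_on UNIV"
    by (subst (asm) summable_on_reindex) (auto simp: inj_on_def comp_def)
  then show ?thesis by (simp add: row_def coord_Abs_ell2)
qed

lemma summable_norm_row: "(\<lambda>i. (norm (row x i))\<^sup>2) summable_on UNIV"
  and norm_row: "(\<Sum>\<^sub>\<infinity>i. (norm (row x i))\<^sup>2) = (norm x)\<^sup>2"
proof -
  have s: "(\<lambda>(i, j). (cmod (coord x (i, j)))\<^sup>2) summable_on Sigma UNIV (\<lambda>_. UNIV)"
    using coord_summable[of x] by (simp add: split_def)
  show "(\<lambda>i. (norm (row x i))\<^sup>2) summable_on UNIV"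
    unfolding norm_ell2_square coord_row by (rule summable_on_Sigma_banach[OF s])
  show "(\<Sum>\<^sub>\<infinity>i. (norm (row x i))\<^sup>2) = (norm x)\<^sup>2"
    unfolding norm_ell2_square coord_row infsum_Sigma'_banach[OF s] by (simp add: split_def)
qed

lemma norm_tensor_vec: "norm (tensor_vec x y) = norm x * norm y"
proof -
  have r: "row (tensor_vec x y) i = coord x i *\<^sub>C y" for i
    by (rule ell2_eqI) (simp add: coord_row tensor_vec.rep_eq scaleC_ell2.rep_eq)
  have "(norm (tensor_vec x y))\<^sup>2 = (norm x * norm y)\<^sup>2"
    unfolding norm_row[symmetric] r norm_scaleC_ell2 power_mult_distrib norm_ell2_square[of x]
    by (rule infsum_cmult_left')
  then show ?thesis by (simp add: power2_eq_iff_nonneg)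
qed

lemma tensor_vec_add_left: "tensor_vec (x + y) z = tensor_vec x z + tensor_vec y z"
  and tensor_vec_add_right: "tensor_vec z (x' + y') = tensor_vec z x' + tensor_vec z y'"
  and tensor_vec_scaleC_left: "tensor_vec (c *\<^sub>C x) z = c *\<^sub>C tensor_vec x z"
  and tensor_vec_scaleC_right: "tensor_vec z (c *\<^sub>C x') = c *\<^sub>C tensor_vec z x'"
  by (auto intro!: ell2_eqI simp: tensor_vec.rep_eq plus_ell2.rep_eq scaleC_ell2.rep_eq algebra_simps
      split: prod.split)

lemma ket_Pair: "ket (i, j) = tensor_vec (ket i) (ket j)"
  by (rule ell2_eqI) (auto simp: tensor_vec.rep_eq coord_ket split: prod.split)

lemma ex_tensor_one_left:
  fixes T :: "'b bop"
  shows "\<exists>R :: ('a \<times> 'b) bop. norm R \<le> norm T \<and> (\<forall>x y. app R (tensor_vec x y) = tensor_vec x (app T y))"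
proof -
  define f :: "('a \<times> 'b) ell2 \<Rightarrow> ('a \<times> 'b) ell2"
    where "f x = Abs_ell2 (\<lambda>(i, j). coord (app T (row x i)) j)" for x
  have le: "(norm (app T (row x i)))\<^sup>2 \<le> (norm T)\<^sup>2 * (norm (row x i))\<^sup>2" for x i
    using power_mono[OF norm_app_le[of T "row x i"], of 2] by (simp add: power_mult_distrib)
  have sum1: "(\<lambda>i. (norm T)\<^sup>2 * (norm (row x i))\<^sup>2) summable_on UNIV" for x
    by (intro summable_on_cmult_right summable_norm_row)
  have sum2: "(\<lambda>i. (norm (app T (row x i)))\<^sup>2) summable_on UNIV" for x
    by (rule summable_on_comparison_test[OF sum1]) (use le in auto)
  have "(\<lambda>p. norm ((\<lambda>(i, j). (cmod (coord (app T (row x i)) j))\<^sup>2) p)) summable_on UNIV \<times> UNIV" for x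
    by (rule Infinite_Sum.abs_summable_on_Sigma_iff[THEN iffD2])
       (use sum2[of x] in \<open>auto simp: coord_summable norm_ell2_square infsum_nonneg\<close>)
  then have cf: "coord (f x) (i, j) = coord (app T (row x i)) j" for x i j
    unfolding f_def by (subst coord_Abs_ell2) (simp_all add: case_prod_unfold)
  have rf: "row (f x) i = app T (row x i)" for x i
    by (rule ell2_eqI) (simp add: coord_row cf)
  have radd: "row (x + y) i = row x i + row y i" and rscale: "row (c *\<^sub>C x) i = c *\<^sub>C row x i"
    for x y :: "('a \<times> 'b) ell2" and c i
    by (auto intro!: ell2_eqI simp: coord_row plus_ell2.rep_eq scaleC_ell2.rep_eq)
  have nf: "norm (f x) \<le> norm T * norm x" for x
  proof -
    have "(norm (f x))\<^sup>2 \<le> (\<Sum>\<^sub>\<infinity>i. (norm T)\<^sup>2 * (norm (row x i))\<^sup>2)"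
      unfolding norm_row[symmetric] rf by (rule infsum_mono[OF sum2 sum1 le])
    also have "\<dots> = (norm T * norm x)\<^sup>2"
      by (simp add: infsum_cmult_right' norm_row power_mult_distrib)
    finally show ?thesis by (simp add: power2_le_iff_abs_le)
  qed
  have "f (x + y) = f x + f y" "f (c *\<^sub>C x) = c *\<^sub>C f x" for x y c
    by (auto intro!: ell2_eqI simp: cf radd rscale blinfun.add_right app_scaleC_right
        plus_ell2.rep_eq scaleC_ell2.rep_eq split: prod.split)
  with nf obtain R where R: "\<And>x. app R x = f x" using ex_bop[of f "norm T"] by auto
  have nR: "norm R \<le> norm T" by (rule norm_bop_le) (simp_all add: R nf)
  have "row (tensor_vec x y) i = coord x i *\<^sub>C y" for i and x :: "'a ell2" and y :: "'b ell2"
    by (rule ell2_eqI) (simp add: coord_row tensor_vec.rep_eq scaleC_ell2.rep_eq)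
  then have "app R (tensor_vec x y) = tensor_vec x (app T y)" for x y
    by (auto intro!: ell2_eqI simp: R cf app_scaleC_right scaleC_ell2.rep_eq tensor_vec.rep_eq
        split: prod.split)
  with nR show ?thesis by blast
qed

text \<open>The previous construction conjugated by the flip of the two factors.\<close>

lemma ex_tensor_one_right:
  fixes S :: "'a bop"
  shows "\<exists>R :: ('a \<times> 'b) bop. norm R \<le> norm S \<and> (\<forall>x y. app R (tensor_vec x y) = tensor_vec (app S x) y)"
proof -
  obtain R' :: "('b \<times> 'a) bop" where R': "\<And>x y. app R' (tensor_vec x y) = tensor_vec x (app S y)"
    and nR': "norm R' \<le> norm S"
    using ex_tensor_one_left by blast
  let ?sw = "\<lambda>x. reindex_vec prod.swap x"
  have sw: "reindex_vec prod.swap (tensor_vec x y) = tensor_vec y x" for x :: "'c ell2" and y :: "'d ell2"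
    by (rule ell2_eqI) (auto simp: coord_reindex_vec tensor_vec.rep_eq split: prod.split)
  have nf: "norm (?sw (app R' (?sw x))) \<le> norm S * norm x" for x
    using order_trans[OF norm_app_le[of R' "?sw x"] mult_right_mono[OF nR']]
    by (simp add: norm_reindex_vec)
  have "\<exists>R. \<forall>x. app R x = ?sw (app R' (?sw x))"
    by (rule ex_bop[OF _ _ nf]) (simp_all add: reindex_vec_linear blinfun.add_right app_scaleC_right)
  then obtain R where R: "\<And>x. app R x = ?sw (app R' (?sw x))" by blast
  have nR: "norm R \<le> norm S" by (rule norm_bop_le) (simp_all add: R nf)
  from R have "app R (tensor_vec x y) = tensor_vec (app S x) y" for x y
    by (simp add: sw R')
  with nR show ?thesis by blast
qed

text \<open>\<open>S \<otimes> T\<close> is the product of S \<otimes> 1 and 1 \<otimes> T.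
  Uniqueness in the definite description holds because kets of pairs are elementary tensors.\<close>

lemma app_tensor_vec: "app (S \<otimes> T) (tensor_vec x y) = tensor_vec (app S x) (app T y)"
  and norm_tensor_le: "norm (S \<otimes> T) \<le> norm S * norm T"
proof -
  obtain R1 :: "('a \<times> 'b) bop" where R1: "\<And>x y. app R1 (tensor_vec x y) = tensor_vec x (app T y)"
    and nR1: "norm R1 \<le> norm T"
    using ex_tensor_one_left by blast
  obtain R2 :: "('a \<times> 'b) bop" where R2: "\<And>x y. app R2 (tensor_vec x y) = tensor_vec (app S x) y"
    and nR2: "norm R2 \<le> norm S"
    using ex_tensor_one_right by blast
  have "S \<otimes> T = R2 * R1"
    unfolding tensor_op_def
  proof (rule the_equality)
    show "\<forall>x y. app (R2 * R1) (tensor_vec x y) = tensor_vec (app S x) (app T y)"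
      by (simp add: app_mult R1 R2)
    fix R assume R: "\<forall>x y. app R (tensor_vec x y) = tensor_vec (app S x) (app T y)"
    show "R = R2 * R1"
    proof (rule bop_eq_on_kets)
      fix p show "app R (ket p) = app (R2 * R1) (ket p)"
        by (cases p) (simp add: ket_Pair R R1 R2 app_mult)
    qed
  qed
  then show "app (S \<otimes> T) (tensor_vec x y) = tensor_vec (app S x) (app T y)"
    and "norm (S \<otimes> T) \<le> norm S * norm T"
    using order_trans[OF norm_mult_ineq mult_mono[OF nR2 nR1]] by (simp_all add: app_mult R1 R2)
qed

lemma tensor_eqI:
  assumes "\<And>x y. app R (tensor_vec x y) = app R' (tensor_vec x y)"
  shows "R = R'"
proof (rule bop_eq_on_kets)
  fix p show "app R (ket p) = app R' (ket p)"
    by (cases p) (simp add: ket_Pair assms)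
qed

lemma tensor_mult: "(S \<otimes> T) * (S' \<otimes> T') = (S * S') \<otimes> (T * T')"
  and tensor_one [simp]: "1 \<otimes> 1 = 1"
  and tensor_zero_left [simp]: "0 \<otimes> T = 0"
  and tensor_zero_right [simp]: "S \<otimes> 0 = 0"
  and tensor_add_left: "(S + S') \<otimes> T = S \<otimes> T + S' \<otimes> T"
  and tensor_add_right: "S \<otimes> (T + T') = S \<otimes> T + S \<otimes> T'"
  and tensor_scaleC_left: "(c *\<^sub>C S) \<otimes> T = c *\<^sub>C (S \<otimes> T)"
  and tensor_scaleC_right: "S \<otimes> (c *\<^sub>C T) = c *\<^sub>C (S \<otimes> T)"
proof -
  have [simp]: "tensor_vec 0 x = 0" "tensor_vec y 0 = 0" for x :: "'x ell2" and y :: "'y ell2"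
    by (auto intro!: ell2_eqI simp: tensor_vec.rep_eq zero_ell2.rep_eq split: prod.split)
  show "(S \<otimes> T) * (S' \<otimes> T') = (S * S') \<otimes> (T * T')" "1 \<otimes> 1 = 1" "0 \<otimes> T = 0" "S \<otimes> 0 = 0"
    "(S + S') \<otimes> T = S \<otimes> T + S' \<otimes> T" "S \<otimes> (T + T') = S \<otimes> T + S \<otimes> T'"
    "(c *\<^sub>C S) \<otimes> T = c *\<^sub>C (S \<otimes> T)" "S \<otimes> (c *\<^sub>C T) = c *\<^sub>C (S \<otimes> T)"
    by (rule tensor_eqI; simp add: app_tensor_vec app_mult app_add app_scaleC tensor_vec_add_left
        tensor_vec_add_right tensor_vec_scaleC_left tensor_vec_scaleC_right)+
qed

lemma tensor_diff_left: "(S - S') \<otimes> T = S \<otimes> T - S' \<otimes> T"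
  using tensor_add_left[of "S - S'" S' T] by (simp add: algebra_simps)

lemma tensor_diff_right: "S \<otimes> (T - T') = S \<otimes> T - S \<otimes> T'"
  using tensor_add_right[of S "T - T'" T'] by (simp add: algebra_simps)

lemma tensor_sum_left: "sum f F \<otimes> T = (\<Sum>i\<in>F. f i \<otimes> T)"
  by (induction F rule: infinite_finite_induct) (auto simp: tensor_add_left)

lemma tensor_sum_right: "S \<otimes> sum f F = (\<Sum>i\<in>F. S \<otimes> f i)"
  by (induction F rule: infinite_finite_induct) (auto simp: tensor_add_right)

lemma cinner_tensor_vec_ket:
  "cinner (tensor_vec (ket i) (ket j)) (tensor_vec x y) = cinner (ket i) x * cinner (ket j) y"
  by (simp add: ket_Pair[symmetric] cinner_ket_left tensor_vec.rep_eq)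

lemma adj_tensor: "(S \<otimes> T)\<^sup>\<dagger> = S\<^sup>\<dagger> \<otimes> T\<^sup>\<dagger>"
proof (rule bop_eq_on_kets)
  fix p :: "'a \<times> 'b"
  show "app ((S \<otimes> T)\<^sup>\<dagger>) (ket p) = app (S\<^sup>\<dagger> \<otimes> T\<^sup>\<dagger>) (ket p)"
  proof (rule ell2_eqI)
    fix q :: "'a \<times> 'b"
    obtain i j k l where pq: "p = (i, j)" "q = (k, l)" by (cases p, cases q)
    have "coord (app ((S \<otimes> T)\<^sup>\<dagger>) (ket p)) q = cinner (app (S \<otimes> T) (ket q)) (ket p)"
      by (simp add: cinner_ket_left[symmetric] cinner_adj_right)
    also have "\<dots> = cnj (cinner (ket p) (app (S \<otimes> T) (ket q)))"
      by (rule cinner_commute)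
    also have "\<dots> = cnj (cinner (ket i) (app S (ket k))) * cnj (cinner (ket j) (app T (ket l)))"
      by (simp add: pq ket_Pair app_tensor_vec cinner_tensor_vec_ket)
    also have "\<dots> = cinner (ket k) (app (S\<^sup>\<dagger>) (ket i)) * cinner (ket l) (app (T\<^sup>\<dagger>) (ket j))"
      by (simp only: cinner_adj_right cinner_commute[symmetric])
    also have "\<dots> = coord (app (S\<^sup>\<dagger> \<otimes> T\<^sup>\<dagger>) (ket p)) q"
      by (simp add: cinner_ket_left[symmetric] pq ket_Pair app_tensor_vec cinner_tensor_vec_ket)
    finally show "coord (app ((S \<otimes> T)\<^sup>\<dagger>) (ket p)) q = coord (app (S\<^sup>\<dagger> \<otimes> T\<^sup>\<dagger>) (ket p)) q" .
  qed
qed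

lemma projection_tensor_one: "projection p \<Longrightarrow> projection (1 \<otimes> p)"
  by (simp add: projection_def tensor_mult adj_tensor)

lemma tensor_nonzero:
  assumes "S \<noteq> 0" "T \<noteq> 0"
  shows "S \<otimes> T \<noteq> 0"
proof
  assume 0: "S \<otimes> T = 0"
  obtain x where x: "app S x \<noteq> 0" using assms(1) bop_eqI[of S 0] by auto
  obtain y where y: "app T y \<noteq> 0" using assms(2) bop_eqI[of T 0] by auto
  have "norm (app (S \<otimes> T) (tensor_vec x y)) = norm (app S x) * norm (app T y)"
    by (simp add: app_tensor_vec norm_tensor_vec)
  with x y show False by (simp add: 0)
qed

lemma bounded_linear_tensor_right: "bounded_linear (\<lambda>T. S \<otimes> T)"
  by (rule bounded_linear_intro[where K = "norm S"])
     (simp_all add: tensor_add_right scaleR_scaleC tensor_scaleC_right order_trans[OF norm_tensor_le])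

section \<open>The associator of triple tensor products\<close>

definition assoc_index :: "'a \<times> 'b \<times> 'c \<Rightarrow> ('a \<times> 'b) \<times> 'c" where
  "assoc_index = (\<lambda>(i, j, k). ((i, j), k))"

lemma bij_assoc_index: "bij assoc_index" and bij_inv_assoc_index: "bij (inv assoc_index)"
proof -
  show "bij assoc_index"
    by (rule bij_betw_byWitness[where f' = "\<lambda>((i, j), k). (i, j, k)"]) (auto simp: assoc_index_def)
  then show "bij (inv assoc_index)" by (rule bij_imp_bij_inv)
qed

lemma assoc_vec_reindex: "assoc_vec x = reindex_vec assoc_index x"
  by (rule ell2_eqI, simp add: coord_reindex_vec[OF bij_assoc_index])
     (simp add: assoc_vec.rep_eq assoc_index_def split: prod.split)

lemma assoc_vec_add: "assoc_vec (x + y) = assoc_vec x + assoc_vec y"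
  and assoc_vec_scaleC: "assoc_vec (c *\<^sub>C x) = c *\<^sub>C assoc_vec x"
  by (simp_all add: assoc_vec_reindex reindex_vec_linear bij_assoc_index)

lemma assoc_vec_tensor: "assoc_vec (tensor_vec (tensor_vec x y) z) = tensor_vec x (tensor_vec y z)"
  by (rule ell2_eqI) (auto simp: assoc_vec.rep_eq tensor_vec.rep_eq split: prod.split)

text \<open>\<open>assoc_op\<close> is conjugation by the unitary \<open>assoc_vec\<close>: the
  inverse re-bracketing supplies the witness, and its uniqueness holds because
  \<open>assoc_vec\<close> is onto.\<close>

lemma app_assoc_op: "app (assoc_op R) (assoc_vec x) = assoc_vec (app R x)"
  and norm_assoc_op_le: "norm (assoc_op R) \<le> norm R"
proof -
  let ?f = "\<lambda>x. assoc_vec (app R (reindex_vec (inv assoc_index) x))"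
  have nf: "norm (?f x) \<le> norm R * norm x" for x
    using norm_app_le[of R "reindex_vec (inv assoc_index) x"]
    by (simp add: assoc_vec_reindex norm_reindex_vec bij_assoc_index bij_inv_assoc_index)
  have "\<exists>R'. \<forall>x. app R' x = ?f x"
    by (rule ex_bop[OF _ _ nf])
       (simp_all add: assoc_vec_reindex reindex_vec_linear bij_assoc_index bij_inv_assoc_index
          blinfun.add_right app_scaleC_right)
  then obtain R' where R': "\<And>x. app R' x = ?f x" by blast
  have inv1: "reindex_vec (inv assoc_index) (assoc_vec x) = x" for x :: "(('a \<times> 'b) \<times> 'c) ell2"
    by (rule ell2_eqI) (simp add: assoc_vec_reindex coord_reindex_vec bij_assoc_index
        bij_inv_assoc_index surj_f_inv_f bij_is_surj)
  have inv2: "assoc_vec (reindex_vec (inv assoc_index) x) = x" for x :: "('a \<times> 'b \<times> 'c) ell2"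
    by (rule ell2_eqI) (simp add: assoc_vec_reindex coord_reindex_vec bij_assoc_index
        bij_inv_assoc_index inv_f_f bij_is_inj)
  have "assoc_op R = R'"
    unfolding assoc_op_def
  proof (rule the_equality)
    show "\<forall>x. app R' (assoc_vec x) = assoc_vec (app R x)" by (simp add: R' inv1)
    fix R'' assume "\<forall>x. app R'' (assoc_vec x) = assoc_vec (app R x)"
    then show "R'' = R'" by (intro bop_eqI) (metis R' inv2)
  qed
  then show "app (assoc_op R) (assoc_vec x) = assoc_vec (app R x)" "norm (assoc_op R) \<le> norm R"
    by (simp_all add: R' inv1 norm_bop_le nf)
qed

lemma assoc_op_eqI:
  assumes "\<And>x. app R' (assoc_vec x) = assoc_vec (app R x)"
  shows "assoc_op R = R'"
proof (rule bop_eqI)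
  fix y :: "('a \<times> 'b \<times> 'c) ell2"
  have "assoc_vec (reindex_vec (inv assoc_index) y) = y"
    by (rule ell2_eqI) (simp add: assoc_vec_reindex coord_reindex_vec bij_assoc_index
        bij_inv_assoc_index inv_f_f bij_is_inj)
  then show "app (assoc_op R) y = app R' y"
    by (metis app_assoc_op assms)
qed

lemma bounded_linear_assoc_op: "bounded_linear assoc_op"
  by (rule bounded_linear_intro[where K = 1])
     (auto intro!: assoc_op_eqI simp: app_add app_assoc_op norm_assoc_op_le scaleR_scaleC app_scaleC
        assoc_vec_add assoc_vec_scaleC)

lemma assoc_op_scaleC: "assoc_op (c *\<^sub>C R) = c *\<^sub>C assoc_op R"
  by (rule assoc_op_eqI)
     (simp add: app_scaleC app_assoc_op assoc_vec_scaleC)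

lemma assoc_op_tensor: "assoc_op ((R \<otimes> S) \<otimes> T) = R \<otimes> (S \<otimes> T)"
proof (rule bop_eq_on_kets)
  fix p :: "'a \<times> 'b \<times> 'c"
  obtain i j k where p: "p = (i, j, k)" by (cases p)
  have k: "ket p = assoc_vec (tensor_vec (tensor_vec (ket i) (ket j)) (ket k))"
    by (simp add: p assoc_vec_tensor ket_Pair)
  have "app (assoc_op ((R \<otimes> S) \<otimes> T)) (ket p)
      = assoc_vec (app ((R \<otimes> S) \<otimes> T) (tensor_vec (tensor_vec (ket i) (ket j)) (ket k)))"
    unfolding k by (rule app_assoc_op)
  then show "app (assoc_op ((R \<otimes> S) \<otimes> T)) (ket p) = app (R \<otimes> (S \<otimes> T)) (ket p)"
    by (simp add: app_tensor_vec assoc_vec_tensor p ket_Pair)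
qed

section \<open>Closed subspaces and minimal tensor products\<close>

lemma closure_seqD: "x \<in> closure V \<Longrightarrow> \<exists>X. (\<forall>n. X n \<in> V) \<and> X \<longlonglongrightarrow> x" for x :: "'a::metric_space"
  unfolding closure_sequential .

lemma closure_seqI: "(\<And>n. X n \<in> V) \<Longrightarrow> X \<longlonglongrightarrow> x \<Longrightarrow> x \<in> closure V" for x :: "'a::metric_space"
  unfolding closure_sequential by blast

lemma subspace_closure:
  fixes V :: "'a bop set"
  assumes "complex_vector.subspace V"
  shows "complex_vector.subspace (closure V)"
  unfolding complex_vector.subspace_def
proof (intro conjI ballI allI)
  show "0 \<in> closure V"
    by (rule subsetD[OF closure_subset complex_vector.subspace_0[OF assms]])
next
  fix x y assume xy: "x \<in> closure V" "y \<in> closure V"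
  obtain X where X: "\<forall>n. X n \<in> V" "X \<longlonglongrightarrow> x" using closure_seqD[OF xy(1)] by blast
  obtain Y where Y: "\<forall>n. Y n \<in> V" "Y \<longlonglongrightarrow> y" using closure_seqD[OF xy(2)] by blast
  show "x + y \<in> closure V"
    by (rule closure_seqI[OF _ tendsto_add[OF X(2) Y(2)]])
       (simp add: complex_vector.subspace_add[OF assms] X Y)
next
  fix c x assume "x \<in> closure V"
  then obtain X where X: "\<forall>n. X n \<in> V" "X \<longlonglongrightarrow> x" using closure_seqD by blast
  show "c *\<^sub>C x \<in> closure V"
    by (rule closure_seqI[OF _ bounded_linear.tendsto[OF bounded_linear_scaleC_bop X(2)]])
       (simp add: complex_vector.subspace_scale[OF assms] X)
qed

lemma closure_span_mono:
  fixes V :: "'a bop set"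
  assumes "X \<subseteq> V" "complex_vector.subspace V" "closed V"
  shows "closure (cspan X) \<subseteq> V"
  by (rule closure_minimal[OF complex_vector.span_minimal[OF assms(1,2)] assms(3)])

lemma closure_span_base: "x \<in> X \<Longrightarrow> x \<in> closure (cspan X)" for x :: "'a bop"
  by (rule subsetD[OF closure_subset complex_vector.span_base])

lemma subspace_closure_span: "complex_vector.subspace (closure (cspan X))" for X :: "'a bop set"
  by (rule subspace_closure[OF complex_vector.subspace_span])

lemma span_mult_closed:
  fixes X :: "'a bop set"
  assumes "\<And>x y. x \<in> X \<Longrightarrow> y \<in> X \<Longrightarrow> x * y \<in> cspan X" "x \<in> cspan X" "y \<in> cspan X"
  shows "x * y \<in> cspan X"
  using assms(2)
proof (induction rule: complex_vector.span_induct_alt)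
  case base
  show ?case by (simp add: complex_vector.span_zero)
next
  case (step c a z)
  have "a * y \<in> cspan X" using assms(3)
  proof (induction rule: complex_vector.span_induct_alt)
    case base
    show ?case by (simp add: complex_vector.span_zero)
  next
    case (step d b w)
    with \<open>a \<in> X\<close> show ?case
      by (simp add: distrib_left scaleC_mult_right complex_vector.span_add complex_vector.span_scale assms(1))
  qed
  with step show ?case
    by (simp add: distrib_right scaleC_mult_left complex_vector.span_add complex_vector.span_scale)
qed

lemma span_adj_closed:
  fixes X :: "'a bop set"
  assumes "\<And>x. x \<in> X \<Longrightarrow> x\<^sup>\<dagger> \<in> cspan X" "x \<in> cspan X"
  shows "x\<^sup>\<dagger> \<in> cspan X"
  using assms(2)
proof (induction rule: complex_vector.span_induct_alt)
  case base
  show ?case by (simp add: complex_vector.span_zero)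
next
  case (step c a z)
  then show ?case
    by (simp add: adj_add adj_scaleC complex_vector.span_add complex_vector.span_scale assms(1))
qed

lemma unital_cstar_closure_span:
  fixes X :: "'a bop set"
  assumes one: "1 \<in> cspan X"
    and mult: "\<And>x y. x \<in> X \<Longrightarrow> y \<in> X \<Longrightarrow> x * y \<in> cspan X"
    and adj: "\<And>x. x \<in> X \<Longrightarrow> x\<^sup>\<dagger> \<in> cspan X"
  shows "unital_cstar_algebra (closure (cspan X))"
  unfolding unital_cstar_algebra_def
proof (intro conjI ballI allI)
  show "1 \<in> closure (cspan X)" by (rule subsetD[OF closure_subset one])
next
  fix a b assume "a \<in> closure (cspan X)" "b \<in> closure (cspan X)"
  then show "a + b \<in> closure (cspan X)"
    by (rule complex_vector.subspace_add[OF subspace_closure_span])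
next
  fix a b assume ab: "a \<in> closure (cspan X)" "b \<in> closure (cspan X)"
  obtain P where P: "\<forall>n. P n \<in> cspan X" "P \<longlonglongrightarrow> a" using closure_seqD[OF ab(1)] by blast
  obtain Q where Q: "\<forall>n. Q n \<in> cspan X" "Q \<longlonglongrightarrow> b" using closure_seqD[OF ab(2)] by blast
  show "a * b \<in> closure (cspan X)"
    by (rule closure_seqI[OF _ tendsto_mult[OF P(2) Q(2)]])
       (rule span_mult_closed[OF mult P(1)[rule_format] Q(1)[rule_format]])
next
  fix c a assume "a \<in> closure (cspan X)"
  then show "c *\<^sub>C a \<in> closure (cspan X)"
    by (rule complex_vector.subspace_scale[OF subspace_closure_span])
next
  fix a assume "a \<in> closure (cspan X)"
  then obtain P where P: "\<forall>n. P n \<in> cspan X" "P \<longlonglongrightarrow> a" using closure_seqD by blast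
  show "a\<^sup>\<dagger> \<in> closure (cspan X)"
    by (rule closure_seqI[OF _ bounded_linear.tendsto[OF bounded_linear_adj P(2)]])
       (rule span_adj_closed[OF adj P(1)[rule_format]])
qed simp

lemma tensor_in_min_tensor: "b \<in> B \<Longrightarrow> d \<in> D \<Longrightarrow> b \<otimes> d \<in> B \<otimes>\<^sub>m D"
  unfolding min_tensor_def by (rule closure_span_base) blast

lemma unital_cstar_min_tensor:
  assumes B: "unital_cstar_algebra B" and D: "unital_cstar_algebra D"
  shows "unital_cstar_algebra (B \<otimes>\<^sub>m D)"
  unfolding min_tensor_def
proof (rule unital_cstar_closure_span)
  let ?X = "{b \<otimes> d |b d. b \<in> B \<and> d \<in> D}"
  have "1 \<otimes> 1 \<in> ?X" using cstar_one[OF B] cstar_one[OF D] by blast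
  then show "1 \<in> cspan ?X" by (simp add: complex_vector.span_base)
  show "x * y \<in> cspan ?X" if "x \<in> ?X" "y \<in> ?X" for x y
  proof (rule complex_vector.span_base)
    show "x * y \<in> ?X" using that by (auto simp: tensor_mult) (metis B D cstar_mult)
  qed
  show "x\<^sup>\<dagger> \<in> cspan ?X" if "x \<in> ?X" for x
  proof (rule complex_vector.span_base)
    show "x\<^sup>\<dagger> \<in> ?X" using that by (auto simp: adj_tensor) (metis B D cstar_adj)
  qed
qed

text \<open>The elements of \<open>B\<close> that \<open>h\<close> sends into \<open>V\<close> form
  a subspace stable under limits, so generators decide.\<close>

lemma star_hom_closure_span_subset:
  assumes B: "unital_cstar_algebra B" and h: "unital_star_hom B D h"
    and X: "X \<subseteq> B" "h ` X \<subseteq> V" and V: "complex_vector.subspace V" "closed V"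
  shows "h ` closure (cspan X) \<subseteq> V"
proof -
  have "cspan X \<subseteq> {x \<in> B. h x \<in> V}"
  proof (rule complex_vector.span_minimal)
    show "complex_vector.subspace {x \<in> B. h x \<in> V}"
    proof (rule complex_vector.subspaceI)
      show "0 \<in> {x \<in> B. h x \<in> V}"
        using complex_vector.subspace_0[OF V(1)] cstar_zero[OF B] by (simp add: star_hom_zero[OF h B])
      show "x + y \<in> {x \<in> B. h x \<in> V}" if "x \<in> {x \<in> B. h x \<in> V}" "y \<in> {x \<in> B. h x \<in> V}" for x y
        using that complex_vector.subspace_add[OF V(1)] cstar_add[OF B] by (simp add: star_hom_add[OF h])
      show "c *\<^sub>C x \<in> {x \<in> B. h x \<in> V}" if "x \<in> {x \<in> B. h x \<in> V}" for c x
        using that complex_vector.subspace_scale[OF V(1)] cstar_scaleC[OF B] by (simp add: star_hom_scaleC[OF h])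
    qed
  qed (use X in auto)
  then have s: "\<And>x. x \<in> cspan X \<Longrightarrow> x \<in> B \<and> h x \<in> V" by blast
  show ?thesis
  proof (rule image_subsetI)
    fix x assume "x \<in> closure (cspan X)"
    then obtain P where P: "\<forall>n. P n \<in> cspan X" "P \<longlonglongrightarrow> x"
      using closure_seqD by blast
    have "(\<lambda>n. h (P n)) \<longlonglongrightarrow> h x"
      by (rule star_hom_tendsto[OF B h _ P(2)]) (simp add: P(1) s)
    then show "h x \<in> V"
      by (rule closed_sequentially[OF V(2), rotated]) (simp add: P(1) s)
  qed
qed

section \<open>Cylinder projections\<close>

abbreviation words :: "nat \<Rightarrow> 'n list set" where
  "words n \<equiv> {w. length w = n}"

lemma finite_words: "finite (words n :: 'n::finite list set)"
  using finite_lists_length_eq[of "UNIV :: 'n set" n] by simp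

lemma words_0: "words 0 = {[]}"
  by auto

lemma sum_words_Suc_snoc: "(\<Sum>w\<in>words (Suc n). f w) = (\<Sum>w\<in>words n. \<Sum>a\<in>UNIV. f (w @ [a]))"
  for f :: "'n::finite list \<Rightarrow> 'b::comm_monoid_add"
proof -
  have "(\<Sum>w\<in>words n. \<Sum>a\<in>UNIV. f (w @ [a])) = (\<Sum>(w, a)\<in>words n \<times> UNIV. f (w @ [a]))"
    by (rule sum.cartesian_product)
  also have "\<dots> = (\<Sum>w\<in>words (Suc n). f w)"
    by (rule sum.reindex_bij_witness[where i = "\<lambda>w. (butlast w, last w)" and j = "\<lambda>(w, a). w @ [a]"])
       (auto intro!: append_butlast_last_id)
  finally show ?thesis ..
qed

lemma sum_words_Suc_Cons: "(\<Sum>w\<in>words (Suc n). f w) = (\<Sum>a\<in>UNIV. \<Sum>w\<in>words n. f (a # w))"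
  for f :: "'n::finite list \<Rightarrow> 'b::comm_monoid_add"
proof -
  have "(\<Sum>a\<in>UNIV. \<Sum>w\<in>words n. f (a # w)) = (\<Sum>(a, w)\<in>UNIV \<times> words n. f (a # w))"
    by (rule sum.cartesian_product)
  also have "\<dots> = (\<Sum>w\<in>words (Suc n). f w)"
    by (rule sum.reindex_bij_witness[where i = "\<lambda>w. (hd w, tl w)" and j = "\<lambda>(a, w). a # w"])
       (auto simp: length_Suc_conv)
  finally show ?thesis ..
qed

text \<open>A tree of projections: those of a fixed length form a partition of unity, refined by the
  next length. Nonvanishing is kept for a second locale, because these axioms are also applied to
  the image of such a family under a homomorphism, where projections may become 0.\<close>

locale cylinders =
  fixes E :: "'n::finite list \<Rightarrow> 'b bop"
  assumes proj: "projection (E w)"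
    and E_Nil: "E [] = 1"
    and E_split: "(\<Sum>a\<in>UNIV. E (w @ [a])) = E w"
begin

lemma sum_words: "(\<Sum>w\<in>words n. E w) = 1"
  by (induction n) (simp_all add: words_0 E_Nil sum_words_Suc_snoc E_split)

lemma orthogonal: "length v = length w \<Longrightarrow> v \<noteq> w \<Longrightarrow> E v * E w = 0"
  by (rule projections_orthogonal[OF finite_words[of "length w"] proj sum_words]) auto

text \<open>Every \<open>E w\<close> splits into its one-letter extensions, which inherit the
  coefficient of their prefix. The abstract \<open>G\<close> covers scalar and operator coefficients
  alike.\<close>

lemma refine:
  assumes "\<And>v w. (\<Sum>a\<in>UNIV. G v (E (w @ [a]))) = G v (E w)" "n \<le> m"
  shows "(\<Sum>w\<in>words n. G w (E w)) = (\<Sum>w\<in>words m. G (take n w) (E w))"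
  using assms(2)
proof (induction m rule: dec_induct)
  case (step m)
  have "(\<Sum>w\<in>words (Suc m). G (take n w) (E w)) = (\<Sum>w\<in>words m. \<Sum>a\<in>UNIV. G (take n w) (E (w @ [a])))"
    unfolding sum_words_Suc_snoc using step(1) by (intro sum.cong refl) simp
  with step show ?case by (simp add: assms(1))
qed simp

lemma refine_tensor:
  "n \<le> m \<Longrightarrow> (\<Sum>w\<in>words n. c w \<otimes> E w) = (\<Sum>w\<in>words m. c (take n w) \<otimes> E w)"
  by (rule refine[where G = "\<lambda>w x. c w \<otimes> x"]) (simp_all add: tensor_sum_right[symmetric] E_split)

lemma refine_scaleC:
  "n \<le> m \<Longrightarrow> (\<Sum>w\<in>words n. c w *\<^sub>C E w) = (\<Sum>w\<in>words m. c (take n w) *\<^sub>C E w)"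
  by (rule refine[where G = "\<lambda>w x. c w *\<^sub>C x"]) (simp_all add: complex_vector.scale_sum_right[symmetric] E_split)

lemma sum_mult_sum:
  fixes G G' :: "'n list \<Rightarrow> 'b bop \<Rightarrow> 'c::semiring_0"
  assumes "\<And>v w. v \<in> words n \<Longrightarrow> w \<in> words n \<Longrightarrow> G v (E v) * G' w (E w) = (if v = w then H w else 0)"
  shows "(\<Sum>v\<in>words n. G v (E v)) * (\<Sum>w\<in>words n. G' w (E w)) = (\<Sum>w\<in>words n. H w)"
proof -
  have "(\<Sum>v\<in>words n. G v (E v)) * (\<Sum>w\<in>words n. G' w (E w))
      = (\<Sum>v\<in>words n. \<Sum>w\<in>words n. if v = w then H w else 0)"
    unfolding sum_product by (intro sum.cong refl) (simp add: assms)
  also have "\<dots> = (\<Sum>w\<in>words n. H w)"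
    by (intro sum.cong refl) (simp add: finite_words)
  finally show ?thesis .
qed

lemma tensor_sum_mult:
  "(\<Sum>w\<in>words n. c w \<otimes> E w) * (\<Sum>w\<in>words n. d w \<otimes> E w) = (\<Sum>w\<in>words n. (c w * d w) \<otimes> E w)"
  by (rule sum_mult_sum[where G = "\<lambda>w x. c w \<otimes> x" and G' = "\<lambda>w x. d w \<otimes> x"])
     (auto simp: tensor_mult orthogonal projectionD proj)

lemma scaleC_sum_mult:
  "(\<Sum>w\<in>words n. c w *\<^sub>C E w) * (\<Sum>w\<in>words n. d w *\<^sub>C E w) = (\<Sum>w\<in>words n. (c w * d w) *\<^sub>C E w)"
  by (rule sum_mult_sum[where G = "\<lambda>w x. c w *\<^sub>C x" and G' = "\<lambda>w x. d w *\<^sub>C x"])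
     (auto simp: scaleC_mult_left scaleC_mult_right scaleC_scaleC orthogonal projectionD proj)

lemma norm_tensor_sum_le:
  assumes "\<And>w. w \<in> words n \<Longrightarrow> norm (c w) \<le> M" "0 \<le> M"
  shows "norm (\<Sum>w\<in>words n. c w \<otimes> E w) \<le> M"
proof -
  have "norm (\<Sum>w\<in>words n. (c w \<otimes> 1) * (1 \<otimes> E w)) \<le> M"
  proof (rule norm_sum_projections_le[OF finite_words])
    show "(\<Sum>w\<in>words n. 1 \<otimes> E w) = 1"
      by (simp add: tensor_sum_right[symmetric] sum_words)
    show "norm (c w \<otimes> (1 :: 'b bop)) \<le> M" if "w \<in> words n" for w
      using norm_tensor_le[of "c w" "1 :: 'b bop"] assms(1)[OF that] by simp
  qed (auto simp: tensor_mult projection_tensor_one proj assms(2))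
  then show ?thesis by (simp add: tensor_mult)
qed

lemma norm_scaleC_sum_le:
  assumes "\<And>w. w \<in> words n \<Longrightarrow> cmod (c w) \<le> M" "0 \<le> M"
  shows "norm (\<Sum>w\<in>words n. c w *\<^sub>C E w) \<le> M"
proof -
  have "norm (\<Sum>w\<in>words n. (c w *\<^sub>C 1) * E w) \<le> M"
    by (rule norm_sum_projections_le[OF finite_words])
       (auto simp: scaleC_mult_left scaleC_mult_right norm_scaleC_bop proj sum_words assms)
  then show ?thesis by (simp add: scaleC_mult_left)
qed

section \<open>The algebra spanned by the cylinder projections\<close>

definition algebra :: "'b bop set" where
  "algebra = closure (cspan (range E))"

lemma E_in_algebra: "E w \<in> algebra"
  unfolding algebra_def by (rule closure_span_base) simp

text \<open>Normal form: cylinder projections of different lengths are rewritten at one common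
  length, where products and norms are computed coefficient by coefficient.\<close>

lemma span_levelD:
  assumes "x \<in> cspan (range E)"
  shows "\<exists>n c. x = (\<Sum>w\<in>words n. c w *\<^sub>C E w)"
  using assms
proof (induction rule: complex_vector.span_induct_alt)
  case base
  show ?case by (rule exI[of _ 0], rule exI[of _ "\<lambda>_. 0"]) simp
next
  case (step s x y)
  obtain v where v: "x = E v" using step(1) by blast
  obtain n c where y: "y = (\<Sum>w\<in>words n. c w *\<^sub>C E w)" using step(2) by blast
  define m where "m = max (length v) n"
  have y': "y = (\<Sum>w\<in>words m. c (take n w) *\<^sub>C E w)"
    unfolding y by (rule refine_scaleC) (simp add: m_def)
  \<comment> \<open>A single \<open>E v\<close> is the indicator of \<open>v\<close> at its own
    level; refined, it becomes the indicator of the words starting with \<open>v\<close>.\<close>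
  have "x = (\<Sum>w\<in>words (length v). if w = v then E v else 0)"
    by (simp add: v finite_words)
  also have "\<dots> = (\<Sum>w\<in>words (length v). (if w = v then 1 else 0) *\<^sub>C E w)"
    by (intro sum.cong refl) auto
  also have "\<dots> = (\<Sum>w\<in>words m. (if take (length v) w = v then 1 else 0) *\<^sub>C E w)"
    by (rule refine_scaleC) (simp add: m_def)
  finally have x': "x = (\<Sum>w\<in>words m. (if take (length v) w = v then 1 else 0) *\<^sub>C E w)" .
  have "s *\<^sub>C x + y = (\<Sum>w\<in>words m. (s * (if take (length v) w = v then 1 else 0) + c (take n w)) *\<^sub>C E w)"
    by (simp add: x' y' complex_vector.scale_sum_right sum.distrib scaleC_add_left scaleC_scaleC)
  then show ?case by (intro exI[of _ m] exI)
qed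

lemma sum_in_span: "(\<Sum>w\<in>words n. c w *\<^sub>C E w) \<in> cspan (range E)"
  by (intro complex_vector.span_sum complex_vector.span_scale complex_vector.span_base) simp

lemma unital_cstar_algebra: "unital_cstar_algebra algebra"
  unfolding algebra_def
proof (rule unital_cstar_closure_span)
  show "1 \<in> cspan (range E)"
    unfolding E_Nil[symmetric] by (intro complex_vector.span_base) simp
  show "x\<^sup>\<dagger> \<in> cspan (range E)" if "x \<in> range E" for x
    using that by (auto simp: projectionD proj intro!: complex_vector.span_base)
  fix x y assume xy: "x \<in> range E" "y \<in> range E"
  obtain n c where x: "x = (\<Sum>w\<in>words n. c w *\<^sub>C E w)"
    using span_levelD[OF complex_vector.span_base[OF xy(1)]] by blast
  obtain m d where y: "y = (\<Sum>w\<in>words m. d w *\<^sub>C E w)"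
    using span_levelD[OF complex_vector.span_base[OF xy(2)]] by blast
  have "x = (\<Sum>w\<in>words (max n m). c (take n w) *\<^sub>C E w)" "y = (\<Sum>w\<in>words (max n m). d (take m w) *\<^sub>C E w)"
    unfolding x y by (simp_all add: refine_scaleC)
  then show "x * y \<in> cspan (range E)" by (simp add: scaleC_sum_mult sum_in_span)
qed

lemma star_hom_image:
  assumes "unital_star_hom algebra D g"
  shows "cylinders (\<lambda>w. g (E w))"
proof
  fix w
  show "projection (g (E w))"
    using star_hom_mult[OF assms E_in_algebra E_in_algebra, of w w] star_hom_adj[OF assms E_in_algebra, of w]
    by (simp add: projection_def projectionD[OF proj])
  show "g (E []) = 1" by (simp add: E_Nil star_hom_one[OF assms])
  show "(\<Sum>a\<in>UNIV. g (E (w @ [a]))) = g (E w)"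
    by (subst star_hom_sum[OF assms unital_cstar_algebra, symmetric]) (simp_all add: E_in_algebra E_split)
qed

end

locale nonzero_cylinders = cylinders +
  assumes nonzero: "E w \<noteq> 0"
begin

text \<open>On an elementary tensor whose second factor is a nonzero vector in the range of
  \<open>E w\<close>, orthogonality kills every summand but the one with \<open>c w\<close>. This is
  where \<open>E w\<close> must not be 0.\<close>

lemma norm_tensor_sum_ge:
  assumes "w \<in> words n"
  shows "norm (c w) \<le> norm (\<Sum>w\<in>words n. c w \<otimes> E w)"
proof (rule norm_bop_le)
  fix x
  obtain y where y: "app (E w) y \<noteq> 0"
    using nonzero[of w] bop_eqI[of "E w" 0] by auto
  let ?X = "\<Sum>w\<in>words n. c w \<otimes> E w"
  have *: "app (E v) (app (E w) y) = (if v = w then app (E w) y else 0)" if "v \<in> words n" for v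
    using orthogonal[of v w] projectionD(1)[OF proj, of w] that assms
    by (auto simp: app_mult[symmetric])
  have "app ?X (tensor_vec x (app (E w) y))
      = (\<Sum>v\<in>words n. if v = w then tensor_vec (app (c w) x) (app (E w) y) else 0)"
    unfolding app_sum by (intro sum.cong refl)
      (auto simp: app_tensor_vec * intro!: ell2_eqI simp: tensor_vec.rep_eq zero_ell2.rep_eq split: prod.split)
  also have "\<dots> = tensor_vec (app (c w) x) (app (E w) y)"
    using assms by (simp add: finite_words)
  finally have "norm (app (c w) x) * norm (app (E w) y) \<le> norm ?X * (norm x * norm (app (E w) y))"
    using norm_app_le[of ?X "tensor_vec x (app (E w) y)"] by (simp add: norm_tensor_vec)
  then have "norm (app (c w) x) * norm (app (E w) y) \<le> (norm ?X * norm x) * norm (app (E w) y)"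
    by (simp add: mult.assoc)
  then show "norm (app (c w) x) \<le> norm ?X * norm x"
    by (rule mult_right_le_imp_le) (use y in simp)
qed simp

text \<open>The homomorphism \<open>f \<otimes> g\<close> is the function whose graph is the closure of the graph \<open>G\<close> of the
  algebraic tensor product on the locally constant functions, where the norm of
  \<open>\<Sum>\<^sub>w c\<^sub>w \<otimes> E\<^sub>w\<close> is the maximum of the norms of the \<open>c\<^sub>w\<close>.\<close>

lemma ex_tensor_hom:
  assumes C: "unital_cstar_algebra C" and f: "unital_star_hom C C' f"
    and g: "unital_star_hom algebra D' g"
  shows "\<exists>h. unital_star_hom (C \<otimes>\<^sub>m algebra) (C' \<otimes>\<^sub>m D') h \<and>
    (\<forall>c\<in>C. \<forall>d\<in>algebra. h (c \<otimes> d) = f c \<otimes> g d)"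
proof -
  interpret g: cylinders "\<lambda>w. g (E w)" by (rule star_hom_image[OF g])
  define G where "G = {(\<Sum>w\<in>words n. c w \<otimes> E w, \<Sum>w\<in>words n. f (c w) \<otimes> g (E w)) |n c. \<forall>w. c w \<in> C}"
  have GI: "(\<Sum>w\<in>words n. c w \<otimes> E w, \<Sum>w\<in>words n. f (c w) \<otimes> g (E w)) \<in> G" if "\<And>w. c w \<in> C" for n c
    using that unfolding G_def by blast
  \<comment> \<open>Two members of \<open>G\<close> are brought to a common level, so that sums and
    products act on the coefficients.\<close>
  have GE: "\<exists>n c c'. (\<forall>w. c w \<in> C \<and> c' w \<in> C) \<and>
      x = (\<Sum>w\<in>words n. c w \<otimes> E w) \<and> y = (\<Sum>w\<in>words n. f (c w) \<otimes> g (E w)) \<and>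
      x' = (\<Sum>w\<in>words n. c' w \<otimes> E w) \<and> y' = (\<Sum>w\<in>words n. f (c' w) \<otimes> g (E w))"
    if xy: "(x, y) \<in> G" "(x', y') \<in> G" for x y x' y'
  proof -
    obtain n c where 1: "\<forall>w. c w \<in> C" "x = (\<Sum>w\<in>words n. c w \<otimes> E w)"
      "y = (\<Sum>w\<in>words n. f (c w) \<otimes> g (E w))"
      using xy(1) unfolding G_def by blast
    obtain m c' where 2: "\<forall>w. c' w \<in> C" "x' = (\<Sum>w\<in>words m. c' w \<otimes> E w)"
      "y' = (\<Sum>w\<in>words m. f (c' w) \<otimes> g (E w))"
      using xy(2) unfolding G_def by blast
    let ?k = "max n m"
    show ?thesis
    proof (intro exI conjI)
      show "\<forall>w. c (take n w) \<in> C \<and> c' (take m w) \<in> C" using 1(1) 2(1) by blast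
      show "x = (\<Sum>w\<in>words ?k. c (take n w) \<otimes> E w)" "x' = (\<Sum>w\<in>words ?k. c' (take m w) \<otimes> E w)"
        unfolding 1(2) 2(2) by (intro refine_tensor; simp)+
      show "y = (\<Sum>w\<in>words ?k. f (c (take n w)) \<otimes> g (E w))"
        "y' = (\<Sum>w\<in>words ?k. f (c' (take m w)) \<otimes> g (E w))"
        unfolding 1(3) 2(3)
        using g.refine_tensor[of n ?k "\<lambda>w. f (c w)"] g.refine_tensor[of m ?k "\<lambda>w. f (c' w)"] by simp_all
    qed
  qed
  have G_add: "(x + x', y + y') \<in> G" and G_diff: "(x - x', y - y') \<in> G"
    and G_mult: "(x * x', y * y') \<in> G" if xy: "(x, y) \<in> G" "(x', y') \<in> G" for x y x' y'
  proof -
    obtain n c c' where "\<forall>w. c w \<in> C \<and> c' w \<in> C" and e: "x = (\<Sum>w\<in>words n. c w \<otimes> E w)"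
      "y = (\<Sum>w\<in>words n. f (c w) \<otimes> g (E w))" "x' = (\<Sum>w\<in>words n. c' w \<otimes> E w)"
      "y' = (\<Sum>w\<in>words n. f (c' w) \<otimes> g (E w))"
      using GE[OF xy] by blast
    then have c: "\<And>w. c w \<in> C" "\<And>w. c' w \<in> C" by auto
    show "(x + x', y + y') \<in> G"
      using GI[of "\<lambda>w. c w + c' w" n] c C
      by (simp add: e cstar_add tensor_add_left sum.distrib star_hom_add[OF f])
    show "(x - x', y - y') \<in> G"
      using GI[of "\<lambda>w. c w - c' w" n] c C
      by (simp add: e cstar_diff tensor_diff_left sum_subtractf star_hom_diff[OF f])
    show "(x * x', y * y') \<in> G"
      using GI[of "\<lambda>w. c w * c' w" n] c C
      by (simp add: e cstar_mult tensor_sum_mult g.tensor_sum_mult star_hom_mult[OF f])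
  qed
  have G_scale: "(s *\<^sub>C x, s *\<^sub>C y) \<in> G" and G_adj: "(x\<^sup>\<dagger>, y\<^sup>\<dagger>) \<in> G" and G_norm: "norm y \<le> norm x"
    and G_ran: "y \<in> C' \<otimes>\<^sub>m D'"
    if xy: "(x, y) \<in> G" for x y s
  proof -
    obtain n c where "\<forall>w. c w \<in> C" and e: "x = (\<Sum>w\<in>words n. c w \<otimes> E w)"
      "y = (\<Sum>w\<in>words n. f (c w) \<otimes> g (E w))"
      using xy unfolding G_def by blast
    then have c: "\<And>w. c w \<in> C" by blast
    show "(s *\<^sub>C x, s *\<^sub>C y) \<in> G"
      using GI[of "\<lambda>w. s *\<^sub>C c w" n] c C
      by (simp add: e cstar_scaleC tensor_scaleC_left complex_vector.scale_sum_right star_hom_scaleC[OF f])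
    show "(x\<^sup>\<dagger>, y\<^sup>\<dagger>) \<in> G"
      using GI[of "\<lambda>w. (c w)\<^sup>\<dagger>" n] c C
      by (simp add: e cstar_adj adj_tensor adj_sum star_hom_adj[OF f] projectionD proj g.proj)
    \<comment> \<open>The images \<open>g (E w)\<close> may vanish, so \<open>y\<close> is only
      bounded above by its largest coefficient. For \<open>x\<close> the nonvanishing of the
      \<open>E w\<close> bounds each coefficient by the norm, and contractivity of \<open>f\<close>
      connects the two.\<close>
    show "norm y \<le> norm x"
      unfolding e(2)
    proof (rule g.norm_tensor_sum_le)
      fix w assume w: "w \<in> (words n :: 'a list set)"
      have "norm (f (c w)) \<le> norm (c w)" by (rule star_hom_contractive[OF C f c])
      also have "\<dots> \<le> norm x" unfolding e(1) by (rule norm_tensor_sum_ge[OF w])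
      finally show "norm (f (c w)) \<le> norm x" .
    qed simp
    show "y \<in> C' \<otimes>\<^sub>m D'"
      unfolding e(2) min_tensor_def
      by (intro complex_vector.subspace_sum[OF subspace_closure_span] closure_span_base)
         (use star_hom_in[OF f c] star_hom_in[OF g E_in_algebra] in blast)
  qed
  define H where "H = closure G"
  have HE: "\<exists>X Y. (\<forall>n. (X n, Y n) \<in> G) \<and> X \<longlonglongrightarrow> x \<and> Y \<longlonglongrightarrow> y" if xy: "(x, y) \<in> H" for x y
  proof -
    obtain Z where "\<forall>n. Z n \<in> G" "Z \<longlonglongrightarrow> (x, y)"
      using closure_seqD[OF xy[unfolded H_def]] by blast
    then show ?thesis
      using tendsto_fst[of Z "(x, y)"] tendsto_snd[of Z "(x, y)"]
      by (intro exI[of _ "\<lambda>n. fst (Z n)"] exI[of _ "\<lambda>n. snd (Z n)"]) simp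
  qed
  have HI: "(x, y) \<in> H" if "\<And>n. (X n, Y n) \<in> G" "X \<longlonglongrightarrow> x" "Y \<longlonglongrightarrow> y" for X Y x y
    unfolding H_def closure_sequential
    by (rule exI[of _ "\<lambda>n. (X n, Y n)"]) (use that in \<open>auto intro: tendsto_Pair\<close>)
  have H_add: "(x + x', y + y') \<in> H" and H_diff: "(x - x', y - y') \<in> H"
    and H_mult: "(x * x', y * y') \<in> H" if xy: "(x, y) \<in> H" "(x', y') \<in> H" for x y x' y'
  proof -
    obtain X Y where "\<forall>n. (X n, Y n) \<in> G" and XY: "X \<longlonglongrightarrow> x" "Y \<longlonglongrightarrow> y"
      using HE[OF xy(1)] by blast
    moreover obtain X' Y' where "\<forall>n. (X' n, Y' n) \<in> G" and XY': "X' \<longlonglongrightarrow> x'" "Y' \<longlonglongrightarrow> y'"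
      using HE[OF xy(2)] by blast
    ultimately have G: "\<And>n. (X n, Y n) \<in> G" "\<And>n. (X' n, Y' n) \<in> G" by auto
    show "(x + x', y + y') \<in> H"
      by (rule HI[of "\<lambda>n. X n + X' n" "\<lambda>n. Y n + Y' n"]) (intro G_add G tendsto_add XY XY')+
    show "(x - x', y - y') \<in> H"
      by (rule HI[of "\<lambda>n. X n - X' n" "\<lambda>n. Y n - Y' n"]) (intro G_diff G tendsto_diff XY XY')+
    show "(x * x', y * y') \<in> H"
      by (rule HI[of "\<lambda>n. X n * X' n" "\<lambda>n. Y n * Y' n"]) (intro G_mult G tendsto_mult XY XY')+
  qed
  have H_scale: "(s *\<^sub>C x, s *\<^sub>C y) \<in> H" and H_adj: "(x\<^sup>\<dagger>, y\<^sup>\<dagger>) \<in> H" and H_norm: "norm y \<le> norm x"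
    and H_ran: "y \<in> C' \<otimes>\<^sub>m D'"
    if xy: "(x, y) \<in> H" for x y s
  proof -
    obtain X Y where "\<forall>n. (X n, Y n) \<in> G" "X \<longlonglongrightarrow> x" "Y \<longlonglongrightarrow> y"
      using HE[OF xy] by blast
    then have XY: "\<And>n. (X n, Y n) \<in> G" "X \<longlonglongrightarrow> x" "Y \<longlonglongrightarrow> y" by auto
    show "(s *\<^sub>C x, s *\<^sub>C y) \<in> H"
      by (rule HI[of "\<lambda>n. s *\<^sub>C X n" "\<lambda>n. s *\<^sub>C Y n"]) (intro G_scale bounded_linear.tendsto[OF bounded_linear_scaleC_bop] XY)+
    show "(x\<^sup>\<dagger>, y\<^sup>\<dagger>) \<in> H"
      by (rule HI[of "\<lambda>n. (X n)\<^sup>\<dagger>" "\<lambda>n. (Y n)\<^sup>\<dagger>"]) (intro G_adj bounded_linear.tendsto[OF bounded_linear_adj] XY)+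
    show "norm y \<le> norm x"
      by (rule LIMSEQ_le[OF tendsto_norm[OF XY(3)] tendsto_norm[OF XY(2)]]) (use G_norm[OF XY(1)] in blast)
    show "y \<in> C' \<otimes>\<^sub>m D'"
      by (rule closed_sequentially[OF _ G_ran[OF XY(1)] XY(3)]) (simp add: min_tensor_def)
  qed
  \<comment> \<open>The difference of the two pairs has first component 0, so the norm bound kills
    the second: \<open>H\<close> is the graph of a function.\<close>
  have H_unique: "y = y'" if "(x, y) \<in> H" "(x, y') \<in> H" for x y y'
    using H_norm[OF H_diff[OF that]] by simp
  \<comment> \<open>By the norm bound, second components follow a Cauchy sequence of first
    components, and \<open>bop\<close> is complete.\<close>
  have H_dom_closed: "\<exists>y. (x, y) \<in> H" if x: "x \<in> closure (fst ` G)" for x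
  proof -
    obtain X where X: "\<forall>n. X n \<in> fst ` G" "X \<longlonglongrightarrow> x" using closure_seqD[OF x] by blast
    have "\<forall>n. \<exists>y. (X n, y) \<in> G"
    proof
      fix n show "\<exists>y. (X n, y) \<in> G" using X(1)[rule_format, of n] by force
    qed
    then obtain Y where Y: "\<And>n. (X n, Y n) \<in> G" by metis
    have "norm (Y m - Y n) \<le> norm (X m - X n)" for m n by (rule G_norm[OF G_diff[OF Y Y]])
    moreover have "Cauchy X" using X(2) by (rule LIMSEQ_imp_Cauchy)
    ultimately have "Cauchy Y"
      unfolding Cauchy_def dist_norm by (meson le_less_trans)
    then obtain y where "Y \<longlonglongrightarrow> y" using Cauchy_convergent convergent_def by blast
    with HI[OF Y X(2)] show ?thesis by blast
  qed
  have tens: "(c \<otimes> d, f c \<otimes> g d) \<in> H" if c: "c \<in> C" and d: "d \<in> algebra" for c d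
  proof -
    obtain X where X: "\<forall>n. X n \<in> cspan (range E)" "X \<longlonglongrightarrow> d"
      using closure_seqD[OF d[unfolded algebra_def]] by blast
    have "(c \<otimes> X k, f c \<otimes> g (X k)) \<in> G" for k
    proof -
      obtain n l where l: "X k = (\<Sum>w\<in>words n. l w *\<^sub>C E w)" using span_levelD[OF X(1)[rule_format]] by blast
      have "g (X k) = (\<Sum>w\<in>words n. l w *\<^sub>C g (E w))"
        unfolding l by (simp add: star_hom_sum[OF g unital_cstar_algebra] E_in_algebra
            cstar_scaleC[OF unital_cstar_algebra] star_hom_scaleC[OF g])
      then show ?thesis
        using GI[of "\<lambda>w. l w *\<^sub>C c" n] c C
        by (simp add: l tensor_sum_right tensor_scaleC_left tensor_scaleC_right cstar_scaleC star_hom_scaleC[OF f])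
    qed
    moreover have "(\<lambda>k. g (X k)) \<longlonglongrightarrow> g d"
    proof (rule star_hom_tendsto[OF unital_cstar_algebra g _ X(2)])
      show "X n \<in> algebra" for n using X(1) closure_subset unfolding algebra_def by blast
    qed
    ultimately show ?thesis
      using bounded_linear.tendsto[OF bounded_linear_tensor_right X(2)]
        bounded_linear.tendsto[OF bounded_linear_tensor_right, of "\<lambda>k. g (X k)" "g d"]
      by (intro HI[of "\<lambda>k. c \<otimes> X k" "\<lambda>k. f c \<otimes> g (X k)"])
  qed
  have "{c \<otimes> d |c d. c \<in> C \<and> d \<in> algebra} \<subseteq> closure (fst ` G)"
  proof clarify
    fix c d assume "c \<in> C" "d \<in> algebra"
    then obtain X Y where XY: "\<forall>n. (X n, Y n) \<in> G" "X \<longlonglongrightarrow> c \<otimes> d"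
      using HE[OF tens] by blast
    have "X n \<in> fst ` G" for n using XY(1)[rule_format, of n] by force
    then show "c \<otimes> d \<in> closure (fst ` G)" using XY(2) by (rule closure_seqI)
  qed
  moreover have "complex_vector.subspace (fst ` G)"
    unfolding complex_vector.subspace_def
  proof (intro conjI ballI allI)
    have "(0, 0) \<in> G"
      using GI[of "\<lambda>_. 0" 0] cstar_zero[OF C] star_hom_zero[OF f C] by simp
    then show "0 \<in> fst ` G" by force
    fix x y s assume "x \<in> fst ` G" "y \<in> fst ` G"
    then obtain x' y' where "(x, x') \<in> G" "(y, y') \<in> G" by auto
    then have "(x + y, x' + y') \<in> G" by (rule G_add)
    then show "x + y \<in> fst ` G" by force
  next
    fix x s assume "x \<in> fst ` G"
    then obtain x' where "(x, x') \<in> G" by auto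
    then have "(s *\<^sub>C x, s *\<^sub>C x') \<in> G" by (rule G_scale)
    then show "s *\<^sub>C x \<in> fst ` G" by force
  qed
  ultimately have dom: "C \<otimes>\<^sub>m algebra \<subseteq> closure (fst ` G)"
    unfolding min_tensor_def by (intro closure_span_mono subspace_closure) auto
  then have "\<forall>x. \<exists>y. x \<in> C \<otimes>\<^sub>m algebra \<longrightarrow> (x, y) \<in> H" using H_dom_closed by blast
  then obtain h where h: "\<And>x. x \<in> C \<otimes>\<^sub>m algebra \<Longrightarrow> (x, h x) \<in> H" by metis
  note M = unital_cstar_min_tensor[OF C unital_cstar_algebra]
  have eq: "h x = y" if "x \<in> C \<otimes>\<^sub>m algebra" "(x, y) \<in> H" for x y
    using H_unique[OF h[OF that(1)] that(2)] .
  have "(1 \<otimes> 1, f 1 \<otimes> g 1) \<in> H"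
    by (rule tens) (simp_all add: cstar_one C unital_cstar_algebra)
  then have "(1, 1) \<in> H" by (simp add: star_hom_one[OF f] star_hom_one[OF g])
  then have "unital_star_hom (C \<otimes>\<^sub>m algebra) (C' \<otimes>\<^sub>m D') h"
    unfolding unital_star_hom_def
    by (auto intro!: eq cstar_one cstar_add cstar_mult cstar_scaleC cstar_adj M
        H_add H_mult H_scale H_adj h intro: H_ran[OF h])
  moreover have "\<forall>c\<in>C. \<forall>d\<in>algebra. h (c \<otimes> d) = f c \<otimes> g d"
    by (auto intro!: eq tens tensor_in_min_tensor)
  ultimately show ?thesis by blast
qed

lemma tensor_hom_properties:
  assumes "unital_cstar_algebra C" "unital_star_hom C C' f" "unital_star_hom algebra D' g"
  shows "unital_star_hom (C \<otimes>\<^sub>m algebra) (C' \<otimes>\<^sub>m D') (tensor_hom C algebra C' D' f g)"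
    and "c \<in> C \<Longrightarrow> d \<in> algebra \<Longrightarrow> tensor_hom C algebra C' D' f g (c \<otimes> d) = f c \<otimes> g d"
  using someI_ex[OF ex_tensor_hom[OF assms]] unfolding tensor_hom_def by blast+

end

section \<open>Path projections\<close>

lemma sum_product3:
  fixes f :: "'i \<Rightarrow> 'a::semiring_0"
  shows "sum f I * sum g J * sum h K = (\<Sum>i\<in>I. \<Sum>j\<in>J. \<Sum>k\<in>K. f i * g j * h k)"
  unfolding sum_product[of f] unfolding sum_distrib_right unfolding sum_distrib_left ..

definition path_proj :: "('n \<Rightarrow> 'n \<Rightarrow> 'a bop) \<Rightarrow> 'n list \<Rightarrow> 'n list \<Rightarrow> 'a bop" where
  "path_proj u w y = prod_list (map2 u w y) * (prod_list (map2 u w y))\<^sup>\<dagger>"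

lemma path_proj_Nil [simp]: "path_proj u [] [] = 1"
  by (simp add: path_proj_def)

lemma path_proj_Cons: "path_proj u (a # w) (b # y) = u a b * path_proj u w y * (u a b)\<^sup>\<dagger>"
  by (simp add: path_proj_def adj_mult mult.assoc)

definition cyl :: "('n \<Rightarrow> 'a bop) \<Rightarrow> 'n list \<Rightarrow> 'a bop" where
  "cyl S w = word_prod S w * (word_prod S w)\<^sup>\<dagger>"

lemma cyl_Nil [simp]: "cyl S [] = 1"
  by (simp add: cyl_def word_prod_def)

lemma cyl_Cons: "cyl S (a # w) = S a * cyl S w * (S a)\<^sup>\<dagger>"
  by (simp add: cyl_def word_prod_def adj_mult mult.assoc)

lemma magic_orthogonal:
  assumes "magic_unitary p" "j \<noteq> k"
  shows "p i j * p i k = 0" "p j i * p k i = 0"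
  using assms unfolding magic_unitary_def
  by (auto intro: projections_orthogonal[of UNIV "p i" j k] projections_orthogonal[of UNIV "\<lambda>j. p j i" j k])

lemma generated_cstar_subset: "X \<subseteq> generated_cstar_algebra X"
  by (auto simp: generated_cstar_algebra_def)

locale quantum_paths =
  fixes A :: "real^'n::finite^'n" and u :: "'n \<Rightarrow> 'n \<Rightarrow> 'a bop"
  assumes family: "quantum_path_family A u"
begin

lemma u_partial_isometry: "partial_isometry (u i j)"
  and magic_range: "magic_unitary (range_proj u)"
  and magic_source: "magic_unitary (source_proj u)"
  and prod_partial_isometry: "length w = length y \<Longrightarrow> admissible A w \<Longrightarrow> admissible A y \<Longrightarrow>
      partial_isometry (prod_list (map2 u w y))"
  using family unfolding quantum_path_family_def Let_def by blast+

lemma u_source: "u i j = u i j * source_proj u i j"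
  using u_partial_isometry[of i j] by (simp add: partial_isometry_def source_proj_def mult.assoc)

lemma u_range: "u i j = range_proj u i j * u i j"
  using u_partial_isometry[of i j] by (simp add: partial_isometry_def range_proj_def)

lemma adj_u_source: "(u i j)\<^sup>\<dagger> = source_proj u i j * (u i j)\<^sup>\<dagger>"
  using partial_isometry_adj[OF u_partial_isometry[of i j]] by (simp add: source_proj_def)

lemma adj_u_range: "(u i j)\<^sup>\<dagger> = (u i j)\<^sup>\<dagger> * range_proj u i j"
  using partial_isometry_adj[OF u_partial_isometry[of i j]] by (simp add: range_proj_def mult.assoc)

lemma sum_range_proj: "(\<Sum>j\<in>UNIV. u i j * (u i j)\<^sup>\<dagger>) = 1" "(\<Sum>i\<in>UNIV. u i j * (u i j)\<^sup>\<dagger>) = 1"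
  using magic_range by (auto simp: magic_unitary_def range_proj_def)

lemma sum_source_proj: "(\<Sum>j\<in>UNIV. (u i j)\<^sup>\<dagger> * u i j) = 1" "(\<Sum>i\<in>UNIV. (u i j)\<^sup>\<dagger> * u i j) = 1"
  using magic_source by (auto simp: magic_unitary_def source_proj_def)

text \<open>For this and the next three lemmas, source projections (for products
  \<open>u * u\<^sup>\<dagger>\<close>) or range projections (for
  \<open>u\<^sup>\<dagger> * u\<close>) are inserted between the factors; they are orthogonal along
  rows and columns of a magic unitary. Together these relations make \<open>u\<close> and
  \<open>conjugate_matrix u\<close> unitary matrices.\<close>

lemma u_adj_u_column: "i \<noteq> j \<Longrightarrow> u i k * (u j k)\<^sup>\<dagger> = 0"
proof -
  assume ij: "i \<noteq> j"
  have "u i k * (u j k)\<^sup>\<dagger> = u i k * (source_proj u i k * source_proj u j k) * (u j k)\<^sup>\<dagger>"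
    using u_source[of i k] adj_u_source[of j k] by (metis mult.assoc)
  then show ?thesis by (simp add: magic_orthogonal(2)[OF magic_source ij])
qed

lemma adj_u_u_row: "i \<noteq> j \<Longrightarrow> (u k i)\<^sup>\<dagger> * u k j = 0"
proof -
  assume ij: "i \<noteq> j"
  have "(u k i)\<^sup>\<dagger> * u k j = (u k i)\<^sup>\<dagger> * (range_proj u k i * range_proj u k j) * u k j"
    using u_range[of k j] adj_u_range[of k i] by (metis mult.assoc)
  then show ?thesis by (simp add: magic_orthogonal(1)[OF magic_range ij])
qed

lemma adj_u_u_column: "i \<noteq> j \<Longrightarrow> (u i k)\<^sup>\<dagger> * u j k = 0"
proof -
  assume ij: "i \<noteq> j"
  have "(u i k)\<^sup>\<dagger> * u j k = (u i k)\<^sup>\<dagger> * (range_proj u i k * range_proj u j k) * u j k"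
    using u_range[of j k] adj_u_range[of i k] by (metis mult.assoc)
  then show ?thesis by (simp add: magic_orthogonal(2)[OF magic_range ij])
qed

lemma u_adj_u_row: "i \<noteq> j \<Longrightarrow> u k i * (u k j)\<^sup>\<dagger> = 0"
proof -
  assume ij: "i \<noteq> j"
  have "u k i * (u k j)\<^sup>\<dagger> = u k i * (source_proj u k i * source_proj u k j) * (u k j)\<^sup>\<dagger>"
    using u_source[of k i] adj_u_source[of k j] by (metis mult.assoc)
  then show ?thesis by (simp add: magic_orthogonal(1)[OF magic_source ij])
qed

lemma path_proj_projection:
  assumes "length w = length y" "admissible A w" "admissible A y"
  shows "projection (path_proj u w y)"
  using prod_partial_isometry[OF assms]
  by (simp add: projection_def path_proj_def adj_mult partial_isometry_def mult.assoc[symmetric])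

lemma source_path_commute:
  assumes "length w = length y" "admissible A (a # w)" "admissible A (b # y)"
  shows "source_proj u a b * path_proj u w y = path_proj u w y * source_proj u a b"
  unfolding source_proj_def path_proj_def
proof (rule partial_isometry_product_commute[OF u_partial_isometry])
  have "admissible A w" "admissible A y"
    using assms(2,3) by (auto simp: admissible_def successively_Cons)
  then show "partial_isometry (prod_list (map2 u w y))"
    using assms(1) by (intro prod_partial_isometry)
  show "partial_isometry (u a b * prod_list (map2 u w y))"
    using prod_partial_isometry[of "a # w" "b # y"] assms by simp
qed

text \<open>The mixed terms vanish: by the third relation the source projection of \<open>u\<^sub>a\<^sub>b\<close> may be moved past
  the range projection of the remaining word, where it meets the orthogonal source projection
  of \<open>u\<^sub>a\<^sub>c\<close> or \<open>u\<^sub>c\<^sub>b\<close>.\<close>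

lemma mixed_terms:
  assumes "length w = length y" "admissible A (a # w)" "admissible A (b # y)" "u a b * (u c d)\<^sup>\<dagger> = 0"
  shows "u a b * path_proj u w y * (u c d)\<^sup>\<dagger> = 0"
proof -
  have "u a b * path_proj u w y * (u c d)\<^sup>\<dagger>
      = u a b * (source_proj u a b * path_proj u w y) * (u c d)\<^sup>\<dagger>"
    using u_source[of a b] by (metis mult.assoc)
  also have "\<dots> = u a b * path_proj u w y * (source_proj u a b * (u c d)\<^sup>\<dagger>)"
    by (simp add: source_path_commute[OF assms(1-3)] mult.assoc)
  also have "source_proj u a b * (u c d)\<^sup>\<dagger> = 0"
    by (simp add: source_proj_def mult.assoc assms(4))
  finally show ?thesis by simp
qed

end

section \<open>Cuntz--Krieger families\<close>

locale cuntz_krieger =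
  fixes A :: "real^'n::finite^'n" and S :: "'n \<Rightarrow> 'b bop"
  assumes zero_one: "zero_one_matrix A" and ck: "cuntz_krieger_family A S"
begin

lemma sum_S: "(\<Sum>j\<in>UNIV. S j * (S j)\<^sup>\<dagger>) = 1"
  and adj_S_S: "(S i)\<^sup>\<dagger> * S k =
    (if i = k then (\<Sum>j\<in>UNIV. (A $ i $ j) *\<^sub>R (S j * (S j)\<^sup>\<dagger>)) else 0)"
  using ck unfolding cuntz_krieger_family_def by blast+

text \<open>Not part of the Cuntz-Krieger relations as given, but a consequence: multiply the sum of
  all range projections, which is 1, by \<open>S i\<close>; the summands with j \<noteq> i
  vanish.\<close>

lemma S_partial_isometry: "S i * (S i)\<^sup>\<dagger> * S i = S i"
proof -
  have "S i = (\<Sum>j\<in>UNIV. S j * (S j)\<^sup>\<dagger>) * S i" by (simp add: sum_S)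
  also have "\<dots> = (\<Sum>j\<in>UNIV. if j = i then S i * (S i)\<^sup>\<dagger> * S i else 0)"
    unfolding sum_distrib_right by (intro sum.cong refl) (auto simp: mult.assoc adj_S_S)
  finally show ?thesis by simp
qed

text \<open>The source projection of \<open>S i\<close> is the sum of the range projections of the
  letters allowed after \<open>i\<close>, and a forbidden \<open>S j\<close> has its range
  orthogonal to it.\<close>

lemma S_S_eq_0: "A $ i $ j \<noteq> 1 \<Longrightarrow> S i * S j = 0"
proof -
  assume "A $ i $ j \<noteq> 1"
  then have A0: "A $ i $ j = 0" using zero_one by (auto simp: zero_one_matrix_def)
  have "S i * S j = S i * ((S i)\<^sup>\<dagger> * S i) * S j" by (simp add: mult.assoc[symmetric] S_partial_isometry)
  also have "(S i)\<^sup>\<dagger> * S i = (\<Sum>k\<in>UNIV. (A $ i $ k) *\<^sub>R (S k * (S k)\<^sup>\<dagger>))" by (simp add: adj_S_S)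
  also have "S i * \<dots> * S j = S i * (\<Sum>k\<in>UNIV. (A $ i $ k) *\<^sub>R (S k * ((S k)\<^sup>\<dagger> * S j)))"
    by (simp add: sum_distrib_right mult.assoc)
  also have "(\<Sum>k\<in>UNIV. (A $ i $ k) *\<^sub>R (S k * ((S k)\<^sup>\<dagger> * S j))) = 0"
  proof (rule sum.neutral, rule ballI)
    fix k show "(A $ i $ k) *\<^sub>R (S k * ((S k)\<^sup>\<dagger> * S j)) = 0"
      by (cases "k = j") (simp_all add: A0 adj_S_S)
  qed
  finally show ?thesis by simp
qed

text \<open>Allows sums to run over all words of a given length: the inadmissible ones contribute
  0.\<close>

lemma word_prod_eq_0: "\<not> admissible A w \<Longrightarrow> word_prod S w = 0"
proof (induction w)
  case Nil
  then show ?case by (simp add: admissible_def)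
next
  case (Cons a w)
  show ?case
  proof (cases "admissible A w")
    case True
    with Cons.prems obtain b v where w: "w = b # v" and "A $ a $ b \<noteq> 1"
      by (cases w) (auto simp: admissible_def)
    then have "S a * S b = 0" by (simp add: S_S_eq_0)
    then show ?thesis by (simp add: word_prod_def w mult.assoc[symmetric])
  next
    case False
    with Cons.IH show ?thesis by (simp add: word_prod_def)
  qed
qed

lemma cyl_eq_0: "\<not> admissible A w \<Longrightarrow> cyl S w = 0"
  by (simp add: cyl_def word_prod_eq_0)

lemma S_cyl_eq_0: "\<not> admissible A (a # w) \<Longrightarrow> S a * cyl S w = 0"
  using word_prod_eq_0[of "a # w"] by (simp add: cyl_def word_prod_def mult.assoc[symmetric])

end

lemma path_space_algebra_eq: "path_space_algebra A S = closure (cspan {cyl S w |w. admissible A w})"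
  unfolding path_space_algebra_def cyl_def ..

lemma cyl_in_path_space_algebra: "admissible A w \<Longrightarrow> cyl S w \<in> path_space_algebra A S"
  unfolding path_space_algebra_eq by (rule closure_span_base) blast

locale path_action =
  fixes A :: "real^'n::finite^'n" and C :: "'a bop set" and u :: "'n \<Rightarrow> 'n \<Rightarrow> 'a bop"
    and CK :: "'b bop set" and S :: "'n \<Rightarrow> 'b bop" and \<phi> :: "'b bop \<Rightarrow> ('a \<times> 'b) bop"
  assumes zero_one: "zero_one_matrix A"
    and quantum_path_algebra: "quantum_path_algebra A C u"
    and cuntz_krieger_algebra: "cuntz_krieger_algebra A CK S"
    and hom: "unital_star_hom CK (C \<otimes>\<^sub>m CK) \<phi>"
    and \<phi>_S: "\<phi> (S i) = (\<Sum>j\<in>UNIV. u i j \<otimes> S j)"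

sublocale path_action \<subseteq> quantum_paths A u
  using quantum_path_algebra by unfold_locales (simp add: quantum_path_algebra_def)

sublocale path_action \<subseteq> cuntz_krieger A S
  using cuntz_krieger_algebra zero_one by unfold_locales (auto simp: cuntz_krieger_algebra_def)

context path_action
begin

lemma cstar_C: "unital_cstar_algebra C"
  using quantum_path_algebra unfolding quantum_path_algebra_def by blast

lemma cstar_CK: "unital_cstar_algebra CK"
  using cuntz_krieger_algebra unfolding cuntz_krieger_algebra_def by blast

lemma u_in_C: "u i j \<in> C"
proof -
  have "C = generated_cstar_algebra {u i j |i j. True}"
    using quantum_path_algebra unfolding quantum_path_algebra_def by blast
  then show ?thesis using generated_cstar_subset[of "{u i j |i j. True}"] by blast
qed

lemma S_in_CK: "S i \<in> CK"
proof -
  have "CK = generated_cstar_algebra (range S)"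
    using cuntz_krieger_algebra unfolding cuntz_krieger_algebra_def by blast
  then show ?thesis using generated_cstar_subset[of "range S"] by blast
qed

lemma path_proj_in_C: "path_proj u w y \<in> C"
  unfolding path_proj_def
  by (intro cstar_mult cstar_adj cstar_prod_list cstar_C) (auto simp: u_in_C)

lemma cyl_in_CK: "cyl S w \<in> CK"
  unfolding cyl_def word_prod_def
  by (intro cstar_mult cstar_adj cstar_prod_list cstar_CK) (auto simp: S_in_CK)

lemma \<phi>_cyl:
  assumes "admissible A w"
  shows "\<phi> (cyl S w) = (\<Sum>y\<in>words (length w). path_proj u w y \<otimes> cyl S y)"
  using assms
proof (induction w)
  case Nil
  show ?case by (simp add: words_0 star_hom_one[OF hom])
next
  case (Cons a w)
  then have IH: "\<phi> (cyl S w) = (\<Sum>y\<in>words (length w). path_proj u w y \<otimes> cyl S y)"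
    by (auto simp: admissible_def successively_Cons)
  \<comment> \<open>For c \<noteq> b one of the two legs vanishes: the first by
    \<open>mixed_terms\<close> if \<open>b # y\<close> is admissible, otherwise the second because
    \<open>S b * cyl S y\<close> is 0. Admissibility of \<open>a # w\<close> enters through
    \<open>mixed_terms\<close>.\<close>
  have summand: "(u a b \<otimes> S b) * (path_proj u w y \<otimes> cyl S y) * ((u a c)\<^sup>\<dagger> \<otimes> (S c)\<^sup>\<dagger>)
      = (if c = b then path_proj u (a # w) (b # y) \<otimes> cyl S (b # y) else 0)"
    if y: "y \<in> words (length w)" for b c y
  proof (cases "c = b")
    case False
    show ?thesis
    proof (cases "admissible A (b # y)")
      case True
      have "u a b * path_proj u w y * (u a c)\<^sup>\<dagger> = 0"
        using y Cons.prems True False by (intro mixed_terms u_adj_u_row) auto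
      with False show ?thesis by (simp add: tensor_mult)
    qed (use False in \<open>simp add: tensor_mult S_cyl_eq_0\<close>)
  qed (simp add: tensor_mult path_proj_Cons cyl_Cons)
  have "\<phi> (cyl S (a # w)) = \<phi> (S a) * \<phi> (cyl S w) * (\<phi> (S a))\<^sup>\<dagger>"
    by (simp add: cyl_Cons star_hom_mult[OF hom] star_hom_adj[OF hom] cstar_mult[OF cstar_CK]
        cstar_adj[OF cstar_CK] S_in_CK cyl_in_CK)
  also have "\<dots> = (\<Sum>b\<in>UNIV. \<Sum>y\<in>words (length w). \<Sum>c\<in>UNIV.
      (u a b \<otimes> S b) * (path_proj u w y \<otimes> cyl S y) * ((u a c)\<^sup>\<dagger> \<otimes> (S c)\<^sup>\<dagger>))"
    unfolding IH \<phi>_S adj_sum adj_tensor by (rule sum_product3)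
  also have "\<dots> = (\<Sum>b\<in>UNIV. \<Sum>y\<in>words (length w). path_proj u (a # w) (b # y) \<otimes> cyl S (b # y))"
    by (intro sum.cong refl) (simp add: summand)
  finally show ?case by (simp only: sum_words_Suc_Cons length_Cons)
qed

lemma path_space_algebra_subset_CK: "path_space_algebra A S \<subseteq> CK"
  unfolding path_space_algebra_eq
  by (rule closure_span_mono) (auto simp: cyl_in_CK cstar_subspace cstar_closed cstar_CK)

lemma \<phi>_path_space_algebra:
  "\<phi> ` path_space_algebra A S \<subseteq> C \<otimes>\<^sub>m path_space_algebra A S"
proof -
  let ?V = "C \<otimes>\<^sub>m path_space_algebra A S"
  have V: "complex_vector.subspace ?V" "closed ?V"
    unfolding min_tensor_def by (simp_all add: subspace_closure_span)
  have "\<phi> (cyl S w) \<in> ?V" if "admissible A w" for w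
    unfolding \<phi>_cyl[OF that]
  proof (rule complex_vector.subspace_sum[OF V(1)])
    fix y
    show "path_proj u w y \<otimes> cyl S y \<in> ?V"
    proof (cases "admissible A y")
      case True
      then show ?thesis by (intro tensor_in_min_tensor path_proj_in_C cyl_in_path_space_algebra)
    next
      case False
      then show ?thesis by (simp add: cyl_eq_0 complex_vector.subspace_0[OF V(1)])
    qed
  qed
  then have "\<phi> ` {cyl S w |w. admissible A w} \<subseteq> ?V" by blast
  moreover have "{cyl S w |w. admissible A w} \<subseteq> CK" using cyl_in_CK by blast
  ultimately show ?thesis
    using star_hom_closure_span_subset[OF cstar_CK hom _ _ V] unfolding path_space_algebra_eq by blast
qed

end

section \<open>The full shift\<close>

lemma admissible_all_ones: "admissible all_ones w"
  by (induction w) (auto simp: admissible_def successively_Cons all_ones_def)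

locale full_shift_action = path_action all_ones C u CK S \<phi>
  for C :: "'a bop set" and u :: "'n::finite \<Rightarrow> 'n \<Rightarrow> 'a bop"
    and CK :: "'b bop set" and S :: "'n \<Rightarrow> 'b bop" and \<phi> :: "'b bop \<Rightarrow> ('a \<times> 'b) bop" +
  fixes \<Phi> :: "'a bop \<Rightarrow> ('a \<times> 'a) bop"
  assumes comult: "matrix_comultiplication C u \<Phi>"
begin

lemma adj_S_S_same: "(S i)\<^sup>\<dagger> * S i = 1"
  using adj_S_S[of i i] by (simp add: all_ones_def sum_S)

lemma adj_word_prod_word_prod: "(word_prod S w)\<^sup>\<dagger> * word_prod S w = 1"
proof (induction w)
  case (Cons a w)
  have "(word_prod S (a # w))\<^sup>\<dagger> * word_prod S (a # w)
      = (word_prod S w)\<^sup>\<dagger> * ((S a)\<^sup>\<dagger> * S a) * word_prod S w"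
    by (simp add: word_prod_def adj_mult mult.assoc)
  with Cons show ?case by (simp add: adj_S_S_same)
qed (simp add: word_prod_def)

text \<open>In the full shift the generators are isometries, hence so is every
  \<open>word_prod S w\<close>, and the range projection of an isometry is not 0.\<close>

sublocale nonzero_cylinders "cyl S"
proof
  fix w
  let ?X = "word_prod S w"
  have "cyl S w * cyl S w = ?X * (?X\<^sup>\<dagger> * ?X) * ?X\<^sup>\<dagger>" by (simp add: cyl_def mult.assoc)
  then show "projection (cyl S w)"
    by (simp add: projection_def adj_word_prod_word_prod) (simp add: cyl_def adj_mult)
  show "cyl S [] = 1" by simp
  have "(\<Sum>a\<in>UNIV. cyl S (w @ [a])) = (\<Sum>a\<in>UNIV. ?X * (S a * (S a)\<^sup>\<dagger>) * ?X\<^sup>\<dagger>)"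
    by (simp add: cyl_def word_prod_def adj_mult mult.assoc)
  also have "\<dots> = ?X * (\<Sum>a\<in>UNIV. S a * (S a)\<^sup>\<dagger>) * ?X\<^sup>\<dagger>"
    unfolding sum_distrib_left sum_distrib_right ..
  finally show "(\<Sum>a\<in>UNIV. cyl S (w @ [a])) = cyl S w" by (simp add: sum_S cyl_def)
  show "cyl S w \<noteq> 0"
  proof
    assume "cyl S w = 0"
    then have "?X\<^sup>\<dagger> * (?X * ?X\<^sup>\<dagger>) * ?X = 0" by (simp add: cyl_def)
    moreover have "?X\<^sup>\<dagger> * (?X * ?X\<^sup>\<dagger>) * ?X = (?X\<^sup>\<dagger> * ?X) * (?X\<^sup>\<dagger> * ?X)" by (simp add: mult.assoc)
    ultimately show False by (simp add: adj_word_prod_word_prod)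
  qed
qed

lemma path_space_algebra: "path_space_algebra all_ones S = algebra"
  unfolding path_space_algebra_eq algebra_def by (simp add: admissible_all_ones full_SetCompr_eq)

lemma comult_hom: "unital_star_hom C (C \<otimes>\<^sub>m C) \<Phi>"
  and \<Phi>_u: "\<Phi> (u i j) = (\<Sum>k\<in>UNIV. u i k \<otimes> u k j)"
  using comult by (simp_all add: matrix_comultiplication_def)

lemma \<Phi>_path_proj:
  assumes "length w = length y"
  shows "\<Phi> (path_proj u w y) = (\<Sum>z\<in>words (length w). path_proj u w z \<otimes> path_proj u z y)"
  using assms
proof (induction w y rule: list_induct2)
  case Nil
  show ?case by (simp add: words_0 star_hom_one[OF comult_hom])
next
  case (Cons a w b y)
  \<comment> \<open>Every word is admissible in the full shift, so the first leg alone makes all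
    mixed terms vanish.\<close>
  have summand: "(u a c \<otimes> u c b) * (path_proj u w z \<otimes> path_proj u z y) * ((u a d)\<^sup>\<dagger> \<otimes> (u d b)\<^sup>\<dagger>)
      = (if d = c then path_proj u (a # w) (c # z) \<otimes> path_proj u (c # z) (b # y) else 0)"
    if z: "z \<in> words (length w)" for c d z
  proof (cases "d = c")
    case False
    then have "u a c * path_proj u w z * (u a d)\<^sup>\<dagger> = 0"
      using z by (intro mixed_terms u_adj_u_row admissible_all_ones) auto
    with False show ?thesis by (simp add: tensor_mult)
  qed (simp add: tensor_mult path_proj_Cons)
  have "\<Phi> (path_proj u (a # w) (b # y)) = \<Phi> (u a b) * \<Phi> (path_proj u w y) * (\<Phi> (u a b))\<^sup>\<dagger>"
    by (simp add: path_proj_Cons star_hom_mult[OF comult_hom] star_hom_adj[OF comult_hom]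
        cstar_mult[OF cstar_C] cstar_adj[OF cstar_C] u_in_C path_proj_in_C)
  also have "\<dots> = (\<Sum>c\<in>UNIV. \<Sum>z\<in>words (length w). \<Sum>d\<in>UNIV.
      (u a c \<otimes> u c b) * (path_proj u w z \<otimes> path_proj u z y) * ((u a d)\<^sup>\<dagger> \<otimes> (u d b)\<^sup>\<dagger>))"
    unfolding Cons.IH \<Phi>_u adj_sum adj_tensor by (rule sum_product3)
  also have "\<dots> = (\<Sum>c\<in>UNIV. \<Sum>z\<in>words (length w).
      path_proj u (a # w) (c # z) \<otimes> path_proj u (c # z) (b # y))"
    by (intro sum.cong refl) (simp add: summand)
  finally show ?case by (simp only: sum_words_Suc_Cons length_Cons)
qed

text \<open>After splitting off the first letter, the inner sum is 1 by induction and the outer one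
  is a column of range projections. With the row version below, \<open>path_proj u\<close> is a
  magic unitary at each word length.\<close>

lemma sum_path_proj_left: "(\<Sum>w\<in>words (length y). path_proj u w y) = 1"
proof (induction y)
  case (Cons b y)
  have "(\<Sum>w\<in>words (length (b # y)). path_proj u w (b # y))
      = (\<Sum>a\<in>UNIV. \<Sum>w\<in>words (length y). u a b * path_proj u w y * (u a b)\<^sup>\<dagger>)"
    by (simp only: sum_words_Suc_Cons length_Cons path_proj_Cons)
  also have "\<dots> = (\<Sum>a\<in>UNIV. u a b * (\<Sum>w\<in>words (length y). path_proj u w y) * (u a b)\<^sup>\<dagger>)"
    unfolding sum_distrib_left sum_distrib_right ..
  finally show ?case by (simp add: Cons.IH sum_range_proj)
qed (simp add: words_0)

lemma sum_path_proj_right: "(\<Sum>y\<in>words (length w). path_proj u w y) = 1"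
proof (induction w)
  case (Cons a w)
  have "(\<Sum>y\<in>words (length (a # w)). path_proj u (a # w) y)
      = (\<Sum>b\<in>UNIV. \<Sum>y\<in>words (length w). u a b * path_proj u w y * (u a b)\<^sup>\<dagger>)"
    by (simp only: sum_words_Suc_Cons length_Cons path_proj_Cons)
  also have "\<dots> = (\<Sum>b\<in>UNIV. u a b * (\<Sum>y\<in>words (length w). path_proj u w y) * (u a b)\<^sup>\<dagger>)"
    unfolding sum_distrib_left sum_distrib_right ..
  finally show ?case by (simp add: Cons.IH sum_range_proj)
qed (simp add: words_0)

lemma projection_path_proj: "length w = length y \<Longrightarrow> projection (path_proj u w y)"
  by (intro path_proj_projection admissible_all_ones)

lemma path_proj_orthogonal_right:
  assumes "length w = length y" "length w = length z" "y \<noteq> z"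
  shows "path_proj u w y * path_proj u w z = 0"
  by (rule projections_orthogonal[OF finite_words _ sum_path_proj_right])
     (use assms projection_path_proj in auto)

lemma path_proj_orthogonal_left:
  assumes "length w = length y" "length v = length y" "v \<noteq> w"
  shows "path_proj u v y * path_proj u w y = 0"
  by (rule projections_orthogonal[OF finite_words _ sum_path_proj_left[of y]])
     (use assms projection_path_proj in auto)

lemma \<phi>_cyl_full: "\<phi> (cyl S w) = (\<Sum>y\<in>words (length w). path_proj u w y \<otimes> cyl S y)"
  by (rule \<phi>_cyl[OF admissible_all_ones])

lemma \<phi>_hom: "unital_star_hom algebra (C \<otimes>\<^sub>m algebra) \<phi>"
  using hom \<phi>_path_space_algebra path_space_algebra_subset_CK
  unfolding path_space_algebra unital_star_hom_def by blast

lemma compact_matrix_quantum_group: "compact_matrix_quantum_group C u \<Phi>"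
  unfolding compact_matrix_quantum_group_def
proof (intro conjI)
  show "C = generated_cstar_algebra {u i j |i j. True}"
    using quantum_path_algebra unfolding quantum_path_algebra_def by blast
  show "invertible_over C u"
    unfolding invertible_over_def
  proof (rule exI[of _ "\<lambda>i j. (u j i)\<^sup>\<dagger>"], intro conjI allI)
    fix i j
    show "(u j i)\<^sup>\<dagger> \<in> C" by (intro cstar_adj cstar_C u_in_C)
    show "(\<Sum>k\<in>UNIV. u i k * (u j k)\<^sup>\<dagger>) = (if i = j then 1 else 0)"
      by (simp add: sum_range_proj u_adj_u_column)
    show "(\<Sum>k\<in>UNIV. (u k i)\<^sup>\<dagger> * u k j) = (if i = j then 1 else 0)"
      by (simp add: sum_source_proj adj_u_u_row)
  qed
  show "invertible_over C (conjugate_matrix u)"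
    unfolding invertible_over_def conjugate_matrix_def
  proof (rule exI[of _ "\<lambda>i j. u j i"], intro conjI allI)
    fix i j
    show "u j i \<in> C" by (rule u_in_C)
    show "(\<Sum>k\<in>UNIV. (u i k)\<^sup>\<dagger> * u j k) = (if i = j then 1 else 0)"
      by (simp add: sum_source_proj adj_u_u_column)
    show "(\<Sum>k\<in>UNIV. u k i * (u k j)\<^sup>\<dagger>) = (if i = j then 1 else 0)"
      by (simp add: sum_range_proj u_adj_u_row)
  qed
qed (simp_all add: cstar_C comult)

lemma coaction:
  assumes x: "x \<in> algebra"
  shows "assoc_op (tensor_hom C algebra (C \<otimes>\<^sub>m C) algebra \<Phi> id (\<phi> x))
    = tensor_hom C algebra C (C \<otimes>\<^sub>m algebra) id \<phi> (\<phi> x)"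
proof -
  have id: "unital_star_hom C C id" "unital_star_hom algebra algebra id"
    by (simp_all add: unital_star_hom_def)
  define h1 where "h1 = tensor_hom C algebra (C \<otimes>\<^sub>m C) algebra \<Phi> id"
  define h2 where "h2 = tensor_hom C algebra C (C \<otimes>\<^sub>m algebra) id \<phi>"
  note alg = unital_cstar_algebra
  note M = unital_cstar_min_tensor[OF cstar_C alg]
  have h1: "unital_star_hom (C \<otimes>\<^sub>m algebra) ((C \<otimes>\<^sub>m C) \<otimes>\<^sub>m algebra) h1"
    "\<And>c d. c \<in> C \<Longrightarrow> d \<in> algebra \<Longrightarrow> h1 (c \<otimes> d) = \<Phi> c \<otimes> d"
    using tensor_hom_properties[OF cstar_C comult_hom id(2)] by (simp_all add: h1_def)
  have h2: "unital_star_hom (C \<otimes>\<^sub>m algebra) (C \<otimes>\<^sub>m (C \<otimes>\<^sub>m algebra)) h2"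
    "\<And>c d. c \<in> C \<Longrightarrow> d \<in> algebra \<Longrightarrow> h2 (c \<otimes> d) = c \<otimes> \<phi> d"
    using tensor_hom_properties[OF cstar_C id(1) \<phi>_hom] by (simp_all add: h2_def)
  interpret assoc: bounded_linear "assoc_op :: (('a \<times> 'a) \<times> 'b) bop \<Rightarrow> _" by (rule bounded_linear_assoc_op)
  let ?d = "\<lambda>x. assoc_op (h1 (\<phi> x)) - h2 (\<phi> x)"
  have \<phi>_in: "\<phi> x \<in> C \<otimes>\<^sub>m algebra" if "x \<in> algebra" for x by (rule star_hom_in[OF \<phi>_hom that])
  \<comment> \<open>Both sides become the double sum over y and z of P_wz \<otimes> P_zy \<otimes>
    cyl_y: the left by applying \<Phi> to P_wy, the right by applying \<phi> to cyl_z.\<close>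
  have gen: "assoc_op (h1 (\<phi> (cyl S w))) = h2 (\<phi> (cyl S w))" for w
  proof -
    let ?W = "words (length w) :: 'n list set"
    have t: "path_proj u w y \<otimes> cyl S y \<in> C \<otimes>\<^sub>m algebra" for y
      by (intro tensor_in_min_tensor path_proj_in_C E_in_algebra)
    have "assoc_op (h1 (\<phi> (cyl S w)))
        = (\<Sum>y\<in>?W. \<Sum>z\<in>?W. path_proj u w z \<otimes> (path_proj u z y \<otimes> cyl S y))"
    proof -
      have "h1 (\<phi> (cyl S w)) = (\<Sum>y\<in>?W. \<Phi> (path_proj u w y) \<otimes> cyl S y)"
        unfolding \<phi>_cyl_full star_hom_sum[OF h1(1) M t]
        by (simp add: h1(2) path_proj_in_C E_in_algebra)
      also have "\<dots> = (\<Sum>y\<in>?W. \<Sum>z\<in>?W. (path_proj u w z \<otimes> path_proj u z y) \<otimes> cyl S y)"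
        by (intro sum.cong refl) (simp add: \<Phi>_path_proj tensor_sum_left)
      finally show ?thesis by (simp add: assoc.sum assoc_op_tensor)
    qed
    also have "\<dots> = (\<Sum>z\<in>?W. \<Sum>y\<in>?W. path_proj u w z \<otimes> (path_proj u z y \<otimes> cyl S y))"
      by (rule sum.swap)
    also have "\<dots> = (\<Sum>z\<in>?W. path_proj u w z \<otimes> \<phi> (cyl S z))"
      by (intro sum.cong refl) (simp add: \<phi>_cyl_full tensor_sum_right)
    also have "\<dots> = h2 (\<phi> (cyl S w))"
      unfolding \<phi>_cyl_full[of w] star_hom_sum[OF h2(1) M t]
      by (simp add: h2(2) path_proj_in_C E_in_algebra)
    finally show ?thesis .
  qed
  have "cspan (range (cyl S)) \<subseteq> {x \<in> algebra. assoc_op (h1 (\<phi> x)) = h2 (\<phi> x)}"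
  proof (rule complex_vector.span_minimal)
    show "range (cyl S) \<subseteq> {x \<in> algebra. assoc_op (h1 (\<phi> x)) = h2 (\<phi> x)}"
      using gen E_in_algebra by blast
    show "complex_vector.subspace {x \<in> algebra. assoc_op (h1 (\<phi> x)) = h2 (\<phi> x)}"
    proof (rule complex_vector.subspaceI)
      show "0 \<in> {x \<in> algebra. assoc_op (h1 (\<phi> x)) = h2 (\<phi> x)}"
        by (simp add: cstar_zero alg star_hom_zero[OF \<phi>_hom alg] star_hom_zero[OF h1(1) M]
            star_hom_zero[OF h2(1) M] assoc.zero)
    next
      fix x y assume "x \<in> {x \<in> algebra. assoc_op (h1 (\<phi> x)) = h2 (\<phi> x)}"
        "y \<in> {x \<in> algebra. assoc_op (h1 (\<phi> x)) = h2 (\<phi> x)}"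
      then show "x + y \<in> {x \<in> algebra. assoc_op (h1 (\<phi> x)) = h2 (\<phi> x)}"
        by (simp add: cstar_add alg star_hom_add[OF \<phi>_hom] star_hom_add[OF h1(1)]
            star_hom_add[OF h2(1)] assoc.add \<phi>_in)
    next
      fix c x assume "x \<in> {x \<in> algebra. assoc_op (h1 (\<phi> x)) = h2 (\<phi> x)}"
      then show "c *\<^sub>C x \<in> {x \<in> algebra. assoc_op (h1 (\<phi> x)) = h2 (\<phi> x)}"
        by (simp add: cstar_scaleC alg star_hom_scaleC[OF \<phi>_hom] star_hom_scaleC[OF h1(1)]
            star_hom_scaleC[OF h2(1)] assoc_op_scaleC \<phi>_in)
    qed
  qed
  then have span: "\<And>x. x \<in> cspan (range (cyl S)) \<Longrightarrow> x \<in> algebra \<and> assoc_op (h1 (\<phi> x)) = h2 (\<phi> x)"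
    by blast
  obtain X where X: "\<forall>n. X n \<in> cspan (range (cyl S))" "X \<longlonglongrightarrow> x"
    using closure_seqD[OF x[unfolded algebra_def]] by blast
  have Xa: "X n \<in> algebra" for n using X(1) span by blast
  have lim: "(\<lambda>n. \<phi> (X n)) \<longlonglongrightarrow> \<phi> x"
    by (rule star_hom_tendsto[OF alg \<phi>_hom Xa X(2)])
  have "(\<lambda>n. assoc_op (h1 (\<phi> (X n)))) \<longlonglongrightarrow> assoc_op (h1 (\<phi> x))"
    by (rule assoc.tendsto, rule star_hom_tendsto[OF M h1(1) _ lim]) (rule \<phi>_in[OF Xa])
  moreover have "(\<lambda>n. h2 (\<phi> (X n))) \<longlonglongrightarrow> h2 (\<phi> x)"
    by (rule star_hom_tendsto[OF M h2(1) _ lim]) (rule \<phi>_in[OF Xa])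
  moreover have "assoc_op (h1 (\<phi> (X n))) = h2 (\<phi> (X n))" for n using X(1) span by blast
  ultimately have "assoc_op (h1 (\<phi> x)) = h2 (\<phi> x)"
    by (simp add: LIMSEQ_unique)
  then show ?thesis by (simp add: h1_def h2_def)
qed

lemma density:
  "closure (cspan {\<phi> x * (c \<otimes> 1) |x c. x \<in> algebra \<and> c \<in> C}) = C \<otimes>\<^sub>m algebra"
proof (rule antisym)
  let ?X = "{\<phi> x * (c \<otimes> 1) |x c. x \<in> algebra \<and> c \<in> C}"
  note alg = unital_cstar_algebra
  note M = unital_cstar_min_tensor[OF cstar_C alg]
  show "closure (cspan ?X) \<subseteq> C \<otimes>\<^sub>m algebra"
  proof (rule closure_span_mono[OF _ cstar_subspace[OF M] cstar_closed[OF M]], clarify)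
    fix x c assume "x \<in> algebra" "c \<in> C"
    then show "\<phi> x * (c \<otimes> 1) \<in> C \<otimes>\<^sub>m algebra"
      by (intro cstar_mult[OF M] star_hom_in[OF \<phi>_hom] tensor_in_min_tensor cstar_one[OF alg])
  qed
  \<comment> \<open>c \<otimes> cyl_z is the sum over w of \<phi>(cyl_w) (P_wz c \<otimes> 1):
    orthogonality within row w leaves only y = z, and then column z of the path projections sums to
    1.\<close>
  have cyl: "c \<otimes> cyl S z \<in> cspan ?X" if c: "c \<in> C" for c z
  proof -
    let ?W = "words (length z) :: 'n list set"
    have "\<phi> (cyl S w) * ((path_proj u w z * c) \<otimes> 1) = (path_proj u w z * c) \<otimes> cyl S z"
      if w: "w \<in> ?W" for w
    proof -
      have "\<phi> (cyl S w) * ((path_proj u w z * c) \<otimes> 1)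
          = (\<Sum>y\<in>?W. if y = z then (path_proj u w z * c) \<otimes> cyl S z else 0)"
        unfolding \<phi>_cyl_full sum_distrib_right
      proof (rule sum.cong)
        fix y assume y: "y \<in> ?W"
        have "path_proj u w y * path_proj u w z = (if y = z then path_proj u w z else 0)"
          using w y path_proj_orthogonal_right[of w y z] projectionD(1)[OF projection_path_proj[of w z]]
          by auto
        then have "path_proj u w y * (path_proj u w z * c) = (if y = z then path_proj u w z * c else 0)"
          by (simp add: mult.assoc[symmetric])
        then show "path_proj u w y \<otimes> cyl S y * ((path_proj u w z * c) \<otimes> 1)
            = (if y = z then (path_proj u w z * c) \<otimes> cyl S z else 0)"
          by (simp add: tensor_mult)
      qed (use w in simp)
      then show ?thesis by (simp add: finite_words)
    qed
    moreover have "\<phi> (cyl S w) * ((path_proj u w z * c) \<otimes> 1) \<in> cspan ?X" for w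
      by (rule complex_vector.span_base) (use E_in_algebra cstar_mult[OF cstar_C path_proj_in_C c] in blast)
    ultimately have "(\<Sum>w\<in>?W. (path_proj u w z * c) \<otimes> cyl S z) \<in> cspan ?X"
      by (intro complex_vector.span_sum) (metis (no_types, lifting))
    then show ?thesis
      by (simp only: tensor_sum_left[symmetric] sum_distrib_right[symmetric] sum_path_proj_left mult_1)
  qed
  show "C \<otimes>\<^sub>m algebra \<subseteq> closure (cspan ?X)"
    unfolding min_tensor_def
  proof (rule closure_span_mono[OF _ subspace_closure_span closed_closure], clarify)
    fix c d assume c: "c \<in> C" and d: "d \<in> algebra"
    obtain D where D: "\<forall>n. D n \<in> cspan (range (cyl S))" "D \<longlonglongrightarrow> d"
      using closure_seqD[OF d[unfolded algebra_def]] by blast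
    show "c \<otimes> d \<in> closure (cspan ?X)"
    proof (rule closure_seqI[OF _ bounded_linear.tendsto[OF bounded_linear_tensor_right D(2)]])
      fix n
      obtain m l where l: "D n = (\<Sum>w\<in>words m. l w *\<^sub>C cyl S w)"
        using span_levelD[OF D(1)[rule_format]] by blast
      show "c \<otimes> D n \<in> cspan ?X"
        unfolding l tensor_sum_right tensor_scaleC_right
        by (intro complex_vector.span_sum complex_vector.span_scale cyl c)
    qed
  qed
qed

lemma quantum_action: "quantum_action C \<Phi> algebra \<phi>"
  unfolding quantum_action_def
  using unital_cstar_algebra \<phi>_hom coaction density by blast

end

section \<open>A representation on a shift orbit\<close>

text \<open>\<open>pf_vector\<close> is a definite description, so maximality of the eigenvalue N
  and uniqueness of the vector both have to be verified. With a constant vector, relation (I)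
  reduces to the row sums of the two magic unitaries.\<close>

lemma pf_vector_all_ones: "pf_vector (all_ones :: real^'n::finite^'n) $ i = 1 / real CARD('n)"
proof -
  let ?v = "(\<chi> i. 1 / real CARD('n)) :: real^'n"
  have Av: "(all_ones *v v) $ i = (\<Sum>j\<in>UNIV. v $ j)" for v :: "real^'n" and i
    by (simp add: matrix_vector_mult_def all_ones_def)
  have "maximal_eigenvalue (all_ones :: real^'n^'n) (real CARD('n))"
    unfolding maximal_eigenvalue_def
  proof (intro conjI allI impI)
    show "complex_eigenvalue (all_ones :: real^'n^'n) (complex_of_real (real CARD('n)))"
      unfolding complex_eigenvalue_def
      by (rule exI[of _ "\<chi> i. 1"]) (auto simp: all_ones_def vec_eq_iff)
    fix \<mu> assume "complex_eigenvalue (all_ones :: real^'n^'n) \<mu>"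
    then obtain z :: "complex^'n" where z: "z \<noteq> 0" "\<And>i. (\<Sum>j\<in>UNIV. z $ j) = \<mu> * z $ i"
      unfolding complex_eigenvalue_def by (auto simp: all_ones_def)
    obtain i where i: "z $ i \<noteq> 0" using z(1) by (auto simp: vec_eq_iff)
    \<comment> \<open>Summing the eigenvalue equation over the rows gives N s = \<mu> s for the
      coordinate sum s. If s = 0, the equation in a row with z_i \<noteq> 0 forces \<mu> =
      0.\<close>
    have "(\<Sum>i\<in>(UNIV :: 'n set). \<Sum>j\<in>UNIV. z $ j) = (\<Sum>i\<in>UNIV. \<mu> * z $ i)"
      by (intro sum.cong refl z(2))
    then have "of_nat CARD('n) * (\<Sum>j\<in>UNIV. z $ j) = \<mu> * (\<Sum>j\<in>UNIV. z $ j)"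
      by (simp add: sum_distrib_left)
    then have "\<mu> = of_nat CARD('n) \<or> \<mu> = 0"
      using z(2)[of i] i by auto
    then show "cmod \<mu> \<le> real CARD('n)" by auto
  qed
  moreover have "all_ones *v ?v = real CARD('n) *\<^sub>R ?v"
    by (simp add: vec_eq_iff Av)
  ultimately have "pf_vector (all_ones :: real^'n^'n) = ?v"
    unfolding pf_vector_def
  proof (intro the_equality conjI exI[of _ "real CARD('n)"])
    fix v :: "real^'n"
    assume "(\<forall>i. 0 < v $ i) \<and> (\<Sum>i\<in>UNIV. v $ i) = 1 \<and>
      (\<exists>r. maximal_eigenvalue all_ones r \<and> all_ones *v v = r *\<^sub>R v)"
    then obtain r where v: "(\<Sum>i\<in>UNIV. v $ i) = 1" "all_ones *v v = r *\<^sub>R v" by blast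
    have r: "1 = r * v $ i" for i
      using arg_cong[OF v(2), of "\<lambda>w. w $ i"] by (simp add: Av v(1))
    then have "v $ i = 1 / r" for i by (metis mult_zero_left nonzero_eq_divide_eq mult.commute zero_neq_one)
    with v(1) show "v = ?v" by (simp add: vec_eq_iff)
  qed (auto)
  then show ?thesis by simp
qed

text \<open>Composition with \<open>f\<close> followed by multiplication with the indicator of
  \<open>s\<close>. For bijective \<open>f\<close> these operators are closed under products and
  adjoints and are partial isometries, which makes relation (III) automatic.\<close>

definition weighted_comp :: "('a \<Rightarrow> bool) \<Rightarrow> ('a \<Rightarrow> 'a) \<Rightarrow> 'a bop" where
  "weighted_comp s f = (SOME T. \<forall>x k. coord (app T x) k = (if s k then coord x (f k) else 0))"

lemma coord_weighted_comp:
  assumes "bij f"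
  shows "coord (app (weighted_comp s f) x) k = (if s k then coord x (f k) else 0)"
proof -
  define F where "F x = Abs_ell2 (\<lambda>k. if s k then coord x (f k) else 0)" for x :: "'a ell2"
  have sm: "(\<lambda>k. (cmod (coord (reindex_vec f x) k))\<^sup>2) summable_on UNIV" for x
    by (rule coord_summable)
  have sm': "(\<lambda>k. (cmod (if s k then coord x (f k) else 0))\<^sup>2) summable_on UNIV" for x
    by (rule summable_on_comparison_test[OF sm[of x]]) (auto simp: coord_reindex_vec[OF assms])
  have cF: "coord (F x) k = (if s k then coord x (f k) else 0)" for x k
    unfolding F_def using coord_Abs_ell2[OF sm'] by metis
  have "norm (F x) \<le> 1 * norm x" for x
  proof -
    have "(norm (F x))\<^sup>2 \<le> (norm (reindex_vec f x))\<^sup>2"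
      unfolding norm_ell2_square
      by (rule infsum_mono[OF coord_summable coord_summable]) (auto simp: cF coord_reindex_vec[OF assms])
    then show ?thesis by (simp add: norm_reindex_vec[OF assms] power2_le_iff_abs_le)
  qed
  then have "\<exists>T. \<forall>x. app T x = F x"
    by (intro ex_bop[where K = 1]) (auto intro!: ell2_eqI simp: cF plus_ell2.rep_eq scaleC_ell2.rep_eq)
  then have "\<exists>T. \<forall>x k. coord (app T x) k = (if s k then coord x (f k) else 0)"
    by (metis cF)
  from someI_ex[OF this] show ?thesis unfolding weighted_comp_def by blast
qed

lemma weighted_comp_mult:
  assumes "bij f" "bij g"
  shows "weighted_comp s f * weighted_comp t g = weighted_comp (\<lambda>k. s k \<and> t (f k)) (g \<circ> f)"
  by (rule bop_eqI, rule ell2_eqI)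
     (simp add: app_mult coord_weighted_comp assms bij_comp)

lemma weighted_comp_one: "weighted_comp (\<lambda>_. True) id = 1"
  by (rule bop_eqI, rule ell2_eqI) (simp add: coord_weighted_comp)

lemma weighted_comp_adj:
  assumes "bij f"
  shows "(weighted_comp s f)\<^sup>\<dagger> = weighted_comp (\<lambda>k. s (inv f k)) (inv f)"
proof (rule adj_unique)
  fix x y
  have "cinner (app (weighted_comp (\<lambda>k. s (inv f k)) (inv f)) x) y
      = (\<Sum>\<^sub>\<infinity>k. (if s (inv f k) then cnj (coord x (inv f k)) else 0) * coord y k)"
    by (simp add: cinner_def coord_weighted_comp bij_imp_bij_inv assms if_distrib cong: if_cong)
  also have "\<dots> = (\<Sum>\<^sub>\<infinity>k. (if s (inv f (f k)) then cnj (coord x (inv f (f k))) else 0) * coord y (f k))"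
    by (rule infsum_reindex_bij_betw[OF assms, symmetric])
  also have "\<dots> = cinner x (app (weighted_comp s f) y)"
    unfolding cinner_def by (rule infsum_cong) (simp add: coord_weighted_comp assms inv_f_f bij_is_inj)
  finally show "cinner (app (weighted_comp (\<lambda>k. s (inv f k)) (inv f)) x) y = cinner x (app (weighted_comp s f) y)" .
qed

lemma weighted_comp_range:
  assumes "bij f"
  shows "weighted_comp s f * (weighted_comp s f)\<^sup>\<dagger> = weighted_comp s id"
  using assms by (simp add: weighted_comp_adj weighted_comp_mult bij_imp_bij_inv bij_is_inj inv_f_f)

lemma weighted_comp_source:
  assumes "bij f"
  shows "(weighted_comp s f)\<^sup>\<dagger> * weighted_comp s f = weighted_comp (\<lambda>k. s (inv f k)) id"
  using assms by (simp add: weighted_comp_adj weighted_comp_mult bij_imp_bij_inv surj_iff[THEN iffD1] bij_is_surj)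

lemma weighted_comp_projection: "projection (weighted_comp s id)"
  by (simp add: projection_def weighted_comp_mult weighted_comp_adj)

lemma weighted_comp_partial_isometry:
  assumes "bij f"
  shows "partial_isometry (weighted_comp s f)"
  using assms by (simp add: partial_isometry_def weighted_comp_range weighted_comp_mult)

lemma sum_weighted_comp:
  assumes "finite I" "\<And>k. \<exists>!i. i \<in> I \<and> s i k"
  shows "(\<Sum>i\<in>I. weighted_comp (s i) id) = 1"
proof (rule bop_eqI, rule ell2_eqI)
  fix x k
  obtain i where i: "i \<in> I" "\<And>j. j \<in> I \<Longrightarrow> s j k \<longleftrightarrow> j = i" using assms(2)[of k] by blast
  have "coord (app (\<Sum>i\<in>I. weighted_comp (s i) id) x) k = (\<Sum>j\<in>I. if j = i then coord x k else 0)"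
    unfolding app_sum coord_sum by (intro sum.cong refl) (simp add: coord_weighted_comp i)
  also have "\<dots> = coord x k" using assms(1) i(1) by simp
  finally show "coord (app (\<Sum>i\<in>I. weighted_comp (s i) id) x) k = coord (app 1 x) k" by simp
qed

text \<open>Since \<open>\<sigma>\<close> may vary along the orbits of \<open>f\<close>, any word can be sent to any other word of the same
  length; a single permutation of the letters would preserve the pattern of repeated letters.\<close>

definition shift_rep :: "('a \<Rightarrow> 'n \<Rightarrow> 'n) \<Rightarrow> ('a \<Rightarrow> 'a) \<Rightarrow> 'n \<Rightarrow> 'n \<Rightarrow> 'a bop" where
  "shift_rep \<sigma> f i j = weighted_comp (\<lambda>k. \<sigma> k i = j) f"

lemma shift_rep_prod:
  fixes f :: "'a \<Rightarrow> 'a"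
  assumes "bij f"
  shows "\<exists>s g. bij g \<and> prod_list (map2 (shift_rep \<sigma> f) w y) = weighted_comp s g"
proof -
  have one: "\<exists>s g. bij g \<and> weighted_comp s g = (1 :: 'a bop)"
    by (rule exI[of _ "\<lambda>_. True"], rule exI[of _ id]) (simp only: weighted_comp_one bij_id)
  show ?thesis
  proof (induction w y rule: list_induct2')
    case (4 a w b y)
    then obtain s g where "bij g" "prod_list (map2 (shift_rep \<sigma> f) w y) = weighted_comp s g" by blast
    moreover from this have "bij (g \<circ> f)" using assms by (intro bij_comp)
    ultimately show ?case
      using assms by (intro exI[of _ "\<lambda>k. \<sigma> k a = b \<and> s (f k)"] exI[of _ "g \<circ> f"])
         (simp add: shift_rep_def weighted_comp_mult comp_def)
  qed (simp_all add: one)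
qed

text \<open>The range projections are the indicators of the sets where \<sigma> sends i to j, and
  the source projections are their translates under \<open>f\<close>. As each
  \<open>\<sigma> k\<close> is a bijection, rows and columns partition the index set. In relation
  (II) both sides are full sums, equal to 1.\<close>

lemma quantum_path_family_shift_rep:
  fixes \<sigma> :: "'a \<Rightarrow> 'n::finite \<Rightarrow> 'n"
  assumes f: "bij f" and \<sigma>: "\<And>k. bij (\<sigma> k)"
  shows "quantum_path_family all_ones (shift_rep \<sigma> f)"
proof -
  let ?p = "range_proj (shift_rep \<sigma> f)" and ?q = "source_proj (shift_rep \<sigma> f)"
  have p: "?p i j = weighted_comp (\<lambda>k. \<sigma> k i = j) id" for i j
    by (simp add: range_proj_def shift_rep_def weighted_comp_range f)
  have q: "?q i j = weighted_comp (\<lambda>k. \<sigma> (inv f k) i = j) id" for i j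
    by (simp add: source_proj_def shift_rep_def weighted_comp_source f)
  have inj: "\<exists>!i. \<sigma> k i = j" for k j
    using \<sigma>[of k] by (auto simp: bij_iff)
  have mp: "magic_unitary ?p" and mq: "magic_unitary ?q"
    unfolding magic_unitary_def p q
    by (intro conjI allI weighted_comp_projection sum_weighted_comp; simp add: inj)+
  have "(\<Sum>j\<in>UNIV. c *\<^sub>R ?p i j) = c *\<^sub>R 1" "(\<Sum>j\<in>UNIV. c *\<^sub>R ?q i j) = c *\<^sub>R 1" for c i
    using mp mq by (simp_all add: magic_unitary_def scaleR_sum_right[symmetric])
  moreover have "partial_isometry (prod_list (map2 (shift_rep \<sigma> f) w y))" for w y
    using shift_rep_prod[OF f, of \<sigma> w y] by (auto simp: weighted_comp_partial_isometry)
  moreover have "partial_isometry (shift_rep \<sigma> f i j)" for i j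
    by (simp add: shift_rep_def weighted_comp_partial_isometry f)
  ultimately show ?thesis
    using mp mq by (simp add: quantum_path_family_def Let_def pf_vector_all_ones)
      (simp add: all_ones_def magic_unitary_def)
qed

text \<open>The m-th factor is evaluated at the m-th point of the orbit of \<open>k\<close>. If
  \<sigma> sends the m-th letter of \<open>w\<close> to that of \<open>y\<close> there, no indicator
  cuts anything off, so the product is nonzero.\<close>

lemma coord_shift_rep_prod:
  assumes f: "bij f" and "length w = length y" "\<And>m. m < length w \<Longrightarrow> \<sigma> ((f ^^ m) k) (w ! m) = y ! m"
  shows "coord (app (prod_list (map2 (shift_rep \<sigma> f) w y)) x) k = coord x ((f ^^ length w) k)"
  using assms(2,3)
proof (induction w y arbitrary: k rule: list_induct2)
  case (Cons a w b y)
  have "\<sigma> k a = b" using Cons.prems[of 0] by simp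
  moreover have "coord (app (prod_list (map2 (shift_rep \<sigma> f) w y)) x) (f k) = coord x ((f ^^ length w) (f k))"
  proof (rule Cons.IH)
    fix m assume "m < length w"
    then show "\<sigma> ((f ^^ m) (f k)) (w ! m) = y ! m"
      using Cons.prems[of "Suc m"] by (simp add: funpow_swap1)
  qed
  ultimately show ?case
    by (simp add: shift_rep_def[of _ _ a] app_mult coord_weighted_comp f funpow_swap1)
qed simp

text \<open>The bilateral shift of the integers transported to \<open>nat\<close>, since the
  universal property only tests algebras of type \<open>nat bop set\<close>.\<close>

definition nat_shift :: "nat \<Rightarrow> nat" where
  "nat_shift k = int_encode (int_decode k + 1)"

lemma bij_nat_shift: "bij nat_shift"
  by (rule bij_betw_byWitness[where f' = "\<lambda>k. int_encode (int_decode k - 1)"])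
     (auto simp: nat_shift_def)

lemma nat_shift_funpow: "(nat_shift ^^ m) (int_encode i) = int_encode (i + int m)"
  by (induction m) (simp_all add: nat_shift_def add_ac)

context full_shift_action
begin

lemma universal:
  assumes "quantum_path_family all_ones v"
  shows "\<exists>h. unital_star_hom C (UNIV :: nat bop set) h \<and> (\<forall>i j. h (u i j) = v i j)"
proof -
  have "unital_cstar_algebra (UNIV :: nat bop set)" by (simp add: unital_cstar_algebra_def)
  with assms show ?thesis using quantum_path_algebra unfolding quantum_path_algebra_def by blast
qed

lemma path_proj_nonzero:
  assumes "length w = length y"
  shows "path_proj u w y \<noteq> 0"
proof
  assume 0: "path_proj u w y = 0"
  \<comment> \<open>At the m-th point of the orbit of 0, the letters at position m of
    \<open>w\<close> and \<open>y\<close> are exchanged; beyond the words nothing is moved.\<close>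
  define \<sigma> where "\<sigma> k = (if 0 \<le> int_decode k \<and> nat (int_decode k) < length w
    then Transposition.transpose (w ! nat (int_decode k)) (y ! nat (int_decode k)) else id)" for k
  let ?v = "shift_rep \<sigma> nat_shift"
  have "bij (\<sigma> k)" for k by (auto simp: \<sigma>_def)
  then obtain h where h: "unital_star_hom C (UNIV :: nat bop set) h" "\<And>i j. h (u i j) = ?v i j"
    using universal[OF quantum_path_family_shift_rep[OF bij_nat_shift]] by blast
  have "h (path_proj u w y) = path_proj ?v w y" using assms
  proof (induction w y rule: list_induct2)
    case Nil
    show ?case by (simp add: star_hom_one[OF h(1)])
  next
    case (Cons a w b y)
    then show ?case
      by (simp add: path_proj_Cons star_hom_mult[OF h(1)] star_hom_adj[OF h(1)] h(2) cstar_mult[OF cstar_C]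
          cstar_adj[OF cstar_C] u_in_C path_proj_in_C)
  qed
  then have P0: "path_proj ?v w y = 0" by (simp add: 0 star_hom_zero[OF h(1) cstar_C])
  have "(prod_list (map2 ?v w y))\<^sup>\<dagger> = 0"
    by (rule adj_mult_self_eq_0) (use P0 in \<open>simp add: path_proj_def\<close>)
  then have X0: "prod_list (map2 ?v w y) = 0" by (metis adj_adj adj_zero)
  have "coord (app (prod_list (map2 ?v w y)) x) (int_encode 0)
      = coord x ((nat_shift ^^ length w) (int_encode 0))" for x
    by (rule coord_shift_rep_prod[OF bij_nat_shift assms]) (simp add: nat_shift_funpow \<sigma>_def)
  from this[of "ket ((nat_shift ^^ length w) (int_encode 0))"] show False
    by (simp add: X0 zero_ell2.rep_eq coord_ket)
qed

lemma noncommutative: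
  assumes "CARD('n) \<ge> 2"
  shows "\<exists>a\<in>C. \<exists>b\<in>C. a * b \<noteq> b * a"
proof -
  obtain a b :: 'n where ab: "a \<noteq> b"
    using card_le_Suc0_iff_eq[of "UNIV :: 'n set"] assms by auto
  \<comment> \<open>The letters a and b are exchanged at the orbit point 0 only. Thus u_aa becomes
    the shift cut off at 0, and its range projection the indicator of all other points.\<close>
  define \<sigma> where "\<sigma> k = (if k = int_encode 0 then Transposition.transpose a b else id)" for k
  let ?v = "shift_rep \<sigma> nat_shift"
  have "bij (\<sigma> k)" for k by (auto simp: \<sigma>_def)
  then obtain h where h: "unital_star_hom C (UNIV :: nat bop set) h" "\<And>i j. h (u i j) = ?v i j"
    using universal[OF quantum_path_family_shift_rep[OF bij_nat_shift]] by blast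
  let ?k = "int_encode (-1)" and ?p = "u a a * (u a a)\<^sup>\<dagger>"
  have v: "?v a a = weighted_comp (\<lambda>k. k \<noteq> int_encode 0) nat_shift"
    unfolding shift_rep_def using ab by (intro arg_cong[where f = "\<lambda>s. weighted_comp s nat_shift"])
      (auto simp: \<sigma>_def fun_eq_iff)
  have hp: "h ?p = weighted_comp (\<lambda>k. k \<noteq> int_encode 0) id"
    by (simp add: star_hom_mult[OF h(1)] star_hom_adj[OF h(1)] h(2) u_in_C cstar_adj[OF cstar_C]
        v weighted_comp_range bij_nat_shift)
  have p: "?p \<in> C" by (intro cstar_mult cstar_adj cstar_C u_in_C)
  \<comment> \<open>The shift moves the ket of 0 to -1, where the projection keeps it; in the other
    order the projection kills it first.\<close>
  have "coord (app (h (?p * u a a)) (ket (int_encode 0))) ?k = 1"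
    by (simp add: star_hom_mult[OF h(1) p u_in_C] hp h(2) v app_mult coord_weighted_comp
        bij_nat_shift coord_ket nat_shift_def int_encode_eq)
  moreover have "coord (app (h (u a a * ?p)) (ket (int_encode 0))) ?k = 0"
    by (simp add: star_hom_mult[OF h(1) u_in_C p] hp h(2) v app_mult coord_weighted_comp
        bij_nat_shift coord_ket nat_shift_def int_encode_eq)
  ultimately have "?p * u a a \<noteq> u a a * ?p" by auto
  with p u_in_C show ?thesis by blast
qed

section \<open>Ergodicity\<close>

lemma almost_fixed_almost_constant:
  assumes "length w = length y" "length w = n"
    and "norm (\<phi> (\<Sum>w\<in>words n. c w *\<^sub>C cyl S w) - 1 \<otimes> (\<Sum>w\<in>words n. c w *\<^sub>C cyl S w)) \<le> e"
  shows "cmod (c w - c y) \<le> e"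
proof -
  let ?g = "\<Sum>w\<in>words n. c w *\<^sub>C cyl S w" and ?P = "path_proj u"
  let ?Q = "?P w y \<otimes> cyl S y"
  \<comment> \<open>Left multiplication by \<open>?Q\<close> selects a single term in two stages:
    the second leg forces z = y, then orthogonality within the column y forces v = w.\<close>
  have yz: "cyl S y * cyl S z = (if z = y then cyl S y else 0)" if "z \<in> words n" for z
    using that assms(1,2) orthogonal[of y z] projectionD(1)[OF proj, of y] by auto
  have wv: "?P w y * ?P v y = (if v = w then ?P w y else 0)" if "v \<in> words n" for v
    using that assms(1,2) path_proj_orthogonal_left[of v y w]
      path_proj_orthogonal_left[of w y v] projectionD(1)[OF projection_path_proj[OF assms(1)]] by auto
  have "\<phi> ?g = (\<Sum>v\<in>words n. c v *\<^sub>C (\<Sum>z\<in>words n. ?P v z \<otimes> cyl S z))"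
    by (simp add: star_hom_sum[OF \<phi>_hom unital_cstar_algebra] star_hom_scaleC[OF \<phi>_hom]
        cstar_scaleC[OF unital_cstar_algebra] E_in_algebra \<phi>_cyl_full)
  then have "?Q * \<phi> ?g = (\<Sum>v\<in>words n. c v *\<^sub>C (\<Sum>z\<in>words n. (?P w y * ?P v z) \<otimes> (cyl S y * cyl S z)))"
    by (simp add: sum_distrib_left scaleC_mult_right tensor_mult)
  also have "\<dots> = (\<Sum>v\<in>words n. if v = w then c w *\<^sub>C ?Q else 0)"
  proof (rule sum.cong)
    fix v assume v: "v \<in> (words n :: 'n list set)"
    have "(\<Sum>z\<in>words n. (?P w y * ?P v z) \<otimes> (cyl S y * cyl S z))
        = (\<Sum>z\<in>words n. if z = y then (?P w y * ?P v y) \<otimes> cyl S y else 0)"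
      by (intro sum.cong refl) (simp add: yz)
    also have "\<dots> = (?P w y * ?P v y) \<otimes> cyl S y"
      using assms(1,2) by (simp add: finite_words)
    also have "?P w y * ?P v y = (if v = w then ?P w y else 0)"
      by (rule wv[OF v])
    finally show "c v *\<^sub>C (\<Sum>z\<in>words n. (?P w y * ?P v z) \<otimes> (cyl S y * cyl S z))
        = (if v = w then c w *\<^sub>C ?Q else 0)"
      by simp
  qed simp
  also have "\<dots> = c w *\<^sub>C ?Q"
    using assms(2) by (simp add: finite_words)
  finally have 1: "?Q * \<phi> ?g = c w *\<^sub>C ?Q" .
  have "cyl S y * ?g = (\<Sum>z\<in>words n. if z = y then c y *\<^sub>C cyl S y else 0)"
    unfolding sum_distrib_left scaleC_mult_right
    by (intro sum.cong refl) (simp add: yz)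
  also have "\<dots> = c y *\<^sub>C cyl S y"
    using assms(1,2) by (simp add: finite_words)
  finally have 2: "?Q * (1 \<otimes> ?g) = c y *\<^sub>C ?Q"
    by (simp add: tensor_mult tensor_scaleC_right)
  have "?Q * (\<phi> ?g - 1 \<otimes> ?g) = (c w - c y) *\<^sub>C ?Q"
    by (simp add: 1 2 right_diff_distrib complex_vector.scale_left_diff_distrib)
  then have "cmod (c w - c y) * norm ?Q = norm (?Q * (\<phi> ?g - 1 \<otimes> ?g))"
    by (simp add: norm_scaleC_bop)
  also have "\<dots> \<le> norm ?Q * norm (\<phi> ?g - 1 \<otimes> ?g)"
    by (rule norm_mult_ineq)
  also have "\<dots> \<le> norm ?Q * e"
    by (intro mult_left_mono assms(3)) simp
  finally have "cmod (c w - c y) * norm ?Q \<le> e * norm ?Q" by (simp add: mult.commute)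
  \<comment> \<open>The norm of \<open>?Q\<close> cancels, so the estimate does not deteriorate with
    the length of the words; the limit argument for general fixed elements rests on this.\<close>
  moreover have "?Q \<noteq> 0" by (intro tensor_nonzero path_proj_nonzero assms(1) nonzero)
  ultimately show ?thesis by simp
qed

lemma ergodic: "{f \<in> algebra. \<phi> f = 1 \<otimes> f} = {c *\<^sub>C 1 |c. True}"
proof (rule antisym)
  note alg = unital_cstar_algebra
  show "{c *\<^sub>C 1 |c. True} \<subseteq> {f \<in> algebra. \<phi> f = 1 \<otimes> f}"
    by (auto simp: cstar_scaleC[OF alg] cstar_one[OF alg] star_hom_scaleC[OF \<phi>_hom]
        star_hom_one[OF \<phi>_hom] tensor_scaleC_right)
  show "{f \<in> algebra. \<phi> f = 1 \<otimes> f} \<subseteq> {c *\<^sub>C 1 |c. True}"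
  proof clarify
    fix f assume f: "f \<in> algebra" and fixed: "\<phi> f = 1 \<otimes> f"
    obtain X where X: "\<forall>n. X n \<in> cspan (range (cyl S))" "X \<longlonglongrightarrow> f"
      using closure_seqD[OF f[unfolded algebra_def]] by blast
    have Xa: "X n \<in> algebra" for n
      unfolding algebra_def by (rule subsetD[OF closure_subset X(1)[rule_format]])
    have "\<exists>a. norm (X n - a *\<^sub>C 1) \<le> 2 * norm (X n - f)" for n
    proof -
      obtain m c where c: "X n = (\<Sum>w\<in>words m. c w *\<^sub>C cyl S w)"
        using span_levelD[OF X(1)[rule_format]] by blast
      \<comment> \<open>The fixed element \<open>f\<close> cancels, and \<phi> and tensoring with 1
        each contribute at most \<open>norm (X n - f)\<close>: hence the factor 2.\<close>
      have "\<phi> (X n) - 1 \<otimes> X n = \<phi> (X n - f) - 1 \<otimes> (X n - f)"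
        by (simp add: star_hom_diff[OF \<phi>_hom alg Xa f] fixed tensor_diff_right)
      also have "norm \<dots> \<le> norm (\<phi> (X n - f)) + norm ((1 :: 'a bop) \<otimes> (X n - f))"
        by (rule norm_triangle_ineq4)
      also have "\<dots> \<le> norm (X n - f) + norm (X n - f)"
        using norm_tensor_le[of "1 :: 'a bop" "X n - f"]
        by (intro add_mono star_hom_contractive[OF alg \<phi>_hom] cstar_diff[OF alg] Xa f) simp
      finally have e: "norm (\<phi> (X n) - 1 \<otimes> X n) \<le> 2 * norm (X n - f)" by simp
      \<comment> \<open>Any word of length \<open>m\<close> would do as reference; its coefficient
        is the scalar that approximates \<open>X n\<close>.\<close>
      define y :: "'n list" where "y = replicate m undefined"
      have y: "length y = m" by (simp add: y_def)
      have "X n - c y *\<^sub>C 1 = (\<Sum>w\<in>words m. (c w - c y) *\<^sub>C cyl S w)"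
        unfolding c sum_words[of m, symmetric]
        by (simp only: complex_vector.scale_sum_right sum_subtractf complex_vector.scale_left_diff_distrib)
      also have "norm \<dots> \<le> 2 * norm (X n - f)"
      proof (rule norm_scaleC_sum_le)
        fix w assume "w \<in> (words m :: 'n list set)"
        then show "cmod (c w - c y) \<le> 2 * norm (X n - f)"
          using y e unfolding c by (intro almost_fixed_almost_constant[of w y m c]) auto
      qed simp
      finally show ?thesis by blast
    qed
    then have "\<forall>n. \<exists>a. norm (X n - a *\<^sub>C 1) \<le> 2 * norm (X n - f)" by blast
    then obtain a where a: "\<forall>n. norm (X n - a n *\<^sub>C 1) \<le> 2 * norm (X n - f)"
      using choice[of "\<lambda>n a. norm (X n - a *\<^sub>C 1) \<le> 2 * norm (X n - f)"] by blast
    have "(\<lambda>n. norm (X n - f)) \<longlonglongrightarrow> 0"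
      using X(2) by (simp add: LIM_zero_iff tendsto_norm_zero_iff)
    then have "(\<lambda>n. 2 * norm (X n - f)) \<longlonglongrightarrow> 0" by (rule tendsto_mult_right_zero)
    then have "(\<lambda>n. X n - a n *\<^sub>C 1) \<longlonglongrightarrow> 0"
      by (rule Lim_null_comparison[rotated]) (simp add: a)
    from tendsto_diff[OF X(2) this] have lim: "(\<lambda>n. a n *\<^sub>C 1) \<longlonglongrightarrow> f" by simp
    \<comment> \<open>The multiples of 1 are an isometric copy of the complex numbers, so the
      approximating scalars converge as well.\<close>
    have "cmod (a m - a n) = norm (a m *\<^sub>C 1 - a n *\<^sub>C (1 :: 'b bop))" for m n
      by (simp add: norm_scaleC_bop flip: complex_vector.scale_left_diff_distrib)
    then have "Cauchy a"
      using LIMSEQ_imp_Cauchy[OF lim] unfolding Cauchy_def dist_norm by simp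
    then obtain l where l: "a \<longlonglongrightarrow> l" using Cauchy_convergent convergent_def by blast
    have "(\<lambda>n. (a n - l) *\<^sub>C (1 :: 'b bop)) \<longlonglongrightarrow> 0"
      by (rule tendsto_norm_zero_cancel)
         (use l in \<open>simp add: norm_scaleC_bop LIM_zero_iff tendsto_norm_zero_iff\<close>)
    then have "(\<lambda>n. a n *\<^sub>C (1 :: 'b bop)) \<longlonglongrightarrow> l *\<^sub>C 1"
      by (simp add: complex_vector.scale_left_diff_distrib LIM_zero_iff)
    then show "\<exists>c. f = c *\<^sub>C 1 \<and> True" using LIMSEQ_unique[OF lim] by blast
  qed
qed

end

theorem theorem3:
  fixes A :: "real^'n^'n"
    and C :: "'a bop set" and u :: "'n \<Rightarrow> 'n \<Rightarrow> 'a bop" and \<Phi> :: "'a bop \<Rightarrow> ('a \<times> 'a) bop"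
    and O\<^sub>A :: "'b bop set" and S :: "'n \<Rightarrow> 'b bop" and \<phi> :: "'b bop \<Rightarrow> ('a \<times> 'b) bop"
  assumes "CARD('n) \<ge> 2"
    and "zero_one_matrix A" and "primitive_matrix A"
    and "quantum_path_algebra A C u"
    and "matrix_comultiplication C u \<Phi>"
    and "cuntz_krieger_algebra A O\<^sub>A S"
    and "unital_star_hom O\<^sub>A (C \<otimes>\<^sub>m O\<^sub>A) \<phi>"
    and "\<forall>i. \<phi> (S i) = (\<Sum>j\<in>UNIV. u i j \<otimes> S j)"
  shows "\<phi> ` path_space_algebra A S \<subseteq> C \<otimes>\<^sub>m path_space_algebra A S \<and>
    (A = all_ones \<longrightarrow>
       compact_matrix_quantum_group C u \<Phi> \<and>
       (\<exists>a\<in>C. \<exists>b\<in>C. a * b \<noteq> b * a) \<and>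
       quantum_action C \<Phi> (path_space_algebra A S) \<phi> \<and>
       {f \<in> path_space_algebra A S. \<phi> f = 1 \<otimes> f} = {c *\<^sub>C 1 | c. True})"
proof -
  have action: "path_action A C u O\<^sub>A S \<phi>"
    using assms by (simp add: path_action_def)
  show ?thesis
  proof (intro conjI impI)
    show "\<phi> ` path_space_algebra A S \<subseteq> C \<otimes>\<^sub>m path_space_algebra A S"
      by (rule path_action.\<phi>_path_space_algebra[OF action])
  next
    assume A: "A = all_ones"
    have "full_shift_action C u O\<^sub>A S \<phi> \<Phi>"
      using action assms(5) by (simp add: A full_shift_action_def full_shift_action_axioms_def)
    then interpret full_shift_action C u O\<^sub>A S \<phi> \<Phi> .
    show "compact_matrix_quantum_group C u \<Phi>" by (rule compact_matrix_quantum_group)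
    show "\<exists>a\<in>C. \<exists>b\<in>C. a * b \<noteq> b * a" by (rule noncommutative[OF assms(1)])
    show "quantum_action C \<Phi> (path_space_algebra A S) \<phi>"
      unfolding A path_space_algebra by (rule quantum_action)
    show "{f \<in> path_space_algebra A S. \<phi> f = 1 \<otimes> f} = {c *\<^sub>C 1 |c. True}"
      unfolding A path_space_algebra by (rule ergodic)
  qed
qed

end
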